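(* Let $\varepsilon>0$, let $K(x,y)=\exp(-\tfrac12\varepsilon^2(x-y)^2)$ be the Gaussian kernel on $[-1,1]\times[-1,1]$, and let $p\in\{2,\infty\}$ (with $1/p=0$ if $p=\infty$). Set $$c_{1,\infty}=\sqrt{\frac{2}{1+\varepsilon^2}}\,e^{-\frac1{32}\varepsilon^4}e^{-\frac12\varepsilon^2},\qquad c_{1,2}=\frac{2\sqrt{2\pi}}{3e^3\sqrt{3(4+\varepsilon^2)}}\,e^{-\frac1{32}\varepsilon^4}e^{-\frac12\varepsilon^2},$$ $$c_{2,\infty}=\sqrt{c_L(\varepsilon^2)},\qquad c_{2,2}=\sqrt{2c_L(\varepsilon^2)}.$$ If $x_1,\dots,x_n\in[-1,1]$ are distinct, then $$c_{1,p}\Big(\frac{\varepsilon}{2}\Big)^n(n!)^{-1/2}\le e_p^{\min}(x_1,\dots,x_n)\le c_{2,p}\,n^{-1/8-1/p}e^{\varepsilon\sqrt n}(2\varepsilon)^n(n!)^{-1/2},$$ $$c_{1,p}\Big(\frac{\varepsilon}{2}\Big)^n(n!)^{-1/2}\le e_p^{\min}(n)\le 2c_{2,p}\,n^{-1/8}e^{\varepsilon\sqrt n}\Big(\frac{\varepsilon}{2}\Big)^n(n!)^{-1/2},$$ and, for every $x\in[-1,1]\setminus\{x_1,\dots,x_n\}$, $$c_{1,\infty}\Big(\frac{\varepsilon}{4}\Big)^n(n!)^{-1/2}\le\frac{e^{\min}(x\mid x_1,\dots,x_n)}{|\prod_{k=1}^n(x-x_k)|}\le c_{2,p}\,n^{-1/8}e^{\varepsilon\sqrt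 n}\varepsilon^n(n!)^{-1/2},$$ where all lower bounds hold when $n\ge1$ and all upper bounds hold when $n\ge m_L(\varepsilon^2)$.
   Context: $H(K)$ is the reproducing kernel Hilbert space of $K$ (functions on $[-1,1]$), with norm $\|\cdot\|_K$; $L^p=L^p([-1,1])$ with norm $\|\cdot\|_p$. The worst-case errors are $$e_p^{\min}(x_1,\dots,x_n)=\inf_{\psi_1,\dots,\psi_n\in L^p}\ \sup_{0\ne f\in H(K)}\frac{\|f-\sum_{k=1}^n f(x_k)\psi_k\|_p}{\|f\|_K},\qquad e_p^{\min}(n)=\inf_{x_1,\dots,x_n\in[-1,1]}e_p^{\min}(x_1,\dots,x_n),$$ $$e^{\min}(x\mid x_1,\dots,x_n)=\inf_{u_1,\dots,u_n\in\mathbb R}\ \sup_{0\ne f\in H(K)}\frac{|f(x)-\sum_{k=1}^n f(x_k)u_k|}{\|f\|_K}.$$ For $\lambda>0$, $$c_L(\lambda)=\frac{e^{\frac12\lambda+2\sqrt\lambda}}{2\sqrt\pi\,\lambda^{1/4}}\Big(3+\sqrt{\tfrac{\pi}{e}}+\frac{2}{\sqrt\pi\,\lambda^{1/4}}+\frac{7}{16\sqrt\lambda}+\sqrt\lambda\,(2+\lambda)\Big),\qquad m_L(\lambda)=\max\Big\{5\lambda,\ \lambda\Big(1+\frac\lambda2\Big)^2,\ \frac9\lambda\Big\}.$$ *)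

theory Defs
  imports "HOL-Analysis.Analysis" "HOL-Probability.Essential_Supremum"
begin

(* Functions on X are represented by functions on the whole type that vanish off X, so that
   equality of representatives is equality on X.  By the Moore-Aronszajn theorem the pair
   (H, inner product on H) is uniquely determined by X and K. *)
locale rkhs =
  fixes X :: "'a set"
    and K :: "'a \<Rightarrow> 'a \<Rightarrow> real"
    and H :: "('a \<Rightarrow> real) set"
    and ip :: "('a \<Rightarrow> real) \<Rightarrow> ('a \<Rightarrow> real) \<Rightarrow> real"
  assumes supported: "f \<in> H \<Longrightarrow> t \<notin> X \<Longrightarrow> f t = 0"
    and zero_mem: "(\<lambda>t. 0) \<in> H"
    and add_mem: "f \<in> H \<Longrightarrow> g \<in> H \<Longrightarrow> (\<lambda>t. f t + g t) \<in> H"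
    and scale_mem: "f \<in> H \<Longrightarrow> (\<lambda>t. c * f t) \<in> H"
    and ip_sym: "f \<in> H \<Longrightarrow> g \<in> H \<Longrightarrow> ip f g = ip g f"
    and ip_add: "f \<in> H \<Longrightarrow> g \<in> H \<Longrightarrow> h \<in> H \<Longrightarrow> ip (\<lambda>t. f t + g t) h = ip f h + ip g h"
    and ip_scale: "f \<in> H \<Longrightarrow> h \<in> H \<Longrightarrow> ip (\<lambda>t. c * f t) h = c * ip f h"
    and ip_nonneg: "f \<in> H \<Longrightarrow> 0 \<le> ip f f"
    and ip_definite: "f \<in> H \<Longrightarrow> ip f f = 0 \<Longrightarrow> f = (\<lambda>t. 0)"
    and complete:
      "(\<And>n::nat. F n \<in> H) \<Longrightarrow>
       (\<And>e. e > 0 \<Longrightarrow> \<exists>N. \<forall>m\<ge>N. \<forall>n\<ge>N.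
          sqrt (ip (\<lambda>t. F m t - F n t) (\<lambda>t. F m t - F n t)) < e) \<Longrightarrow>
       \<exists>f\<in>H. (\<lambda>n. sqrt (ip (\<lambda>t. F n t - f t) (\<lambda>t. F n t - f t))) \<longlonglongrightarrow> 0"
    and section_mem: "y \<in> X \<Longrightarrow> (\<lambda>t. if t \<in> X then K t y else 0) \<in> H"
    and reproducing: "f \<in> H \<Longrightarrow> y \<in> X \<Longrightarrow> ip f (\<lambda>t. if t \<in> X then K t y else 0) = f y"

definition gaussian_kernel :: "real \<Rightarrow> real \<Rightarrow> real \<Rightarrow> real" where
  "gaussian_kernel \<epsilon> x y = exp (- (1/2) * \<epsilon>^2 * (x - y)^2)"

(* The L^p norm, for an extended exponent p in [1, \<infinity>], with values in [0, \<infinity>]. *)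
definition Lp_norm :: "'a measure \<Rightarrow> ennreal \<Rightarrow> ('a \<Rightarrow> real) \<Rightarrow> ennreal" where
  "Lp_norm M p f =
    (if p = \<infinity> then esssup M (\<lambda>t. ennreal \<bar>f t\<bar>)
     else let I = (\<integral>\<^sup>+ t. ennreal (\<bar>f t\<bar> powr enn2real p) \<partial>M)
          in if I = \<infinity> then \<infinity> else ennreal (enn2real I powr (1 / enn2real p)))"

definition Lp_space :: "'a measure \<Rightarrow> ennreal \<Rightarrow> ('a \<Rightarrow> real) set" where
  "Lp_space M p = {f \<in> borel_measurable M. Lp_norm M p f < \<infinity>}"

abbreviation leb :: "real measure" where
  "leb \<equiv> lebesgue_on {-1..1}"

definition emin_points ::
  "(real \<Rightarrow> real) set \<Rightarrow> ((real \<Rightarrow> real) \<Rightarrow> (real \<Rightarrow> real) \<Rightarrow> real) \<Rightarrow> ennreal \<Rightarrow> nat \<Rightarrow> (nat \<Rightarrow> real) \<Rightarrow> ennreal"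
  where
  "emin_points H ip p n x =
    (INF \<psi> \<in> {\<psi>. \<forall>k\<in>{1..n}. \<psi> k \<in> Lp_space leb p}.
       SUP f \<in> H - {\<lambda>t. 0}.
         Lp_norm leb p (\<lambda>t. f t - (\<Sum>k=1..n. f (x k) * \<psi> k t)) / ennreal (sqrt (ip f f)))"

definition emin ::
  "(real \<Rightarrow> real) set \<Rightarrow> ((real \<Rightarrow> real) \<Rightarrow> (real \<Rightarrow> real) \<Rightarrow> real) \<Rightarrow> ennreal \<Rightarrow> nat \<Rightarrow> ennreal" where
  "emin H ip p n = (INF x \<in> {x. \<forall>k\<in>{1..n}. x k \<in> {-1..1}}. emin_points H ip p n x)"

definition emin_at ::
  "(real \<Rightarrow> real) set \<Rightarrow> ((real \<Rightarrow> real) \<Rightarrow> (real \<Rightarrow> real) \<Rightarrow> real) \<Rightarrow> nat \<Rightarrow> (nat \<Rightarrow> real) \<Rightarrow> real \<Rightarrow> ennreal"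
  where
  "emin_at H ip n x t =
    (INF u \<in> (UNIV :: (nat \<Rightarrow> real) set).
       SUP f \<in> H - {\<lambda>t. 0}.
         ennreal \<bar>f t - (\<Sum>k=1..n. f (x k) * u k)\<bar> / ennreal (sqrt (ip f f)))"

definition c_L :: "real \<Rightarrow> real" where
  "c_L l = exp (l / 2 + 2 * sqrt l) / (2 * sqrt pi * l powr (1/4)) *
     (3 + sqrt (pi / exp 1) + 2 / (sqrt pi * l powr (1/4)) + 7 / (16 * sqrt l)
        + sqrt l * (2 + l))"

definition m_L :: "real \<Rightarrow> real" where
  "m_L l = Max {5 * l, l * (1 + l / 2)^2, 9 / l}"

(* The constants c_{1,p} and c_{2,p} are only meaningful for p = 2 and p = \<infinity>. *)
definition c1 :: "ennreal \<Rightarrow> real \<Rightarrow> real" where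
  "c1 p \<epsilon> =
    (if p = \<infinity>
     then sqrt (2 / (1 + \<epsilon>^2)) * exp (- (1/32) * \<epsilon>^4) * exp (- (1/2) * \<epsilon>^2)
     else 2 * sqrt (2 * pi) / (3 * exp 3 * sqrt (3 * (4 + \<epsilon>^2)))
            * exp (- (1/32) * \<epsilon>^4) * exp (- (1/2) * \<epsilon>^2))"

definition c2 :: "ennreal \<Rightarrow> real \<Rightarrow> real" where
  "c2 p \<epsilon> = (if p = \<infinity> then sqrt (c_L (\<epsilon>^2)) else sqrt (2 * c_L (\<epsilon>^2)))"

definition recip :: "ennreal \<Rightarrow> real" where
  "recip p = (if p = \<infinity> then 0 else 1 / enn2real p)"

end

theory Submission
  imports Defs "HOL-Computational_Algebra.Polynomial" "HOL-Probability.Distributions"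
begin

text \<open>
  Write \<open>\<lambda> = \<epsilon>\<^sup>2\<close>. The Gaussian kernel factors as
  \<open>exp (- \<lambda> x\<^sup>2 / 2) * exp (- \<lambda> y\<^sup>2 / 2) * exp (\<lambda> x y)\<close>, and the power series of the last factor
  shows that the functions \<open>exp (- \<lambda> x\<^sup>2 / 2) * x ^ j\<close> are orthogonal in the Gaussian space, with
  squared norms \<open>j! / \<lambda> ^ j\<close>. Up to the weight \<open>exp (- \<lambda> x\<^sup>2 / 2)\<close>, which lies between
  \<open>exp (- \<lambda> / 2)\<close> and \<open>1\<close>, the problem is therefore one about power series, and polynomial
  interpolation at the nodes is a good sampling method.

  \<^bold>\<open>Upper bounds.\<close> The polynomial that interpolates \<open>exp (\<lambda> x\<^sup>2 / 2) * f x\<close> at the nodes depends linearly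
  on the samples of \<open>f\<close>, and the norm of its error functional at \<open>t\<close> is determined by the interpolation
  errors of the monomials: its square is at most \<open>\<Sum>j. \<lambda> ^ j / j! * e j\<^sup>2\<close>, where \<open>e j\<close> is the error
  for \<open>x ^ j\<close> (lemma \<open>interpolation_error\<close>). That error is \<open>\<Prod>k. (t - x k)\<close> times a divided
  difference, which on \<open>[-1, 1]\<close> is at most the binomial coefficient \<open>j choose n\<close>
  (\<open>monomial_interpolation_error\<close>). What remains is a scalar series,
  \<open>\<lambda> ^ n / n! * (\<Sum>i. (n + i)! / (n! i!\<^sup>2) * \<lambda> ^ i)\<close>. The inner sum is the expectation of the Bessel
  function \<open>I\<^sub>0 (2 * sqrt (\<lambda> T))\<close> for a Gamma-distributed \<open>T\<close> of mean \<open>n + 1\<close>. Bounding \<open>I\<^sub>0 c\<close> by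
  \<open>exp c / (2 * sqrt c)\<close>, and \<open>2 * sqrt (\<lambda> T)\<close> by its tangent at \<open>T = n\<close>, turns the
  expectation into an elementary one with the right growth
  \<open>n powr (-1/4) * exp (2 * sqrt (\<lambda> n))\<close> (\<open>kummer_series_le\<close>, \<open>kummer_constant_le\<close>). The upper
  bounds then differ only in how the node polynomial is measured: by \<open>2 ^ n\<close> for arbitrary nodes, by
  \<open>2 * 2 powr - n\<close> for Chebyshev nodes, or by its \<open>L\<^sup>2\<close> norm.

  \<^bold>\<open>Lower bounds.\<close> If \<open>W\<close> is the node polynomial, then \<open>exp (- \<lambda> x\<^sup>2 / 2) * W x\<close> lies in the space
  and vanishes at every node, so no sampling method can distinguish it from zero and its own norm
  quotient is a lower bound for the error. Membership is proved from completeness alone: the weighted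
  monomial is a limit of divided differences of kernel sections (\<open>monomial_feature\<close>). It remains to
  bound the Gaussian norm of a polynomial of degree \<open>n\<close> by its size on \<open>[-1, 1]\<close>. The polynomial is
  expanded in Chebyshev polynomials of the second kind. Their coefficients are explicit and give their
  Gaussian norms (\<open>weighted_norm_le_expansion\<close>), while the orthogonality of sines bounds the
  expansion coefficients, in its discrete form by the supremum norm (\<open>expansion_le_sup\<close>) and in its
  continuous form by the \<open>L\<^sup>2\<close> norm (\<open>expansion_le_integral\<close>).
\<close>

section \<open>Bilinear algebra in a reproducing kernel Hilbert space\<close>

context rkhs
begin

lemma minus_mem:
  assumes "f \<in> H" "g \<in> H"
  shows "(\<lambda>t. f t - g t) \<in> H"
  using add_mem[OF assms(1) scale_mem[OF assms(2), of "-1"]] by simp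

lemma sum_mem:
  assumes "finite I" "\<And>i. i \<in> I \<Longrightarrow> f i \<in> H"
  shows "(\<lambda>t. \<Sum>i\<in>I. c i * f i t) \<in> H"
  using assms
proof (induction I rule: finite_induct)
  case empty
  then show ?case using zero_mem by simp
next
  case (insert i I)
  have "(\<lambda>t. c i * f i t + (\<Sum>i\<in>I. c i * f i t)) \<in> H"
    using insert by (intro add_mem scale_mem) auto
  then show ?case using insert by simp
qed

lemma ip_sum_left:
  assumes "finite I" "\<And>i. i \<in> I \<Longrightarrow> f i \<in> H" "h \<in> H"
  shows "ip (\<lambda>t. \<Sum>i\<in>I. c i * f i t) h = (\<Sum>i\<in>I. c i * ip (f i) h)"
  using assms
proof (induction I rule: finite_induct)
  case empty
  have "ip (\<lambda>t. 0 * (\<lambda>t. 0) t) h = 0 * ip (\<lambda>t. 0) h"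
    using zero_mem empty by (intro ip_scale) auto
  then show ?case by simp
next
  case (insert i I)
  have "ip (\<lambda>t. c i * f i t + (\<Sum>i\<in>I. c i * f i t)) h
      = ip (\<lambda>t. c i * f i t) h + ip (\<lambda>t. \<Sum>i\<in>I. c i * f i t) h"
    using insert by (intro ip_add scale_mem sum_mem) auto
  then show ?case using insert by (simp add: ip_scale)
qed

lemma ip_sum_right:
  assumes "finite I" "\<And>i. i \<in> I \<Longrightarrow> f i \<in> H" "h \<in> H"
  shows "ip h (\<lambda>t. \<Sum>i\<in>I. c i * f i t) = (\<Sum>i\<in>I. c i * ip h (f i))"
proof -
  have "ip h (\<lambda>t. \<Sum>i\<in>I. c i * f i t) = ip (\<lambda>t. \<Sum>i\<in>I. c i * f i t) h"
    using assms by (intro ip_sym sum_mem) auto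
  then show ?thesis using assms ip_sum_left[OF assms] ip_sym by simp
qed

lemma ip_scale_right: "f \<in> H \<Longrightarrow> h \<in> H \<Longrightarrow> ip h (\<lambda>t. c * f t) = c * ip h f"
  by (metis ip_scale ip_sym scale_mem)

lemma ip_minus_left:
  assumes "f \<in> H" "g \<in> H" "h \<in> H"
  shows "ip (\<lambda>t. f t - g t) h = ip f h - ip g h"
  using ip_add[OF assms(1) scale_mem[OF assms(2), of "-1"] assms(3)] ip_scale[OF assms(2,3), of "-1"]
  by simp

lemma ip_minus_right:
  assumes "f \<in> H" "g \<in> H" "h \<in> H"
  shows "ip h (\<lambda>t. f t - g t) = ip h f - ip h g"
  using ip_minus_left[OF assms] ip_sym minus_mem assms by metis

lemma ip_minus_self:
  assumes "f \<in> H" "g \<in> H"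
  shows "ip (\<lambda>t. f t - g t) (\<lambda>t. f t - g t) = ip f f - 2 * ip f g + ip g g"
  using assms by (simp add: ip_minus_left ip_minus_right minus_mem ip_sym[of g f])

lemma Cauchy_Schwarz:
  assumes f: "f \<in> H" and g: "g \<in> H"
  shows "\<bar>ip f g\<bar> \<le> sqrt (ip f f) * sqrt (ip g g)"
proof -
  have *: "0 \<le> ip f f - 2 * (c * ip f g) + c * (c * ip g g)" for c
    using ip_nonneg[OF minus_mem[OF f scale_mem[OF g, of c]]]
    by (simp add: ip_minus_self f g scale_mem ip_scale_right ip_scale)
  have "(ip f g)\<^sup>2 \<le> ip f f * ip g g"
  proof (cases "ip g g = 0")
    case True
    then have "g = (\<lambda>t. 0)" using ip_definite g by blast
    then have "ip f g = 0" using ip_sum_right[of "{}" undefined f] f by simp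
    then show ?thesis using True by simp
  next
    case False
    then have pos: "ip g g > 0" using ip_nonneg[OF g] by simp
    have "0 \<le> ip f f - (ip f g)\<^sup>2 / ip g g"
      using *[of "ip f g / ip g g"] pos by (simp add: field_simps power2_eq_square)
    then show ?thesis using pos by (simp add: field_simps)
  qed
  then have "sqrt ((ip f g)\<^sup>2) \<le> sqrt (ip f f * ip g g)" by (rule real_sqrt_le_mono)
  then show ?thesis by (simp add: real_sqrt_mult)
qed

lemma ip_tendsto:
  assumes h: "\<And>N::nat. h N \<in> H" and f: "f \<in> H" and g: "g \<in> H"
    and lim: "(\<lambda>N. sqrt (ip (\<lambda>t. h N t - f t) (\<lambda>t. h N t - f t))) \<longlonglongrightarrow> 0"
  shows "(\<lambda>N. ip g (h N)) \<longlonglongrightarrow> ip g f"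
proof -
  have "(\<lambda>N. sqrt (ip g g) * sqrt (ip (\<lambda>t. h N t - f t) (\<lambda>t. h N t - f t))) \<longlonglongrightarrow> 0"
    using tendsto_mult_right_zero[OF lim] .
  moreover have "norm (ip g (h N) - ip g f) \<le> sqrt (ip g g) * sqrt (ip (\<lambda>t. h N t - f t) (\<lambda>t. h N t - f t))" for N
    using Cauchy_Schwarz[OF g minus_mem[OF h f]] ip_minus_right[OF h f g] by simp
  ultimately have "(\<lambda>N. ip g (h N) - ip g f) \<longlonglongrightarrow> 0"
    by (intro Lim_null_comparison[of "\<lambda>N. ip g (h N) - ip g f"]) auto
  then show ?thesis by (simp add: LIM_zero_iff)
qed

end

section \<open>Divided differences of monomials\<close>

text \<open>
  The divided difference of \<open>x ^ j\<close> at the points of a list, equivalently the complete homogeneous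
  symmetric polynomial of degree \<open>j + 1 - length xs\<close> in these points. The recursion in \<open>j\<close> is the
  Leibniz rule for \<open>x * x ^ j\<close> and involves no division by differences of points, so that its terms can be bounded one by one.
\<close>
fun power_dd :: "nat \<Rightarrow> real list \<Rightarrow> real" where
  "power_dd j [] = 0"
| "power_dd 0 (a # xs) = (if xs = [] then 1 else 0)"
| "power_dd (Suc j) (a # xs) = a * power_dd j (a # xs) + power_dd j xs"

lemma power_dd_single: "power_dd j [a] = a ^ j"
  by (induction j) auto

lemma power_dd_difference:
  "(t - a) * power_dd j (t # a # xs) = power_dd j (t # xs) - power_dd j (a # xs)"
proof (induction j)
  case (Suc j)
  have "(t - a) * power_dd (Suc j) (t # a # xs)
      = t * ((t - a) * power_dd j (t # a # xs)) + (t - a) * power_dd j (a # xs)"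
    by (simp add: algebra_simps)
  then show ?case unfolding Suc by (simp add: algebra_simps)
qed auto

text \<open>
  The recursion is Pascal's rule for \<open>j choose length xs\<close>, the number of monomials in the complete
  homogeneous symmetric polynomial.
\<close>
lemma power_dd_le:
  assumes "\<And>b. b \<in> set (a # xs) \<Longrightarrow> \<bar>b\<bar> \<le> r"
  shows "\<bar>power_dd j (a # xs)\<bar> \<le> real (j choose length xs) * r ^ (j - length xs)"
  using assms
proof (induction j arbitrary: a xs)
  case 0
  then show ?case by (cases xs) auto
next
  case (Suc j)
  have r: "0 \<le> r" using Suc.prems[of a] by auto
  have "\<bar>a * power_dd j (a # xs)\<bar> \<le> r * (real (j choose length xs) * r ^ (j - length xs))"
    unfolding abs_mult using Suc.prems by (intro mult_mono Suc.IH) (auto simp: r)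
  also have "\<dots> = real (j choose length xs) * r ^ (Suc j - length xs)"
    by (cases "length xs \<le> j") (auto simp: Suc_diff_le binomial_eq_0)
  finally have 1: "\<bar>a * power_dd j (a # xs)\<bar> \<le> real (j choose length xs) * r ^ (Suc j - length xs)" .
  show ?case
  proof (cases xs)
    case Nil
    then show ?thesis using 1 by simp
  next
    case (Cons b ys)
    have "\<bar>power_dd j xs\<bar> \<le> real (j choose length ys) * r ^ (j - length ys)"
      unfolding Cons using Suc.prems Cons by (intro Suc.IH) auto
    with 1 have "\<bar>power_dd (Suc j) (a # xs)\<bar>
        \<le> (real (j choose length xs) + real (j choose length ys)) * r ^ (Suc j - length xs)"
      using Cons by (simp add: algebra_simps)
    then show ?thesis using Cons by (simp add: algebra_simps)
  qed
qed

text \<open>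
  The divided difference of order \<open>n\<close> of \<open>x ^ n\<close> is its leading coefficient: in the recursion the
  first summand is a divided difference of too high an order and vanishes.
\<close>
lemma power_dd_length: "power_dd (length xs) (a # xs) = 1"
proof (induction xs arbitrary: a)
  case (Cons b ys)
  have "\<bar>power_dd (length ys) (a # b # ys)\<bar> \<le> 0"
    by (intro order.trans[OF power_dd_le[of a "b # ys" "Max (abs ` set (a # b # ys))"]] Max_ge)
      auto
  then show ?case using Cons by simp
qed simp

text \<open>
  Polynomial interpolation with exact error. The weights \<open>u a t\<close> are the Lagrange basis polynomials,
  but they are built node by node: adding the node \<open>a\<close> to \<open>ys\<close> subtracts from the old error at \<open>t\<close> the
  multiple of the old error at \<open>a\<close> that makes it vanish there, and \<open>power_dd_difference\<close> identifies
  the result. All degrees \<open>j\<close> are treated with the same weights, which is what makes the lemma usable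
  termwise in a power series.
\<close>
lemma monomial_interpolation:
  assumes "distinct xs"
  shows "\<exists>u. (\<forall>a. continuous_on UNIV (u a)) \<and>
    (\<forall>t j. t ^ j - (\<Sum>a\<in>set xs. u a t * a ^ j) = (\<Prod>a\<in>set xs. t - a) * power_dd j (t # xs))"
  using assms
proof (induction xs)
  case Nil
  then show ?case by (intro exI[of _ "\<lambda>a t. 0"]) (auto simp: power_dd_single)
next
  case (Cons a ys)
  then obtain u where cont: "\<And>b. continuous_on UNIV (u b)"
    and u: "\<And>t j. t ^ j - (\<Sum>b\<in>set ys. u b t * b ^ j) = (\<Prod>b\<in>set ys. t - b) * power_dd j (t # ys)"
    by auto
  define w where "w t = (\<Prod>b\<in>set ys. t - b)" for t
  have wa: "w a \<noteq> 0" using Cons.prems by (auto simp: w_def)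
  define v where "v b t = (if b = a then w t / w a else u b t - w t / w a * u b a)" for b t
  have "continuous_on UNIV (v b)" for b
    unfolding v_def w_def using cont[of b]
    by (cases "b = a") (auto intro!: continuous_intros simp: wa[unfolded w_def])
  moreover have "t ^ j - (\<Sum>b\<in>set (a # ys). v b t * b ^ j)
      = (\<Prod>b\<in>set (a # ys). t - b) * power_dd j (t # a # ys)" for t j
  proof -
    have "(\<Sum>b\<in>set (a # ys). v b t * b ^ j) = v a t * a ^ j + (\<Sum>b\<in>set ys. v b t * b ^ j)"
      using Cons.prems by simp
    also have "(\<Sum>b\<in>set ys. v b t * b ^ j) = (\<Sum>b\<in>set ys. u b t * b ^ j - w t / w a * (u b a * b ^ j))"
      using Cons.prems by (intro sum.cong) (auto simp: v_def algebra_simps)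
    also have "\<dots> = (\<Sum>b\<in>set ys. u b t * b ^ j) - w t / w a * (\<Sum>b\<in>set ys. u b a * b ^ j)"
      by (simp add: sum_subtractf sum_distrib_left)
    also have "(\<Sum>b\<in>set ys. u b t * b ^ j) = t ^ j - w t * power_dd j (t # ys)"
      using u[of t j] by (simp add: w_def)
    also have "(\<Sum>b\<in>set ys. u b a * b ^ j) = a ^ j - w a * power_dd j (a # ys)"
      using u[of a j] by (simp add: w_def)
    also have "v a t * a ^ j + (t ^ j - w t * power_dd j (t # ys)
        - w t / w a * (a ^ j - w a * power_dd j (a # ys)))
        = t ^ j - w t * (power_dd j (t # ys) - power_dd j (a # ys))"
      using wa by (simp add: v_def[of a] field_simps)
    finally have "t ^ j - (\<Sum>b\<in>set (a # ys). v b t * b ^ j)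
        = w t * (power_dd j (t # ys) - power_dd j (a # ys))"
      by linarith
    also have "\<dots> = ((t - a) * w t) * power_dd j (t # a # ys)"
      by (simp flip: power_dd_difference)
    finally show ?thesis using Cons.prems by (simp add: w_def)
  qed
  ultimately show ?case by blast
qed

corollary monomial_interpolation_error:
  assumes "finite A" "\<And>a. a \<in> A \<Longrightarrow> \<bar>a\<bar> \<le> 1"
  obtains u :: "real \<Rightarrow> real \<Rightarrow> real" where "\<And>a. continuous_on UNIV (u a)"
    and "\<And>t j. \<bar>t\<bar> \<le> 1 \<Longrightarrow>
      \<bar>t ^ j - (\<Sum>a\<in>A. u a t * a ^ j)\<bar> \<le> \<bar>\<Prod>a\<in>A. t - a\<bar> * real (j choose card A)"
proof -
  obtain xs where xs: "set xs = A" "distinct xs" using finite_distinct_list assms(1) by blast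
  obtain u where u: "\<And>a. continuous_on UNIV (u a)"
    "\<And>t j. t ^ j - (\<Sum>a\<in>A. u a t * a ^ j) = (\<Prod>a\<in>A. t - a) * power_dd j (t # xs)"
    using monomial_interpolation[OF xs(2)] xs(1) by auto
  show thesis
  proof (rule that[OF u(1)])
    fix t :: real and j assume t: "\<bar>t\<bar> \<le> 1"
    have "\<bar>power_dd j (t # xs)\<bar> \<le> real (j choose length xs) * 1 ^ (j - length xs)"
      using t xs(1) assms(2) by (intro power_dd_le) auto
    then show "\<bar>t ^ j - (\<Sum>a\<in>A. u a t * a ^ j)\<bar> \<le> \<bar>\<Prod>a\<in>A. t - a\<bar> * real (j choose card A)"
      unfolding u(2) abs_mult using distinct_card[OF xs(2)] xs(1) by (intro mult_left_mono) auto
  qed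
qed

text \<open>
  A combination of point evaluations near \<open>0\<close> that approximates the functional which reads off the
  \<open>k\<close>-th Taylor coefficient. It is a divided difference of order \<open>k\<close>, so it is exact in degrees up
  to \<open>k\<close>, and higher degrees are damped by the powers of \<open>\<delta>\<close>.
\<close>
corollary monomial_extraction:
  fixes \<delta> :: real
  assumes "0 < \<delta>" "\<delta> \<le> 1"
  shows "\<exists>A c. finite A \<and> A \<subseteq> {-\<delta>..\<delta>} \<and>
    (\<forall>j. \<bar>(\<Sum>a\<in>A. c a * a ^ j) - (if j = k then 1 else 0)\<bar> \<le> real (j choose k) * \<delta>)"
proof -
  \<comment> \<open>Together with \<open>\<delta>\<close> these are \<open>k + 1\<close> distinct nodes.\<close>
  define xs where "xs = map (\<lambda>i. \<delta> / (real i + 2)) [0..<k]"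
  have inj: "inj (\<lambda>i. \<delta> / (real i + 2))"
    using assms by (intro injI) (simp add: field_simps)
  have len: "length xs = k" and dist: "distinct xs"
    using inj by (auto simp: xs_def distinct_map inj_on_def)
  have bd: "\<bar>b\<bar> \<le> \<delta>" if "b \<in> set (\<delta> # xs)" for b
    using that assms by (auto simp: xs_def field_simps)
  have "\<delta> / (real i + 2) < \<delta>" for i
    using assms divide_strict_left_mono[of 1 "real i + 2" \<delta>] by simp
  then have "\<delta> \<noteq> \<delta> / (real i + 2)" for i by (metis less_irrefl)
  then have new: "\<delta> \<notin> set xs" unfolding xs_def set_map by blast
  define w where "w = (\<Prod>a\<in>set xs. \<delta> - a)"
  have w: "w \<noteq> 0" using new by (auto simp: w_def)
  obtain u where u: "\<And>j. \<delta> ^ j - (\<Sum>a\<in>set xs. u a \<delta> * a ^ j) = w * power_dd j (\<delta> # xs)"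
    using monomial_interpolation[OF dist] unfolding w_def by blast
  define c where "c a = (if a = \<delta> then 1 / w else - u a \<delta> / w)" for a
  have eq: "(\<Sum>a\<in>set (\<delta> # xs). c a * a ^ j) = power_dd j (\<delta> # xs)" for j
  proof -
    have "(\<Sum>a\<in>set xs. c a * a ^ j) = (\<Sum>a\<in>set xs. - (u a \<delta> * a ^ j) / w)"
      using new by (intro sum.cong) (auto simp: c_def)
    then have "(\<Sum>a\<in>set (\<delta> # xs). c a * a ^ j) = (\<delta> ^ j - (\<Sum>a\<in>set xs. u a \<delta> * a ^ j)) / w"
      using new by (simp add: c_def diff_divide_distrib sum_divide_distrib sum_negf)
    then show ?thesis using w u by simp
  qed
  have "\<bar>power_dd j (\<delta> # xs) - (if j = k then 1 else 0)\<bar> \<le> real (j choose k) * \<delta>" for j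
  proof (cases j k rule: linorder_cases)
    case less
    then show ?thesis
      using power_dd_le[of \<delta> xs \<delta> j] bd len binomial_eq_0[of j k] assms by simp
  next
    case equal
    then show ?thesis using power_dd_length[of xs \<delta>] len equal assms by simp
  next
    case greater
    have "\<delta> ^ (j - k) \<le> \<delta> ^ 1"
      using greater assms by (intro power_decreasing) auto
    then have "real (j choose k) * \<delta> ^ (j - k) \<le> real (j choose k) * \<delta>"
      by (intro mult_left_mono) auto
    moreover have "\<bar>power_dd j (\<delta> # xs)\<bar> \<le> real (j choose k) * \<delta> ^ (j - k)"
      using power_dd_le[of \<delta> xs \<delta> j] bd len by simp
    ultimately have "\<bar>power_dd j (\<delta> # xs)\<bar> \<le> real (j choose k) * \<delta>"
      by (rule order.trans[rotated])
    then show ?thesis using greater by simp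
  qed
  moreover have "set (\<delta> # xs) \<subseteq> {-\<delta>..\<delta>}"
  proof
    fix b assume "b \<in> set (\<delta> # xs)"
    from bd[OF this] show "b \<in> {-\<delta>..\<delta>}" by auto
  qed
  ultimately show ?thesis
    unfolding eq[symmetric] by (intro exI[of _ "set (\<delta> # xs)"] exI[of _ c]) auto
qed

section \<open>Sections of the Gaussian kernel\<close>

locale gaussian_rkhs = rkhs "{-1..1}" "gaussian_kernel \<epsilon>" H ip
  for \<epsilon> :: real and H ip +
  assumes eps: "0 < \<epsilon>"
begin

text \<open>
  Kernel sections, rescaled so that their inner products are \<open>exp (\<epsilon>\<^sup>2 * y * z)\<close>, whose power series
  separates the two variables.
\<close>
definition scaled_section :: "real \<Rightarrow> real \<Rightarrow> real" where
  "scaled_section y = (\<lambda>t. exp (\<epsilon>\<^sup>2 * y\<^sup>2 / 2) * (if t \<in> {-1..1} then gaussian_kernel \<epsilon> t y else 0))"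

definition section_comb :: "real set \<Rightarrow> (real \<Rightarrow> real) \<Rightarrow> real \<Rightarrow> real" where
  "section_comb A c = (\<lambda>t. \<Sum>a\<in>A. c a * scaled_section a t)"

text \<open>
  The weight \<open>exp (- \<epsilon>\<^sup>2 * t\<^sup>2 / 2)\<close> times a polynomial, cut off outside the interval as the
  representatives in the space are.
\<close>
definition feature :: "real poly \<Rightarrow> real \<Rightarrow> real" where
  "feature P = (\<lambda>t. if t \<in> {-1..1} then exp (- \<epsilon>\<^sup>2 * t\<^sup>2 / 2) * poly P t else 0)"

lemma scaled_section_mem: "y \<in> {-1..1} \<Longrightarrow> scaled_section y \<in> H"
  unfolding scaled_section_def by (intro scale_mem section_mem)

lemma ip_scaled_section: "f \<in> H \<Longrightarrow> y \<in> {-1..1} \<Longrightarrow> ip f (scaled_section y) = exp (\<epsilon>\<^sup>2 * y\<^sup>2 / 2) * f y"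
  unfolding scaled_section_def by (subst ip_scale_right) (simp_all only: reproducing section_mem)

lemma scaled_section_apply:
  "t \<in> {-1..1} \<Longrightarrow> scaled_section y t = exp (- \<epsilon>\<^sup>2 * t\<^sup>2 / 2) * exp (\<epsilon>\<^sup>2 * (y * t))"
  unfolding scaled_section_def gaussian_kernel_def
  by (simp flip: exp_add) (simp add: power2_eq_square field_simps)

lemma section_comb_mem: "finite A \<Longrightarrow> A \<subseteq> {-1..1} \<Longrightarrow> section_comb A c \<in> H"
  unfolding section_comb_def by (intro sum_mem scaled_section_mem) auto

lemma ip_section_comb:
  assumes "finite A" "A \<subseteq> {-1..1}" "f \<in> H"
  shows "ip f (section_comb A c) = (\<Sum>a\<in>A. c a * (exp (\<epsilon>\<^sup>2 * a\<^sup>2 / 2) * f a))"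
  unfolding section_comb_def using assms
  by (subst ip_sum_right) (auto intro!: scaled_section_mem sum.cong simp: ip_scaled_section subset_iff)

lemma section_comb_apply:
  assumes "finite A" "t \<in> {-1..1}"
  shows "(\<lambda>j. (\<epsilon>\<^sup>2) ^ j / fact j * (\<Sum>a\<in>A. c a * a ^ j) * t ^ j) sums (exp (\<epsilon>\<^sup>2 * t\<^sup>2 / 2) * section_comb A c t)"
proof -
  have "(\<lambda>j. \<Sum>a\<in>A. c a * ((\<epsilon>\<^sup>2 * (a * t)) ^ j /\<^sub>R fact j)) sums (\<Sum>a\<in>A. c a * exp (\<epsilon>\<^sup>2 * (a * t)))"
    by (intro sums_sum sums_mult exp_converges)
  also have "(\<Sum>a\<in>A. c a * exp (\<epsilon>\<^sup>2 * (a * t))) = exp (\<epsilon>\<^sup>2 * t\<^sup>2 / 2) * section_comb A c t"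
    unfolding section_comb_def sum_distrib_left
    by (intro sum.cong refl) (simp add: scaled_section_apply[OF assms(2)] exp_minus)
  also have "(\<lambda>j. \<Sum>a\<in>A. c a * ((\<epsilon>\<^sup>2 * (a * t)) ^ j /\<^sub>R fact j))
      = (\<lambda>j. (\<epsilon>\<^sup>2) ^ j / fact j * (\<Sum>a\<in>A. c a * a ^ j) * t ^ j)"
    by (auto simp: sum_distrib_left sum_distrib_right power_mult_distrib divide_inverse mult_ac
        intro!: sum.cong)
  finally show ?thesis .
qed

text \<open>
  Through the moments \<open>\<Sum>a\<in>A. c a * a ^ j\<close>, a combination of sections behaves like a sequence in a
  weighted \<open>\<ell>\<^sup>2\<close> space. Both error bounds and membership of the weighted monomials are read off from
  this isometry.
\<close>
lemma ip_section_comb_comb: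
  assumes "finite A" "A \<subseteq> {-1..1}" "finite B" "B \<subseteq> {-1..1}"
  shows "(\<lambda>j. (\<epsilon>\<^sup>2) ^ j / fact j * (\<Sum>a\<in>A. c a * a ^ j) * (\<Sum>b\<in>B. d b * b ^ j))
    sums ip (section_comb A c) (section_comb B d)"
proof -
  have "(\<lambda>j. \<Sum>b\<in>B. d b * ((\<epsilon>\<^sup>2) ^ j / fact j * (\<Sum>a\<in>A. c a * a ^ j) * b ^ j))
     sums (\<Sum>b\<in>B. d b * (exp (\<epsilon>\<^sup>2 * b\<^sup>2 / 2) * section_comb A c b))"
    using assms by (intro sums_sum sums_mult section_comb_apply) auto
  also have "(\<Sum>b\<in>B. d b * (exp (\<epsilon>\<^sup>2 * b\<^sup>2 / 2) * section_comb A c b)) = ip (section_comb A c) (section_comb B d)"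
    using assms by (simp add: ip_section_comb section_comb_mem)
  also have "(\<lambda>j. \<Sum>b\<in>B. d b * ((\<epsilon>\<^sup>2) ^ j / fact j * (\<Sum>a\<in>A. c a * a ^ j) * b ^ j))
      = (\<lambda>j. (\<epsilon>\<^sup>2) ^ j / fact j * (\<Sum>a\<in>A. c a * a ^ j) * (\<Sum>b\<in>B. d b * b ^ j))"
  proof -
    have "(\<Sum>b\<in>B. d b * (k * b ^ j)) = k * (\<Sum>b\<in>B. d b * b ^ j)" for k j
      by (simp add: sum_distrib_left mult.left_commute)
    then show ?thesis by (simp only:)
  qed
  finally show ?thesis .
qed

text \<open>
  The error functional of the sampling formula is represented by the difference of the section at
  \<open>t\<close> and a combination of sections at the nodes. Its moments are the errors of the underlying
  formula for monomials, so \<open>ip_section_comb_comb\<close> bounds its norm. The weights of the formula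
  are those for monomials, conjugated with \<open>exp (\<epsilon>\<^sup>2 * x\<^sup>2 / 2)\<close>.
\<close>
lemma interpolation_error:
  assumes A: "finite A" "A \<subseteq> {-1..1}" and t: "t \<in> {-1..1}" and f: "f \<in> H"
    and m: "\<And>j. \<bar>t ^ j - (\<Sum>a\<in>A. u a * a ^ j)\<bar> \<le> w * real (j choose n)" and w: "0 \<le> w"
    and S: "(\<lambda>j. (\<epsilon>\<^sup>2) ^ j / fact j * (real (j choose n))\<^sup>2) sums S"
  shows "\<bar>f t - (\<Sum>a\<in>A. f a * (exp (- \<epsilon>\<^sup>2 * t\<^sup>2 / 2) * (exp (\<epsilon>\<^sup>2 * a\<^sup>2 / 2) * u a)))\<bar>
    \<le> sqrt (ip f f) * (w * sqrt S)"
proof -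
  \<comment> \<open>The point \<open>t\<close> may itself be a node, so the coefficients have to be added there.\<close>
  define B where "B = insert t A"
  define c where "c a = (if a = t then 1 else 0) - (if a \<in> A then u a else 0)" for a
  have B: "finite B" "B \<subseteq> {-1..1}" using A t by (auto simp: B_def)
  have c: "(\<Sum>a\<in>B. c a * g a) = g t - (\<Sum>a\<in>A. u a * g a)" for g
  proof -
    have "(\<Sum>a\<in>B. c a * g a)
        = (\<Sum>a\<in>B. (if a = t then g a else 0)) - (\<Sum>a\<in>B. (if a \<in> A then u a * g a else 0))"
      unfolding sum_subtractf[symmetric] by (intro sum.cong) (auto simp: c_def algebra_simps)
    also have "(\<Sum>a\<in>B. (if a = t then g a else 0)) = g t"
      using B by (simp add: B_def)
    also have "(\<Sum>a\<in>B. (if a \<in> A then u a * g a else 0)) = (\<Sum>a\<in>A. u a * g a)"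
      using B(1) A by (simp add: sum.If_cases B_def) (metis Int_absorb1 subset_insertI)
    finally show ?thesis .
  qed
  have "ip (section_comb B c) (section_comb B c) \<le> w\<^sup>2 * S"
  proof (rule sums_le)
    show "(\<lambda>j. (\<epsilon>\<^sup>2) ^ j / fact j * (\<Sum>a\<in>B. c a * a ^ j) * (\<Sum>a\<in>B. c a * a ^ j))
      sums ip (section_comb B c) (section_comb B c)" by (intro ip_section_comb_comb B)
    show "(\<lambda>j. w\<^sup>2 * ((\<epsilon>\<^sup>2) ^ j / fact j * (real (j choose n))\<^sup>2)) sums (w\<^sup>2 * S)"
      by (intro sums_mult S)
    fix j
    have "(t ^ j - (\<Sum>a\<in>A. u a * a ^ j))\<^sup>2 \<le> (w * real (j choose n))\<^sup>2"
      using m[of j] by (metis abs_le_square_iff abs_of_nonneg mult_nonneg_nonneg of_nat_0_le_iff w)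
    from mult_left_mono[OF this, of "(\<epsilon>\<^sup>2) ^ j / fact j"]
    show "(\<epsilon>\<^sup>2) ^ j / fact j * (\<Sum>a\<in>B. c a * a ^ j) * (\<Sum>a\<in>B. c a * a ^ j)
        \<le> w\<^sup>2 * ((\<epsilon>\<^sup>2) ^ j / fact j * (real (j choose n))\<^sup>2)"
      unfolding c by (simp add: power2_eq_square mult_ac)
  qed
  then have nrm: "sqrt (ip (section_comb B c) (section_comb B c)) \<le> w * sqrt S"
    using real_sqrt_le_mono w by (fastforce simp: real_sqrt_mult)
  have "exp (\<epsilon>\<^sup>2 * t\<^sup>2 / 2) * (f t - (\<Sum>a\<in>A. f a * (exp (- \<epsilon>\<^sup>2 * t\<^sup>2 / 2) * (exp (\<epsilon>\<^sup>2 * a\<^sup>2 / 2) * u a))))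
      = ip f (section_comb B c)"
    unfolding ip_section_comb[OF B f] c right_diff_distrib sum_distrib_left
    by (auto intro!: sum.cong simp: exp_minus field_simps)
  moreover have "\<bar>x\<bar> = exp (- \<epsilon>\<^sup>2 * t\<^sup>2 / 2) * \<bar>y\<bar>" if "exp (\<epsilon>\<^sup>2 * t\<^sup>2 / 2) * x = y" for x y
    unfolding that[symmetric] by (simp add: exp_minus abs_mult)
  ultimately have "\<bar>f t - (\<Sum>a\<in>A. f a * (exp (- \<epsilon>\<^sup>2 * t\<^sup>2 / 2) * (exp (\<epsilon>\<^sup>2 * a\<^sup>2 / 2) * u a)))\<bar>
      = exp (- \<epsilon>\<^sup>2 * t\<^sup>2 / 2) * \<bar>ip f (section_comb B c)\<bar>"
    by blast
  also have "\<dots> \<le> 1 * (sqrt (ip f f) * sqrt (ip (section_comb B c) (section_comb B c)))"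
    by (intro mult_mono Cauchy_Schwarz f section_comb_mem B) auto
  also have "\<dots> \<le> sqrt (ip f f) * (w * sqrt S)"
    using nrm ip_nonneg[OF f] by (simp add: mult_left_mono)
  finally show ?thesis .
qed

end

section \<open>The weighted monomials in the Gaussian space\<close>

lemma summable_binomial_squares:
  fixes l :: real
  assumes "0 \<le> l"
  shows "summable (\<lambda>j. l ^ j / fact j * (real (j choose n))\<^sup>2)"
proof (rule summable_comparison_test')
  show "summable (\<lambda>j. (4 * l) ^ j /\<^sub>R fact j)" by (rule summable_exp_generic)
  fix j
  have "real (j choose n) \<le> 2 ^ j"
  proof (cases "n \<le> j")
    case True
    have "(j choose n) \<le> (\<Sum>i\<le>j. j choose i)"
      using True by (intro member_le_sum) auto
    also have "\<dots> = 2 ^ j" by (rule choose_row_sum)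
    finally show ?thesis by (metis of_nat_le_iff of_nat_numeral of_nat_power)
  qed (simp add: binomial_eq_0)
  then have "(real (j choose n))\<^sup>2 \<le> (2 ^ j)\<^sup>2" by (intro power_mono) auto
  also have "(2 ^ j)\<^sup>2 = (4::real) ^ j" by (simp flip: power_mult add: power_mult mult.commute[of j])
  finally have "l ^ j / fact j * (real (j choose n))\<^sup>2 \<le> l ^ j / fact j * 4 ^ j"
    using assms by (intro mult_left_mono) auto
  then show "norm (l ^ j / fact j * (real (j choose n))\<^sup>2) \<le> (4 * l) ^ j /\<^sub>R fact j"
    using assms by (simp add: power_mult_distrib divide_inverse mult_ac)
qed

context gaussian_rkhs
begin

text \<open>
  The combinations of sections that carry the coefficients of \<open>monomial_extraction\<close> have moments
  tending to the unit sequence at \<open>k\<close>. Hence they form a Cauchy sequence, their limit is a multiple of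
  the weighted monomial, and inner products with the limit are limits of moments.
\<close>
lemma monomial_feature:
  fixes k :: nat
  shows "feature (monom 1 k) \<in> H" (is "?\<phi> \<in> H")
    and "feature (monom 1 l) \<in> H \<Longrightarrow>
      ip (feature (monom 1 l)) (feature (monom 1 k)) = (if l = k then fact k / (\<epsilon>\<^sup>2) ^ k else 0)"
proof -
  define E where "E j = (\<epsilon>\<^sup>2) ^ j / fact j * (real (j choose k))\<^sup>2" for j
  define S where "S = suminf E"
  have E: "E sums S" and E0: "0 \<le> E j" for j
    using summable_binomial_squares[of "\<epsilon>\<^sup>2" k] by (auto simp: E_def[abs_def] S_def summable_sums)
  have S0: "0 \<le> S" using sums_le[OF _ sums_zero E] E0 by auto
  define \<delta> :: "nat \<Rightarrow> real" where "\<delta> N = inverse (real (Suc N))" for N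
  have \<delta>: "0 < \<delta> N" "\<delta> N \<le> 1" for N by (auto simp: \<delta>_def field_simps)
  have \<delta>_lim: "\<delta> \<longlonglongrightarrow> 0" unfolding \<delta>_def[abs_def] by (rule LIMSEQ_inverse_real_of_nat)
  have "\<exists>A c. finite A \<and> A \<subseteq> {-1..1} \<and>
      (\<forall>j. \<bar>(\<Sum>a\<in>A. c a * a ^ j) - (if j = k then 1 else 0)\<bar> \<le> real (j choose k) * \<delta> N)" for N
  proof -
    obtain A c where A: "finite A" "A \<subseteq> {-\<delta> N..\<delta> N}"
      and m: "\<And>j. \<bar>(\<Sum>a\<in>A. c a * a ^ j) - (if j = k then 1 else 0)\<bar> \<le> real (j choose k) * \<delta> N"
      using monomial_extraction[OF \<delta>, of N k] by blast
    have "A \<subseteq> {-1..1}" using A(2) \<delta>(2)[of N] by force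
    then show ?thesis using A m by blast
  qed
  then obtain A c where A: "\<And>N. finite (A N)" "\<And>N. A N \<subseteq> {-1..1}"
    and m': "\<And>N j. \<bar>(\<Sum>a\<in>A N. c N a * a ^ j) - (if j = k then 1 else 0)\<bar> \<le> real (j choose k) * \<delta> N"
    by metis
  define \<mu> where "\<mu> N j = (\<Sum>a\<in>A N. c N a * a ^ j)" for N j
  have \<mu>: "\<bar>\<mu> N j - (if j = k then 1 else 0)\<bar> \<le> real (j choose k) * \<delta> N" for N j
    using m' unfolding \<mu>_def .
  define h where "h N = section_comb (A N) (c N)" for N
  have h: "h N \<in> H" for N unfolding h_def using A by (intro section_comb_mem)
  have ip_h: "(\<lambda>j. (\<epsilon>\<^sup>2) ^ j / fact j * \<mu> N j * \<mu> M j) sums ip (h N) (h M)" for N M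
    unfolding h_def \<mu>_def by (intro ip_section_comb_comb A)
  \<comment> \<open>The moments of \<open>h N\<close> and \<open>h M\<close> differ by at most \<open>(j choose k) * (\<delta> N + \<delta> M)\<close>.\<close>
  have dist: "sqrt (ip (\<lambda>t. h N t - h M t) (\<lambda>t. h N t - h M t)) \<le> (\<delta> N + \<delta> M) * sqrt S" for N M
  proof -
    have "(\<lambda>j. (\<epsilon>\<^sup>2) ^ j / fact j * \<mu> N j * \<mu> N j - 2 * ((\<epsilon>\<^sup>2) ^ j / fact j * \<mu> N j * \<mu> M j)
        + (\<epsilon>\<^sup>2) ^ j / fact j * \<mu> M j * \<mu> M j) sums (ip (h N) (h N) - 2 * ip (h N) (h M) + ip (h M) (h M))"
      by (intro sums_add sums_diff sums_mult ip_h)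
    moreover have "(\<lambda>j. (\<delta> N + \<delta> M)\<^sup>2 * E j) sums ((\<delta> N + \<delta> M)\<^sup>2 * S)"
      by (intro sums_mult E)
    moreover have "(\<epsilon>\<^sup>2) ^ j / fact j * \<mu> N j * \<mu> N j - 2 * ((\<epsilon>\<^sup>2) ^ j / fact j * \<mu> N j * \<mu> M j)
        + (\<epsilon>\<^sup>2) ^ j / fact j * \<mu> M j * \<mu> M j \<le> (\<delta> N + \<delta> M)\<^sup>2 * E j" for j
    proof -
      have "\<bar>\<mu> N j - \<mu> M j\<bar> \<le> real (j choose k) * (\<delta> N + \<delta> M)"
        using \<mu>[of N j] \<mu>[of M j] by (simp add: algebra_simps)
      then have "(\<mu> N j - \<mu> M j)\<^sup>2 \<le> (real (j choose k) * (\<delta> N + \<delta> M))\<^sup>2"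
        by (metis abs_ge_zero power2_abs power_mono)
      then have "(\<epsilon>\<^sup>2) ^ j / fact j * (\<mu> N j - \<mu> M j)\<^sup>2
          \<le> (\<epsilon>\<^sup>2) ^ j / fact j * (real (j choose k) * (\<delta> N + \<delta> M))\<^sup>2"
        by (intro mult_left_mono) auto
      moreover have q: "q * x * x - 2 * (q * x * y) + q * y * y = q * (x - y)\<^sup>2" for q x y :: real
        by (simp add: power2_eq_square algebra_simps)
      ultimately show ?thesis
        unfolding q E_def by (simp only: power_mult_distrib mult_ac)
    qed
    ultimately have "ip (\<lambda>t. h N t - h M t) (\<lambda>t. h N t - h M t) \<le> (\<delta> N + \<delta> M)\<^sup>2 * S"
      unfolding ip_minus_self[OF h h] by (rule sums_le[rotated])
    then have "sqrt (ip (\<lambda>t. h N t - h M t) (\<lambda>t. h N t - h M t)) \<le> sqrt ((\<delta> N + \<delta> M)\<^sup>2 * S)"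
      by (rule real_sqrt_le_mono)
    then show ?thesis using \<delta>(1)[of N] \<delta>(1)[of M] by (simp add: real_sqrt_mult)
  qed
  have cauchy: "\<exists>N. \<forall>m\<ge>N. \<forall>n\<ge>N. sqrt (ip (\<lambda>t. h m t - h n t) (\<lambda>t. h m t - h n t)) < e" if "e > 0" for e
  proof -
    have "0 < e / (2 * (sqrt S + 1))"
      using that S0 by (intro divide_pos_pos mult_pos_pos add_nonneg_pos) auto
    then obtain N where N: "inverse (real (Suc N)) < e / (2 * (sqrt S + 1))"
      using reals_Archimedean by blast
    have "sqrt (ip (\<lambda>t. h m t - h n t) (\<lambda>t. h m t - h n t)) < e" if "m \<ge> N" "n \<ge> N" for m n
    proof -
      have "\<delta> m \<le> \<delta> N" "\<delta> n \<le> \<delta> N" using that by (auto simp: \<delta>_def field_simps)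
      then have "(\<delta> m + \<delta> n) * sqrt S \<le> (2 * \<delta> N) * (sqrt S + 1)"
        using \<delta>(1)[of N] S0 by (intro mult_mono) auto
      also have "\<dots> < e"
      proof -
        have pos: "0 < 2 * (sqrt S + 1)" using real_sqrt_ge_zero[OF S0] by (simp add: add_nonneg_pos)
        have "\<delta> N * (2 * (sqrt S + 1)) < e"
          using N pos_less_divide_eq[OF pos] unfolding \<delta>_def by blast
        then show ?thesis by (simp add: algebra_simps)
      qed
      finally show ?thesis using dist[of m n] by simp
    qed
    then show ?thesis by blast
  qed
  have "\<exists>f\<in>H. (\<lambda>n. sqrt (ip (\<lambda>t. h n t - f t) (\<lambda>t. h n t - f t))) \<longlonglongrightarrow> 0"
    by (rule complete[of h, OF h cauchy])
  then obtain f where f: "f \<in> H"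
    and lim: "(\<lambda>n. sqrt (ip (\<lambda>t. h n t - f t) (\<lambda>t. h n t - f t))) \<longlonglongrightarrow> 0"
    by (rule bexE)
  have ft: "exp (\<epsilon>\<^sup>2 * t\<^sup>2 / 2) * f t = (\<epsilon>\<^sup>2) ^ k / fact k * t ^ k" if t: "t \<in> {-1..1}" for t
  proof (rule LIMSEQ_unique)
    have ev: "ip (scaled_section t) g = exp (\<epsilon>\<^sup>2 * t\<^sup>2 / 2) * g t" if "g \<in> H" for g
      using ip_sym[OF scaled_section_mem[OF t] that] ip_scaled_section[OF that t] by (rule trans)
    show "(\<lambda>N. exp (\<epsilon>\<^sup>2 * t\<^sup>2 / 2) * h N t) \<longlonglongrightarrow> exp (\<epsilon>\<^sup>2 * t\<^sup>2 / 2) * f t"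
      using ip_tendsto[OF h f scaled_section_mem[OF t] lim]
      by (simp only: ev[OF h] ev[OF f])
    have "norm (exp (\<epsilon>\<^sup>2 * t\<^sup>2 / 2) * h N t - (\<epsilon>\<^sup>2) ^ k / fact k * t ^ k) \<le> \<delta> N * S" for N
    proof -
      have single: "(\<lambda>j. if j = k then (\<epsilon>\<^sup>2) ^ j / fact j * t ^ j else 0) sums ((\<epsilon>\<^sup>2) ^ k / fact k * t ^ k)"
        using sums_single[of k "\<lambda>j. (\<epsilon>\<^sup>2) ^ j / fact j * t ^ j"] by simp
      have "(\<lambda>j. (\<epsilon>\<^sup>2) ^ j / fact j * \<mu> N j * t ^ j) sums (exp (\<epsilon>\<^sup>2 * t\<^sup>2 / 2) * h N t)"
        unfolding h_def \<mu>_def by (intro section_comb_apply A t)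
      moreover have "(\<epsilon>\<^sup>2) ^ j / fact j * \<mu> N j * t ^ j - (if j = k then (\<epsilon>\<^sup>2) ^ j / fact j * t ^ j else 0)
          = (\<epsilon>\<^sup>2) ^ j / fact j * (\<mu> N j - (if j = k then 1 else 0)) * t ^ j" for j
        by (cases "j = k") (simp_all add: algebra_simps diff_divide_distrib)
      ultimately
      have d: "(\<lambda>j. (\<epsilon>\<^sup>2) ^ j / fact j * (\<mu> N j - (if j = k then 1 else 0)) * t ^ j)
         sums (exp (\<epsilon>\<^sup>2 * t\<^sup>2 / 2) * h N t - (\<epsilon>\<^sup>2) ^ k / fact k * t ^ k)"
        using sums_diff[OF _ single] by force
      have "norm ((\<epsilon>\<^sup>2) ^ j / fact j * (\<mu> N j - (if j = k then 1 else 0)) * t ^ j) \<le> \<delta> N * E j" for j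
      proof -
        have "\<bar>t ^ j\<bar> \<le> 1" using t by (simp add: power_abs power_le_one abs_le_iff)
        moreover have "real (j choose k) \<le> (real (j choose k))\<^sup>2"
          using le_square[of "j choose k"] by (simp add: power2_eq_square flip: of_nat_mult)
        then have "real (j choose k) * \<delta> N \<le> (real (j choose k))\<^sup>2 * \<delta> N"
          using \<delta>(1)[of N] by (intro mult_right_mono) auto
        then have "\<bar>\<mu> N j - (if j = k then 1 else 0)\<bar> \<le> (real (j choose k))\<^sup>2 * \<delta> N"
          using \<mu>[of N j] by linarith
        ultimately have "(\<epsilon>\<^sup>2) ^ j / fact j * \<bar>\<mu> N j - (if j = k then 1 else 0)\<bar> * \<bar>t ^ j\<bar>
            \<le> (\<epsilon>\<^sup>2) ^ j / fact j * ((real (j choose k))\<^sup>2 * \<delta> N) * 1"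
          using \<delta>(1)[of N] by (intro mult_mono mult_nonneg_nonneg) auto
        then show ?thesis by (simp add: abs_mult E_def mult_ac)
      qed
      then show ?thesis
        using norm_sums_le[OF d sums_mult[OF E, of "\<delta> N"]] by simp
    qed
    moreover have "(\<lambda>N. \<delta> N * S) \<longlonglongrightarrow> 0" using tendsto_mult_left_zero[OF \<delta>_lim] .
    ultimately have "(\<lambda>N. exp (\<epsilon>\<^sup>2 * t\<^sup>2 / 2) * h N t - (\<epsilon>\<^sup>2) ^ k / fact k * t ^ k) \<longlonglongrightarrow> 0"
      by (intro Lim_null_comparison[of "\<lambda>N. exp (\<epsilon>\<^sup>2 * t\<^sup>2 / 2) * h N t - (\<epsilon>\<^sup>2) ^ k / fact k * t ^ k"]) auto
    then show "(\<lambda>N. exp (\<epsilon>\<^sup>2 * t\<^sup>2 / 2) * h N t) \<longlonglongrightarrow> (\<epsilon>\<^sup>2) ^ k / fact k * t ^ k"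
      by (simp only: LIM_zero_iff)
  qed
  have "f t = exp (- \<epsilon>\<^sup>2 * t\<^sup>2 / 2) * ((\<epsilon>\<^sup>2) ^ k / fact k * t ^ k)" if "t \<in> {-1..1}" for t
    unfolding ft[OF that, symmetric] by (simp add: exp_minus)
  note ft = this
  have "?\<phi> t = fact k / (\<epsilon>\<^sup>2) ^ k * f t" for t
    using eps supported[OF f, of t] ft[of t] by (cases "t \<in> {-1..1}") (simp_all add: feature_def poly_monom)
  then have \<phi>: "?\<phi> = (\<lambda>t. fact k / (\<epsilon>\<^sup>2) ^ k * f t)" by blast
  show "?\<phi> \<in> H" unfolding \<phi> by (rule scale_mem[OF f])
  assume l: "feature (monom 1 l) \<in> H"
  have m: "ip (feature (monom 1 l)) (h N) = \<mu> N l" for N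
    unfolding h_def ip_section_comb[OF A l] \<mu>_def
    using A(2)[of N] by (auto intro!: sum.cong simp: feature_def poly_monom exp_minus)
  have "(\<lambda>N. \<mu> N l) \<longlonglongrightarrow> (if l = k then 1 else 0)"
  proof -
    have "(\<lambda>N. real (l choose k) * \<delta> N) \<longlonglongrightarrow> 0" using tendsto_mult_right_zero[OF \<delta>_lim] .
    then have "(\<lambda>N. \<mu> N l - (if l = k then 1 else 0)) \<longlonglongrightarrow> 0"
      using \<mu>[of _ l] by (intro Lim_null_comparison[of "\<lambda>N. \<mu> N l - (if l = k then 1 else 0)"]) auto
    then show ?thesis by (simp only: LIM_zero_iff)
  qed
  then have "ip (feature (monom 1 l)) f = (if l = k then 1 else 0)"
    by (rule LIMSEQ_unique[OF ip_tendsto[OF h f l lim, unfolded m]])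
  then show "ip (feature (monom 1 l)) ?\<phi> = (if l = k then fact k / (\<epsilon>\<^sup>2) ^ k else 0)"
    unfolding \<phi> ip_scale_right[OF f l] by simp
qed

lemma feature_sum:
  "feature P = (\<lambda>t. \<Sum>i\<le>degree P. coeff P i * feature (monom 1 i) t)"
  by (auto simp: feature_def poly_altdef[of P] poly_monom sum_distrib_left sum_distrib_right mult_ac fun_eq_iff)

lemma feature_mem: "feature P \<in> H"
  by (subst feature_sum) (intro sum_mem monomial_feature; simp)

lemma ip_feature: "ip (feature P) (feature P) = (\<Sum>i\<le>degree P. (coeff P i)\<^sup>2 * (fact i / (\<epsilon>\<^sup>2) ^ i))"
proof -
  have m: "ip (feature (monom 1 i)) (feature P) = coeff P i * (fact i / (\<epsilon>\<^sup>2) ^ i)" if "i \<le> degree P" for i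
  proof -
    have "ip (feature (monom 1 i)) (feature P)
        = (\<Sum>j\<le>degree P. coeff P j * ip (feature (monom 1 i)) (feature (monom 1 j)))"
      by (subst feature_sum[of P], rule ip_sum_right) (auto intro: monomial_feature)
    also have "\<dots> = (\<Sum>j\<le>degree P. if j = i then coeff P i * (fact i / (\<epsilon>\<^sup>2) ^ i) else 0)"
      by (intro sum.cong) (auto simp: monomial_feature)
    finally show ?thesis using that by simp
  qed
  have "ip (feature P) (feature P) = (\<Sum>i\<le>degree P. coeff P i * ip (feature (monom 1 i)) (feature P))"
    by (subst (1) feature_sum, rule ip_sum_left) (auto intro: monomial_feature feature_mem)
  then show ?thesis by (simp add: m power2_eq_square mult.assoc)
qed

end

section \<open>Growth of a Kummer series\<close>

lemma exp_sums_real: "(\<lambda>i. x ^ i / fact i) sums exp (x :: real)"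
  using exp_converges[of x] by (simp add: divide_inverse_commute)

text \<open>
  That is, the central binomial coefficient \<open>2 * i choose i\<close> is at most
  \<open>4 ^ i / sqrt (2 * i + 1)\<close>. The induction is carried out on squares.
\<close>
lemma central_factorial_le:
  "fact (2 * i) * sqrt (2 * real i + 1) \<le> 4 ^ i * (fact i :: real)\<^sup>2"
proof -
  have "(fact (2 * i))\<^sup>2 * (2 * real i + 1) \<le> (4 ^ i * (fact i :: real)\<^sup>2)\<^sup>2"
  proof (induction i)
    case (Suc i)
    let ?x = "2 * real i + 2"
    have f: "fact (2 * Suc i) = ?x * (2 * real i + 1) * fact (2 * i)"
      by (simp add: algebra_simps)
    have "(fact (2 * Suc i))\<^sup>2 * (2 * real (Suc i) + 1)
        = ((fact (2 * i))\<^sup>2 * (2 * real i + 1)) * (?x\<^sup>2 * ((?x - 1) * (?x + 1)))"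
      unfolding f by (simp add: power2_eq_square algebra_simps)
    also have "\<dots> \<le> (4 ^ i * (fact i :: real)\<^sup>2)\<^sup>2 * (?x\<^sup>2 * ?x\<^sup>2)"
      using Suc by (intro mult_mono) (auto simp: power2_eq_square algebra_simps)
    also have "\<dots> = (4 ^ Suc i * (fact (Suc i) :: real)\<^sup>2)\<^sup>2"
      by (simp add: power2_eq_square algebra_simps)
    finally show ?case .
  qed simp
  then have "sqrt ((fact (2 * i))\<^sup>2 * (2 * real i + 1)) \<le> sqrt ((4 ^ i * (fact i :: real)\<^sup>2)\<^sup>2)"
    by (rule real_sqrt_le_mono)
  then show ?thesis by (simp add: real_sqrt_mult)
qed

text \<open>
  After \<open>central_factorial_le\<close> the left-hand side carries a factor \<open>1 / sqrt m\<close> with \<open>m = 2 * i + 1\<close>.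
  Replacing it by the linear function of \<open>1 / m\<close> that touches it at \<open>m = c\<close> costs little, since the
  series is concentrated there, and produces two consecutive terms of the exponential series.
\<close>
lemma bessel_term_le:
  fixes c :: real
  assumes c: "0 < c"
  shows "(c\<^sup>2 / 4) ^ i / (fact i)\<^sup>2
    \<le> (c ^ (2 * i) / fact (2 * i) + c ^ (2 * i + 1) / fact (2 * i + 1)) / (2 * sqrt c)"
proof -
  define m where "m = 2 * real i + 1"
  have m: "0 < m" by (simp add: m_def)
  have "(c\<^sup>2 / 4) ^ i / (fact i)\<^sup>2 = c ^ (2 * i) / (4 ^ i * (fact i)\<^sup>2)"
    by (simp add: power_divide power_mult)
  also have "\<dots> \<le> c ^ (2 * i) / (fact (2 * i) * sqrt m)"
    using central_factorial_le[of i] c m by (intro divide_left_mono mult_pos_pos) (auto simp: m_def)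
  also have "\<dots> = c ^ (2 * i) / fact (2 * i) * (1 / sqrt m)" by simp
  also have "\<dots> \<le> c ^ (2 * i) / fact (2 * i) * ((1 + c / m) / (2 * sqrt c))"
  proof (rule mult_left_mono)
    have "0 \<le> (sqrt m - sqrt c)\<^sup>2" by simp
    then have "2 * sqrt c * sqrt m \<le> m + c"
      using c m by (simp add: power2_eq_square algebra_simps)
    then have "2 * sqrt c * sqrt m / (2 * sqrt c * m) \<le> (m + c) / (2 * sqrt c * m)"
      using c m by (intro divide_right_mono) auto
    moreover have "2 * sqrt c * sqrt m / (2 * sqrt c * m) = 1 / sqrt m"
      using c m by (simp add: field_simps flip: power2_eq_square)
    moreover have "(m + c) / (2 * sqrt c * m) = (1 + c / m) / (2 * sqrt c)"
      using c m by (simp add: field_simps)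
    ultimately show "1 / sqrt m \<le> (1 + c / m) / (2 * sqrt c)" by simp
  qed (use c in auto)
  also have "\<dots> = (c ^ (2 * i) / fact (2 * i) + c ^ (2 * i + 1) / fact (2 * i + 1)) / (2 * sqrt c)"
    using m by (simp add: m_def divide_simps) (simp add: algebra_simps)
  finally show ?thesis .
qed

text \<open>
  The series is that of the modified Bessel function \<open>I\<^sub>0 c\<close>, which grows like
  \<open>exp c / sqrt (2 * pi * c)\<close>.
\<close>
lemma bessel_series:
  fixes c :: real
  assumes c: "0 < c"
  shows "summable (\<lambda>i. (c\<^sup>2 / 4) ^ i / (fact i)\<^sup>2)"
    and "(\<Sum>i. (c\<^sup>2 / 4) ^ i / (fact i)\<^sup>2) \<le> exp c / (2 * sqrt c)"
proof -
  from sums_group[OF exp_sums_real[of c], of 2]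
  have "(\<lambda>i. c ^ (2 * i) / fact (2 * i) + c ^ (2 * i + 1) / fact (2 * i + 1)) sums exp c"
    by (simp add: numeral_2_eq_2 mult.commute)
  then have S: "(\<lambda>i. (c ^ (2 * i) / fact (2 * i) + c ^ (2 * i + 1) / fact (2 * i + 1)) / (2 * sqrt c))
      sums (exp c / (2 * sqrt c))"
    by (rule sums_divide)
  have nn: "norm ((c\<^sup>2 / 4) ^ i / (fact i)\<^sup>2) \<le>
      (c ^ (2 * i) / fact (2 * i) + c ^ (2 * i + 1) / fact (2 * i + 1)) / (2 * sqrt c)" for i
    using bessel_term_le[OF c] by simp
  show summ: "summable (\<lambda>i. (c\<^sup>2 / 4) ^ i / (fact i)\<^sup>2)"
    by (rule summable_comparison_test'[OF sums_summable[OF S] nn])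
  show "(\<Sum>i. (c\<^sup>2 / 4) ^ i / (fact i)\<^sup>2) \<le> exp c / (2 * sqrt c)"
    by (rule sums_le[OF bessel_term_le[OF c] summable_sums[OF summ] S])
qed

text \<open>
  The exponent \<open>2 * sqrt (l * t)\<close> is replaced by its tangent at \<open>t = n\<close> and the factor
  \<open>t powr (-1/4)\<close> by the linear function of \<open>1 / t\<close> that touches it at \<open>t = n\<close>. Then only exponentials
  and integer powers of \<open>t\<close> remain, which can be integrated against Gamma densities.
\<close>
lemma bessel_le_exponential:
  fixes l t :: real and n :: nat
  assumes "0 < l" "0 < t" "0 < n"
  shows "summable (\<lambda>i. (l * t) ^ i / (fact i)\<^sup>2)"
    and "(\<Sum>i. (l * t) ^ i / (fact i)\<^sup>2)
      \<le> exp (sqrt (l * n)) / (8 * sqrt 2 * sqrt (sqrt (l * n))) * (exp (sqrt (l / n) * t) * (3 + n / t))"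
proof -
  define c where "c = 2 * sqrt (l * t)"
  have c: "0 < c" "c\<^sup>2 / 4 = l * t" using assms by (auto simp: c_def power_mult_distrib)
  show "summable (\<lambda>i. (l * t) ^ i / (fact i)\<^sup>2)" using bessel_series(1)[OF c(1)] unfolding c(2) .
  have "(\<Sum>i. (l * t) ^ i / (fact i)\<^sup>2) \<le> exp c / (2 * sqrt c)"
    using bessel_series(2)[OF c(1)] unfolding c(2) .
  also have "exp c \<le> exp (sqrt (l * n) + sqrt (l / n) * t)"
  proof -
    have "0 \<le> (sqrt t - sqrt n)\<^sup>2" by simp
    then have "2 * sqrt t * sqrt n \<le> n + t"
      using assms by (simp add: power2_eq_square algebra_simps)
    then have "sqrt l / sqrt n * (2 * sqrt t * sqrt n) \<le> sqrt l / sqrt n * (n + t)"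
      using assms by (intro mult_left_mono) auto
    moreover have "sqrt l / sqrt n * (2 * sqrt t * sqrt n) = c"
      using assms by (simp add: c_def real_sqrt_mult)
    moreover have "sqrt l / sqrt n * (n + t) = sqrt (l * n) + sqrt (l / n) * t"
      using assms by (simp add: real_sqrt_mult real_sqrt_divide field_simps)
    ultimately show ?thesis by simp
  qed
  also have "exp (sqrt (l * n) + sqrt (l / n) * t) / (2 * sqrt c)
      = exp (sqrt (l * n)) * exp (sqrt (l / n) * t) / (2 * sqrt 2) / sqrt (sqrt (l * t))"
    by (simp add: c_def real_sqrt_mult exp_add)
  also have "\<dots> \<le> exp (sqrt (l * n)) * exp (sqrt (l / n) * t) / (2 * sqrt 2) *
      ((3 + n / t) / (4 * sqrt (sqrt (l * n))))"
  proof -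
    \<comment> \<open>The quartic root of \<open>n / t\<close> is at most \<open>(3 + n / t) / 4\<close>, its tangent at \<open>1\<close>.\<close>
    define v where "v = sqrt (sqrt (n / t))"
    have "0 \<le> (v - 1)\<^sup>2 * ((v + 1)\<^sup>2 + 2)" by simp
    then have "4 * v \<le> 3 + (v\<^sup>2)\<^sup>2"
      by (simp add: power2_eq_square algebra_simps)
    also have "(v\<^sup>2)\<^sup>2 = n / t" using assms by (simp add: v_def)
    finally have "v / sqrt (sqrt (l * n)) \<le> (3 + n / t) / 4 / sqrt (sqrt (l * n))"
      using assms by (intro divide_right_mono) auto
    also have "v / sqrt (sqrt (l * n)) = 1 / sqrt (sqrt (l * t))"
      using assms by (simp add: v_def real_sqrt_mult real_sqrt_divide)
    finally have "1 / sqrt (sqrt (l * t)) \<le> (3 + n / t) / (4 * sqrt (sqrt (l * n)))" by simp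
    from mult_left_mono[OF this, of "exp (sqrt (l * n)) * exp (sqrt (l / n) * t) / (2 * sqrt 2)"]
    show ?thesis by simp
  qed
  also have "\<dots> = exp (sqrt (l * n)) / (8 * sqrt 2 * sqrt (sqrt (l * n))) * (exp (sqrt (l / n) * t) * (3 + n / t))"
    by simp
  finally show "(\<Sum>i. (l * t) ^ i / (fact i)\<^sup>2)
      \<le> exp (sqrt (l * n)) / (8 * sqrt 2 * sqrt (sqrt (l * n))) * (exp (sqrt (l / n) * t) * (3 + n / t))"
    using c by (simp add: divide_right_mono)
qed

text \<open>
  Multiplying a Gamma density by \<open>exp (s * t)\<close> or by \<open>1 / t\<close> changes only its parameters.
\<close>
lemma erlang_density_tilt:
  assumes "0 < t" "0 < n" "s < 1"
  shows "erlang_density n 1 t * (exp (s * t) * (3 + n / t))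
    = 3 / (1 - s) ^ Suc n * erlang_density n (1 - s) t + 1 / (1 - s) ^ n * erlang_density (n - 1) (1 - s) t"
proof -
  obtain k where n: "n = Suc k" using assms by (cases n) auto
  have e: "exp (- t) * exp (s * t) = exp (- (1 - s) * t)"
    by (simp flip: exp_add add: algebra_simps)
  have "erlang_density n 1 t * (exp (s * t) * (3 + n / t))
      = (exp (- t) * exp (s * t)) * (t ^ n / fact n) * (3 + n / t)"
    using assms by (simp add: erlang_density_def)
  also have "\<dots> = 3 * (t ^ n * exp (- (1 - s) * t) / fact n) + t ^ k * exp (- (1 - s) * t) / fact k"
    unfolding e using assms by (simp add: n divide_simps) (simp add: algebra_simps)
  also have "\<dots> = 3 / (1 - s) ^ Suc n * erlang_density n (1 - s) t + 1 / (1 - s) ^ n * erlang_density (n - 1) (1 - s) t"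
    using assms by (simp add: erlang_density_def n)
  finally show ?thesis .
qed

text \<open>
  The series is \<open>\<^sub>1F\<^sub>1 (n + 1; 1; l)\<close>, which is \<open>exp l\<close> times the Laguerre polynomial \<open>L\<^sub>n\<close> at \<open>- l\<close>.
  Because \<open>(n + i)! / n!\<close> is the \<open>i\<close>-th moment of the Erlang distribution with density
  \<open>t ^ n * exp (- t) / n!\<close>, the series is the expectation of the Bessel series in
  \<open>bessel_le_exponential\<close>.
\<close>
lemma kummer_series_le:
  fixes l :: real and n :: nat
  assumes l: "0 < l" "l < n"
    and summ: "summable (\<lambda>i. l ^ i * fact (n + i) / (fact n * (fact i)\<^sup>2))"
  shows "(\<Sum>i. l ^ i * fact (n + i) / (fact n * (fact i)\<^sup>2))
    \<le> exp (sqrt (l * n)) / (2 * sqrt 2 * sqrt (sqrt (l * n))) / (1 - sqrt (l / n)) ^ Suc n" (is "_ \<le> ?R")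
proof -
  define s where "s = sqrt (l / n)"
  define C where "C = exp (sqrt (l * n)) / (8 * sqrt 2 * sqrt (sqrt (l * n)))"
  have n: "0 < n" and s: "0 \<le> s" "s < 1" and C: "0 \<le> C" using l by (auto simp: s_def C_def)
  define D1 where "D1 = 3 / (1 - s) ^ Suc n"
  define D2 where "D2 = 1 / (1 - s) ^ n"
  have D: "0 \<le> D1" "0 \<le> D2" using s by (auto simp: D1_def D2_def)
  have "ennreal (\<Sum>i. l ^ i * fact (n + i) / (fact n * (fact i)\<^sup>2))
      = (\<Sum>i. ennreal (l ^ i * fact (n + i) / (fact n * (fact i)\<^sup>2)))"
    using l summ by (intro suminf_ennreal2[symmetric]) auto
  also have "\<dots> = (\<Sum>i. \<integral>\<^sup>+t. ennreal (l ^ i / (fact i)\<^sup>2) * ennreal (erlang_density n 1 t * t ^ i) \<partial>lborel)"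
  proof (intro suminf_cong)
    fix i
    have "(\<integral>\<^sup>+t. ennreal (l ^ i / (fact i)\<^sup>2) * ennreal (erlang_density n 1 t * t ^ i) \<partial>lborel)
        = ennreal (l ^ i / (fact i)\<^sup>2) * ennreal (fact (n + i) / fact n)"
      using nn_integral_erlang_ith_moment[of 1 n i] by (subst nn_integral_cmult) auto
    also have "\<dots> = ennreal (l ^ i * fact (n + i) / (fact n * (fact i)\<^sup>2))"
      using l by (subst ennreal_mult[symmetric]) (auto simp: mult.commute)
    finally show "ennreal (l ^ i * fact (n + i) / (fact n * (fact i)\<^sup>2))
      = (\<integral>\<^sup>+t. ennreal (l ^ i / (fact i)\<^sup>2) * ennreal (erlang_density n 1 t * t ^ i) \<partial>lborel)" ..
  qed
  also have "\<dots> = (\<integral>\<^sup>+t. (\<Sum>i. ennreal (l ^ i / (fact i)\<^sup>2) * ennreal (erlang_density n 1 t * t ^ i)) \<partial>lborel)"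
    by (intro nn_integral_suminf[symmetric]) measurable
  also have "\<dots> \<le> (\<integral>\<^sup>+t. ennreal (C * D1) * ennreal (erlang_density n (1 - s) t)
      + ennreal (C * D2) * ennreal (erlang_density (n - 1) (1 - s) t) \<partial>lborel)"
  proof (rule nn_integral_mono)
    fix t :: real
    show "(\<Sum>i. ennreal (l ^ i / (fact i)\<^sup>2) * ennreal (erlang_density n 1 t * t ^ i))
      \<le> ennreal (C * D1) * ennreal (erlang_density n (1 - s) t)
      + ennreal (C * D2) * ennreal (erlang_density (n - 1) (1 - s) t)"
    proof (cases "0 < t")
      case False
      then have "erlang_density n 1 t = 0" using n by (auto simp: erlang_density_def)
      then show ?thesis by simp
    next
      case True
      note B = bessel_le_exponential[OF l(1) True n]
      have "(\<Sum>i. ennreal (l ^ i / (fact i)\<^sup>2) * ennreal (erlang_density n 1 t * t ^ i))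
          = (\<Sum>i. ennreal (erlang_density n 1 t * ((l * t) ^ i / (fact i)\<^sup>2)))"
        using l True
        by (intro suminf_cong) (auto simp: ennreal_mult[symmetric] power_mult_distrib mult_ac)
      also have "\<dots> = ennreal (\<Sum>i. erlang_density n 1 t * ((l * t) ^ i / (fact i)\<^sup>2))"
        using l True B(1) by (intro suminf_ennreal2 summable_mult) auto
      also have "\<dots> = ennreal (erlang_density n 1 t * (\<Sum>i. (l * t) ^ i / (fact i)\<^sup>2))"
        by (simp only: suminf_mult[OF B(1)])
      also have "\<dots> \<le> ennreal (erlang_density n 1 t * (C * (exp (s * t) * (3 + n / t))))"
        using B(2) unfolding C_def s_def by (intro ennreal_leI mult_left_mono) auto
      also have "erlang_density n 1 t * (C * (exp (s * t) * (3 + n / t)))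
          = C * D1 * erlang_density n (1 - s) t + C * D2 * erlang_density (n - 1) (1 - s) t"
      proof -
        have "erlang_density n 1 t * (C * (exp (s * t) * (3 + n / t)))
            = C * (erlang_density n 1 t * (exp (s * t) * (3 + n / t)))"
          by (simp only: mult_ac)
        then show ?thesis
          unfolding erlang_density_tilt[OF True n s(2)] D1_def D2_def by (simp only: distrib_left mult.assoc)
      qed
      also have "ennreal (C * D1 * erlang_density n (1 - s) t + C * D2 * erlang_density (n - 1) (1 - s) t)
          = ennreal (C * D1) * ennreal (erlang_density n (1 - s) t)
      + ennreal (C * D2) * ennreal (erlang_density (n - 1) (1 - s) t)"
        using C D s by (simp add: ennreal_plus ennreal_mult[symmetric])
      finally show ?thesis .
    qed
  qed
  also have "\<dots> = ennreal (C * D1) + ennreal (C * D2)"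
    using nn_integral_erlang_ith_moment[of "1 - s" n 0] nn_integral_erlang_ith_moment[of "1 - s" "n - 1" 0] s
    by (subst nn_integral_add) (auto simp: nn_integral_cmult)
  also have "\<dots> = ennreal (C * (D1 + D2))" using C D by (simp add: ennreal_plus[symmetric] algebra_simps del: ennreal_plus)
  finally have "(\<Sum>i. l ^ i * fact (n + i) / (fact n * (fact i)\<^sup>2)) \<le> C * (D1 + D2)"
    using C D by (subst (asm) ennreal_le_iff) auto
  also have "D2 \<le> 1 / (1 - s) ^ Suc n"
    unfolding D2_def using s by (intro divide_left_mono power_decreasing) auto
  then have "C * (D1 + D2) \<le> C * (4 / (1 - s) ^ Suc n)"
    unfolding D1_def by (intro mult_left_mono C) auto
  also have "\<dots> = ?R" unfolding C_def s_def by simp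
  finally show ?thesis .
qed

text \<open>
  The difference of the two sides has derivative \<open>s ^ 3 / (3 * (1 - s)\<^sup>2)\<close>.
\<close>
lemma neg_ln_one_minus_le:
  fixes s :: real
  assumes "0 \<le> s" "s < 1"
  shows "- ln (1 - s) \<le> s + s\<^sup>2 / 2 + s ^ 3 / (3 * (1 - s))"
proof -
  define g where "g x = x + x\<^sup>2 / 2 + x ^ 3 / (3 * (1 - x)) + ln (1 - x)" for x :: real
  have "g 0 \<le> g s"
  proof (rule DERIV_nonneg_imp_nondecreasing[OF assms(1)])
    fix x :: real assume x: "0 \<le> x" "x \<le> s"
    then have "x < 1" using assms by simp
    then have "(g has_real_derivative
        1 + x + (3 * x\<^sup>2 * (3 * (1 - x)) + 3 * x ^ 3) / (3 * (1 - x))\<^sup>2 - 1 / (1 - x)) (at x)"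
      unfolding g_def by (auto intro!: derivative_eq_intros simp: power2_eq_square)
    moreover have "1 + x + (3 * x\<^sup>2 * (3 * (1 - x)) + 3 * x ^ 3) / (3 * (1 - x))\<^sup>2 - 1 / (1 - x)
        = x ^ 3 / (3 * (1 - x)\<^sup>2)"
      using \<open>x < 1\<close> by (simp add: divide_simps) (simp add: power2_eq_square power3_eq_cube algebra_simps)
    ultimately show "\<exists>y. (g has_real_derivative y) (at x) \<and> 0 \<le> y"
      using x by auto
  qed
  then show ?thesis by (simp add: g_def)
qed

text \<open>
  With \<open>s = sqrt (l / n)\<close> one has \<open>n * s = sqrt (l * n)\<close> and \<open>n * s\<^sup>2 = l\<close>, so the first two
  logarithmic terms of \<open>(1 - s) powr - n\<close> contribute \<open>exp (sqrt (l * n) + l / 2)\<close>. The assumption with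
  the square says \<open>s * (1 + l / 2) \<le> 1\<close> and keeps the remaining terms below \<open>2 / 3\<close>; the other one
  bounds \<open>s\<close> away from \<open>1\<close>. Everything left is a numerical constant, below \<open>4.6\<close>, which the last
  factor of \<open>c_L\<close> exceeds.
\<close>
lemma kummer_constant_le:
  fixes l :: real and n :: nat
  assumes l: "0 < l" and n: "5 * l \<le> n" "l * (1 + l / 2)\<^sup>2 \<le> n"
  shows "exp (sqrt (l * n)) / (2 * sqrt 2 * sqrt (sqrt (l * n))) / (1 - sqrt (l / n)) ^ Suc n
    \<le> c_L l * real n powr (-1/4) * exp (2 * sqrt (l * n))"
proof -
  define s where "s = sqrt (l / n)"
  have n0: "0 < real n" using n l by linarith
  have s0: "0 < s" using l n0 by (simp add: s_def)
  \<comment> \<open>The number \<open>1 / sqrt 5\<close> is just below \<open>1 - 1 / 1.81\<close>.\<close>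
  have s1: "s \<le> 1 - 1 / 1.81"
  proof -
    have "l / n \<le> (1 - 1 / 1.81)\<^sup>2"
      using n(1) n0 by (simp add: field_simps power2_eq_square)
    then have "sqrt (l / n) \<le> sqrt ((1 - 1 / 1.81)\<^sup>2)" by (rule real_sqrt_le_mono)
    then show ?thesis by (simp add: s_def)
  qed
  have s2: "s * (1 + l / 2) \<le> 1"
  proof -
    have "s\<^sup>2 = l / n" using l n0 by (simp add: s_def)
    then have "(s * (1 + l / 2))\<^sup>2 \<le> 1"
      using n(2) n0 by (simp add: power_mult_distrib divide_le_eq)
    then show ?thesis using power2_le_imp_le[of "s * (1 + l / 2)" 1] by simp
  qed
  have ns: "n * s = sqrt (l * n)" "n * s\<^sup>2 = l"
    using l n0 by (auto simp: s_def real_sqrt_divide real_sqrt_mult field_simps)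
  have "n * (s + s\<^sup>2 / 2 + s ^ 3 / (3 * (1 - s))) = n * s + (n * s\<^sup>2) / 2 + (n * s\<^sup>2) * s / (3 * (1 - s))"
    by (simp add: power2_eq_square power3_eq_cube algebra_simps)
  also have "(n * s\<^sup>2) * s / (3 * (1 - s)) \<le> 2 / 3"
    using s1 s2 unfolding ns by (simp add: field_simps)
  finally have "n * (s + s\<^sup>2 / 2 + s ^ 3 / (3 * (1 - s))) \<le> sqrt (l * n) + l / 2 + 2 / 3"
    unfolding ns by simp
  moreover have "n * (- ln (1 - s)) \<le> n * (s + s\<^sup>2 / 2 + s ^ 3 / (3 * (1 - s)))"
    using s0 s1 by (intro mult_left_mono neg_ln_one_minus_le) auto
  ultimately have "n * (- ln (1 - s)) \<le> sqrt (l * n) + l / 2 + 2 / 3"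
    by (rule order.trans[rotated])
  then have "exp (n * (- ln (1 - s))) \<le> exp (sqrt (l * n) + l / 2) * exp (2 / 3)"
    by (simp flip: exp_add)
  moreover have "exp (n * (- ln (1 - s))) = 1 / (1 - s) ^ n"
    using s1 by (simp add: exp_minus exp_of_nat_mult field_simps)
  moreover have "exp (2 / 3 :: real) \<le> 2"
  proof (rule power_le_imp_le_base)
    have "exp (2 / 3 :: real) ^ Suc 2 = exp 1 ^ 2"
      by (simp flip: exp_of_nat_mult)
    also have "\<dots> \<le> (2.72 :: real) ^ 2"
      using e_less_272 by (intro power_mono) auto
    finally show "exp (2 / 3 :: real) ^ Suc 2 \<le> 2 ^ Suc 2" by (simp add: power2_eq_square)
  qed simp
  then have "exp (sqrt (l * n) + l / 2) * exp (2 / 3) \<le> exp (sqrt (l * n) + l / 2) * 2"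
    by (intro mult_left_mono) auto
  ultimately have A: "1 / (1 - s) ^ n \<le> exp (sqrt (l * n) + l / 2) * 2" by linarith
  have "1 / (1 - s) \<le> 1.81" using s1 by (simp add: field_simps)
  with A have "1 / (1 - s) ^ n * (1 / (1 - s)) \<le> exp (sqrt (l * n) + l / 2) * 2 * 1.81"
    using s1 by (intro mult_mono) auto
  then have "exp (sqrt (l * n)) / (2 * sqrt 2 * sqrt (sqrt (l * n))) * (1 / (1 - s) ^ n * (1 / (1 - s)))
    \<le> exp (sqrt (l * n)) / (2 * sqrt 2 * sqrt (sqrt (l * n))) * (exp (sqrt (l * n) + l / 2) * 2 * 1.81)"
    using l by (intro mult_left_mono) auto
  also have "\<dots> = exp (2 * sqrt (l * n) + l / 2) / (2 * sqrt pi * sqrt (sqrt (l * n))) * (2 * 1.81 * (sqrt pi / sqrt 2))"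
    by (simp add: mult_exp_exp divide_simps)
  also have "\<dots> \<le> exp (2 * sqrt (l * n) + l / 2) / (2 * sqrt pi * sqrt (sqrt (l * n))) * (2 * 1.81 * 1.27)"
  proof -
    have "sqrt pi / sqrt 2 = sqrt (pi / 2)" by (simp add: real_sqrt_divide)
    also have "\<dots> \<le> sqrt (1.27\<^sup>2)" using pi_approx by (intro real_sqrt_le_mono) (auto simp: power2_eq_square)
    finally have "sqrt pi / sqrt 2 \<le> 1.27" by simp
    then show ?thesis using l by (intro mult_left_mono) auto
  qed
  also have "\<dots> \<le> exp (2 * sqrt (l * n) + l / 2) / (2 * sqrt pi * sqrt (sqrt (l * n))) *
      (exp (2 * sqrt l) * (3 + sqrt (pi / exp 1) + 2 / (sqrt pi * l powr (1/4)) + 7 / (16 * sqrt l)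
        + sqrt l * (2 + l)))"
  proof (rule mult_left_mono)
    define x where "x = sqrt l"
    have x: "0 < x" "l = x\<^sup>2" using l by (auto simp: x_def)
    \<comment> \<open>By the inequality of the means \<open>7 / (16 * x) + 2 * x\<close> is at least \<open>1.6\<close>, and together with the summand \<open>3\<close> this reaches the constant.\<close>
    have "0 \<le> 2 * (x - 0.4)\<^sup>2 + (7 / 16 - 2 * 0.4\<^sup>2)" by (simp add: power2_eq_square)
    then have "0 \<le> (2 * (x - 0.4)\<^sup>2 + (7 / 16 - 2 * 0.4\<^sup>2)) / x" using x by simp
    also have "\<dots> = 7 / (16 * x) + 2 * x - 1.6"
      using x by (simp add: field_simps power2_eq_square)
    finally have "1.6 \<le> 7 / (16 * x) + x * 2" by simp
    moreover have "0 \<le> x * l" "0 \<le> sqrt (pi / exp 1)" "0 \<le> 2 / (sqrt pi * l powr (1/4))"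
      using x l by auto
    moreover have "2 * 1.81 * 1.27 \<le> (46 / 10 :: real)" by simp
    ultimately have Q: "2 * 1.81 * 1.27 \<le> 3 + sqrt (pi / exp 1) + 2 / (sqrt pi * l powr (1/4)) + 7 / (16 * sqrt l)
        + sqrt l * (2 + l)" (is "_ \<le> ?Q")
      unfolding x_def[symmetric] distrib_left by linarith
    have "0 \<le> ?Q" by (rule order.trans[OF _ Q]) simp
    then have "1 * ?Q \<le> exp (2 * sqrt l) * ?Q"
      using l by (intro mult_right_mono) auto
    from order.trans[OF Q this[unfolded mult_1_left]]
    show "2 * 1.81 * 1.27 \<le> exp (2 * sqrt l) * ?Q" .
  qed (use l in simp)
  also have "\<dots> = c_L l * real n powr (-1/4) * exp (2 * sqrt (l * n))"
  proof -
    have "sqrt (sqrt x) = x powr (1/4)" if "0 < x" for x :: real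
      using that by (simp add: powr_half_sqrt[symmetric] powr_powr)
    then have q: "sqrt (sqrt (l * n)) = l powr (1/4) * real n powr (1/4)"
      using l n0 by (simp add: powr_mult)
    have e: "exp (2 * sqrt (l * n) + l / 2) * exp (2 * sqrt l) = exp (l / 2 + 2 * sqrt l) * exp (2 * sqrt (l * n))"
      by (simp flip: exp_add add: algebra_simps)
    have "u / (2 * sqrt pi * (a * b)) * (v * w) = x / (2 * sqrt pi * a) * w * (1 / b) * y"
      if "u * v = x * y" for a b u v w x y :: real
    proof -
      have "u / (2 * sqrt pi * (a * b)) * (v * w) = (u * v) * (w / (2 * sqrt pi * (a * b)))" by simp
      also have "\<dots> = x / (2 * sqrt pi * a) * w * (1 / b) * y" unfolding that by (simp add: mult_ac)
      finally show ?thesis .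
    qed
    from this[OF e] show ?thesis
      unfolding q c_L_def by (simp add: powr_minus_divide)
  qed
  finally show ?thesis by (simp add: s_def mult.commute[of "1 - sqrt (l / n)"])
qed

lemma c_L_nonneg: "0 < l \<Longrightarrow> 0 \<le> c_L l"
  by (auto simp: c_L_def intro!: mult_nonneg_nonneg divide_nonneg_nonneg add_nonneg_nonneg)

text \<open>
  The terms with \<open>j < n\<close> vanish, and with \<open>j = n + i\<close> the series becomes \<open>l ^ n / n!\<close> times the
  one in \<open>kummer_series_le\<close>.
\<close>
lemma binomial_squares_sum_le:
  fixes l :: real and n :: nat
  assumes l: "0 < l" and n: "m_L l \<le> n"
  obtains S where "(\<lambda>j. l ^ j / fact j * (real (j choose n))\<^sup>2) sums S"
    and "S \<le> c_L l * real n powr (-1/4) * exp (2 * sqrt (l * n)) * l ^ n / fact n"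
proof -
  let ?a = "\<lambda>j. l ^ j / fact j * (real (j choose n))\<^sup>2"
  let ?b = "\<lambda>i. l ^ i * fact (n + i) / (fact n * (fact i)\<^sup>2)"
  have n': "5 * l \<le> n" "l * (1 + l / 2)\<^sup>2 \<le> n" using n by (auto simp: m_L_def)
  have summ: "summable ?a" using l by (intro summable_binomial_squares) auto
  have ab: "?a (i + n) = l ^ n / fact n * ?b i" for i
  proof -
    define B where "B = real (i + n choose n)"
    have B: "0 < B" by (simp add: B_def)
    have f: "fact (i + n) = B * (fact n * fact i)"
      using binomial_fact[of n "i + n", where 'a = real] by (simp add: B_def)
    show ?thesis
      unfolding add.commute[of n i] f B_def[symmetric]
      using B by (simp add: power_add power2_eq_square)
  qed
  have "summable (\<lambda>i. l ^ n / fact n * ?b i)"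
    using summable_ignore_initial_segment[OF summ, of n] unfolding ab .
  from summable_mult_D[OF this] have sb: "summable ?b" using l by auto
  have "(\<Sum>i<n. ?a i) = 0" by (simp add: binomial_eq_0)
  then have "suminf ?a = (\<Sum>i. ?a (i + n))"
    using suminf_split_initial_segment[OF summ, of n] by simp
  also have "\<dots> = l ^ n / fact n * (\<Sum>i. ?b i)"
    unfolding ab by (rule suminf_mult[OF sb])
  also have "\<dots> \<le> l ^ n / fact n * (c_L l * real n powr (-1/4) * exp (2 * sqrt (l * n)))"
    using kummer_series_le[OF l _ sb] kummer_constant_le[OF l n'] l n'
    by (intro mult_left_mono) (linarith, simp)
  finally have "suminf ?a \<le> l ^ n / fact n * (c_L l * real n powr (-1/4) * exp (2 * sqrt (l * n)))" .
  with summ show ?thesis by (intro that[of "suminf ?a"]) (auto simp: summable_sums mult_ac)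
qed

section \<open>Chebyshev polynomials and their coefficients\<close>

text \<open>
  Chebyshev polynomials of the first kind for \<open>c = 1\<close> and of the second kind for \<open>c = 2\<close>; the two
  families differ only in the polynomial of degree one.
\<close>
fun chebyshev :: "real \<Rightarrow> nat \<Rightarrow> real poly" where
  "chebyshev c 0 = 1"
| "chebyshev c (Suc 0) = [:0, c:]"
| "chebyshev c (Suc (Suc n)) = smult 2 (pCons 0 (chebyshev c (Suc n))) - chebyshev c n"

lemma poly_chebyshev_1: "poly (chebyshev 1 n) (cos \<theta>) = cos (n * \<theta>)"
proof (induction "1 :: real" n rule: chebyshev.induct)
  case (3 n)
  have "cos ((real n * \<theta> + \<theta>) + \<theta>) = 2 * cos \<theta> * cos (real n * \<theta> + \<theta>) - cos ((real n * \<theta> + \<theta>) - \<theta>)"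
    unfolding cos_add[of "real n * \<theta> + \<theta>"] cos_diff[of "real n * \<theta> + \<theta>"] by simp
  then show ?case using 3 by (simp add: algebra_simps)
qed auto

lemma poly_chebyshev_2: "poly (chebyshev 2 n) (cos \<theta>) * sin \<theta> = sin (real (Suc n) * \<theta>)"
proof (induction "2 :: real" n rule: chebyshev.induct)
  case 2
  then show ?case by (simp add: sin_double)
next
  case (3 n)
  have "sin ((real n * \<theta> + 2 * \<theta>) + \<theta>)
      = 2 * cos \<theta> * sin (real n * \<theta> + 2 * \<theta>) - sin ((real n * \<theta> + 2 * \<theta>) - \<theta>)"
    unfolding sin_add[of "real n * \<theta> + 2 * \<theta>"] sin_diff[of "real n * \<theta> + 2 * \<theta>"] by simp
  also have "\<dots> = 2 * cos \<theta> * (poly (chebyshev 2 (Suc n)) (cos \<theta>) * sin \<theta>) - poly (chebyshev 2 n) (cos \<theta>) * sin \<theta>"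
    unfolding 3 by (simp add: algebra_simps)
  also have "\<dots> = poly (chebyshev 2 (Suc (Suc n))) (cos \<theta>) * sin \<theta>" by (simp add: algebra_simps)
  finally show ?case by (simp add: algebra_simps)
qed simp

lemma coeff_chebyshev_eq_0: "n < i \<Longrightarrow> coeff (chebyshev c n) i = 0"
  by (induction c n arbitrary: i rule: chebyshev.induct) (auto simp: coeff_pCons split: nat.splits)

lemma lead_coeff_chebyshev: "coeff (chebyshev c (Suc n)) (Suc n) = c * 2 ^ n"
proof (induction n)
  case (Suc n)
  then show ?case by (simp add: coeff_chebyshev_eq_0)
qed simp

lemma lead_coeff_chebyshev_2: "coeff (chebyshev 2 n) n = 2 ^ n"
  by (cases n) (auto simp: lead_coeff_chebyshev)

lemma degree_chebyshev_le: "degree (chebyshev c n) \<le> n"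
  by (intro degree_le) (auto simp: coeff_chebyshev_eq_0)

text \<open>
  With alternating signs this is the classical explicit formula for the coefficients. The recurrence
  turns into Pascal's rule, and absolute values make the signs irrelevant.
\<close>
lemma abs_coeff_chebyshev_2:
  "\<bar>coeff (chebyshev 2 n) i\<bar> \<le> (if even (n + i) then 2 ^ i * real ((n + i) div 2 choose i) else 0)"
proof (induction "2 :: real" n arbitrary: i rule: chebyshev.induct)
  case 1
  then show ?case by (cases i) auto
next
  case 2
  then show ?case by (auto simp: coeff_pCons split: nat.splits)
next
  case (3 n)
  show ?case
  proof (cases i)
    case 0
    then show ?thesis using 3(2)[of 0] by (auto split: if_splits)
  next
    case (Suc k)
    have a: "\<bar>coeff (chebyshev 2 (Suc (Suc n))) i\<bar>
        \<le> 2 * \<bar>coeff (chebyshev 2 (Suc n)) k\<bar> + \<bar>coeff (chebyshev 2 n) (Suc k)\<bar>"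
      by (simp add: Suc)
    show ?thesis
    proof (cases "even (n + Suc k)")
      case True
      then obtain m where m: "n + Suc k = 2 * m" by (elim evenE)
      then have d: "(Suc n + k) div 2 = m" "(Suc (Suc n) + Suc k) div 2 = Suc m" "(n + Suc k) div 2 = m"
        by auto
      have "\<bar>coeff (chebyshev 2 (Suc n)) k\<bar> \<le> 2 ^ k * real (m choose k)"
        using 3(1)[of k] True d by simp
      moreover have "\<bar>coeff (chebyshev 2 n) (Suc k)\<bar> \<le> 2 ^ Suc k * real (m choose Suc k)"
        using 3(2)[of "Suc k"] True d by simp
      ultimately show ?thesis using a d True Suc by (simp add: algebra_simps)
    next
      case False
      then show ?thesis using a 3(1)[of k] 3(2)[of "Suc k"] Suc by simp
    qed
  qed
qed

lemma chebyshev_2_expansion: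
  fixes P :: "real poly"
  assumes "degree P \<le> n"
  shows "\<exists>d. P = (\<Sum>j\<le>n. smult (d j) (chebyshev 2 j))"
  using assms
proof (induction n arbitrary: P)
  case 0
  then obtain a where "P = [:a:]" by (metis degree_eq_zeroE le_zero_eq)
  then show ?case by (intro exI[of _ "\<lambda>_. a"]) simp
next
  case (Suc n)
  define b where "b = coeff P (Suc n) / 2 ^ Suc n"
  define Q where "Q = P - smult b (chebyshev 2 (Suc n))"
  have "coeff Q i = 0" if "n < i" for i
  proof (cases "i = Suc n")
    case True
    then show ?thesis by (simp add: Q_def b_def lead_coeff_chebyshev_2 del: chebyshev.simps)
  next
    case False
    then show ?thesis using that Suc.prems
      by (simp add: Q_def coeff_chebyshev_eq_0 coeff_eq_0 del: chebyshev.simps)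
  qed
  then have "degree Q \<le> n" by (intro degree_le) auto
  from Suc.IH[OF this] obtain d where d: "Q = (\<Sum>j\<le>n. smult (d j) (chebyshev 2 j))" ..
  have "P = (\<Sum>j\<le>Suc n. smult ((d(Suc n := b)) j) (chebyshev 2 j))"
    using d by (simp add: Q_def diff_eq_eq del: chebyshev.simps)
  then show ?case by blast
qed

text \<open>
  In terms of \<open>i = j - 2 * m\<close> the \<open>i\<close>-th summand is, by \<open>abs_coeff_chebyshev_2\<close> and the log-convexity
  of the factorial, at most \<open>(4 / l) ^ j * j!\<close> times \<open>((l / 4)\<^sup>2) ^ m / (m!)\<^sup>2\<close>. The resulting Bessel series
  does not depend on \<open>j\<close>.
\<close>
lemma chebyshev_2_weighted_norm:
  fixes l :: real
  assumes l: "0 < l" and jn: "j \<le> n"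
  shows "(\<Sum>i\<le>n. (coeff (chebyshev 2 j) i)\<^sup>2 * (fact i / l ^ i))
    \<le> (4 / l) ^ j * fact j * (\<Sum>m. ((l / 4)\<^sup>2) ^ m / (fact m)\<^sup>2)" (is "(\<Sum>i\<le>n. ?t i) \<le> ?C * suminf ?b")
proof -
  have summ: "summable ?b" using bessel_series(1)[of "l / 2"] l by (simp add: power_divide)
  have "(\<Sum>i\<le>n. ?t i) = (\<Sum>i\<in>(\<lambda>m. j - 2 * m) ` {..j div 2}. ?t i)"
  proof (rule sum.mono_neutral_right)
    show "\<forall>i\<in>{..n} - (\<lambda>m. j - 2 * m) ` {..j div 2}. ?t i = 0"
    proof
      fix i assume i: "i \<in> {..n} - (\<lambda>m. j - 2 * m) ` {..j div 2}"
      have "j < i \<or> odd (j + i)"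
      proof (rule ccontr)
        assume a: "\<not> (j < i \<or> odd (j + i))"
        then have "even (j + i)" by simp
        then obtain m where "j + i = 2 * m" by (rule evenE)
        with a have "i = j - 2 * (j - m)" "j - m \<le> j div 2" by auto
        then show False using i by blast
      qed
      then show "?t i = 0"
        using abs_coeff_chebyshev_2[of j i] by (auto simp: coeff_chebyshev_eq_0)
    qed
  qed (use jn in auto)
  also have "\<dots> = (\<Sum>m\<le>j div 2. ?t (j - 2 * m))"
    by (subst sum.reindex) (auto simp: inj_on_def)
  also have "\<dots> \<le> (\<Sum>m\<le>j div 2. ?C * ?b m)"
  proof (rule sum_mono)
    fix m assume "m \<in> {..j div 2}"
    then obtain k where k: "j = k + 2 * m"
      by (metis add.commute atMost_iff le_add_diff_inverse less_eq_div_iff_mult_less_eq mult.commute zero_less_numeral)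
    have "real (k + m choose k) = fact (k + m) / (fact k * fact m)"
      using binomial_fact[of k "k + m", where 'a = real] by simp
    moreover have "fact (k + m) / fact k \<le> (fact (k + 2 * m) / fact (k + m) :: real)"
    proof -
      have "(k + m choose m) \<le> (k + 2 * m choose m)" by (intro binomial_right_mono) auto
      then have "real (k + m choose m) \<le> real (k + 2 * m choose m)" by simp
      moreover have "fact (k + m) / fact k = fact m * real (k + m choose m)"
        "fact (k + 2 * m) / fact (k + m) = fact m * real (k + 2 * m choose m)"
        using binomial_fact[of m "k + m", where 'a = real] binomial_fact[of m "k + 2 * m", where 'a = real]
        by (simp_all add: add.commute[of m k])
      ultimately show ?thesis by simp
    qed
    then have "fact (k + m) / (fact k * fact m) * (fact (k + m) / (fact k * fact m)) * fact k
        \<le> (fact (k + 2 * m) / (fact m)\<^sup>2 :: real)"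
      by (simp add: field_simps power2_eq_square)
    ultimately have B: "(real (k + m choose k))\<^sup>2 * fact k \<le> fact j / (fact m)\<^sup>2"
      unfolding k power2_eq_square by simp
    have "\<bar>coeff (chebyshev 2 j) k\<bar> \<le> 2 ^ k * real (k + m choose k)"
      using abs_coeff_chebyshev_2[of j k] unfolding k by simp
    then have "(coeff (chebyshev 2 j) k)\<^sup>2 \<le> (2 ^ k * real (k + m choose k))\<^sup>2"
      by (metis abs_ge_zero power2_abs power_mono)
    then have "?t k \<le> (2 ^ k * real (k + m choose k))\<^sup>2 * (fact k / l ^ k)"
      using l by (intro mult_right_mono) auto
    also have "\<dots> = (4 / l) ^ k * ((real (k + m choose k))\<^sup>2 * fact k)"
      by (simp add: power_mult_distrib power_divide flip: power_mult) (simp add: power_mult mult.commute[of k])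
    also have "\<dots> \<le> (4 / l) ^ k * (fact j / (fact m)\<^sup>2)"
      using B l by (intro mult_left_mono) auto
    also have "(4 / l) ^ k = (4 / l) ^ j * ((l / 4)\<^sup>2) ^ m"
      using l by (simp add: k power_add power_mult power_divide)
    finally show "?t (j - 2 * m) \<le> ?C * ?b m" by (simp add: k mult_ac)
  qed
  also have "\<dots> = ?C * sum ?b {..j div 2}" by (simp add: sum_distrib_left)
  also have "\<dots> \<le> ?C * suminf ?b"
    using l by (intro mult_left_mono sum_le_suminf summ) auto
  finally show ?thesis .
qed

text \<open>
  For small \<open>s\<close> the elementary bounds \<open>exp (s\<^sup>2)\<close> and \<open>1 + 4 * s\<close> of the two factors suffice. For large
  \<open>s\<close> the series grows only like \<open>exp (2 * s) / sqrt s\<close>, and the left-hand side like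
  \<open>exp (3 * s - s\<^sup>2) * exp (s\<^sup>2)\<close>, whose first factor is at most \<open>exp (9 / 4)\<close>.
\<close>
lemma bessel_exp_ineq:
  fixes s :: real
  assumes s: "0 < s"
  shows "(\<Sum>m. (s\<^sup>2) ^ m / (fact m)\<^sup>2) * (2 * exp s - 1) \<le> (1 + 4 * s) * exp (s\<^sup>2)" (is "?B * _ \<le> _")
proof -
  have summ: "summable (\<lambda>m. (s\<^sup>2) ^ m / (fact m)\<^sup>2)"
    and B2: "?B \<le> exp (2 * s) / (2 * sqrt (2 * s))"
    using bessel_series[of "2 * s"] s by (simp_all add: power_mult_distrib)
  have B0: "0 \<le> ?B" by (intro suminf_nonneg summ) auto
  show ?thesis
  proof (cases "s \<le> 5 / 4")
    case True
    have "(\<lambda>m. (s\<^sup>2) ^ m / fact m) sums exp (s\<^sup>2)"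
      by (rule exp_sums_real)
    moreover have le: "(s\<^sup>2) ^ m / (fact m)\<^sup>2 \<le> (s\<^sup>2) ^ m / fact m" for m
      using s self_le_power[of "fact m :: real" 2] fact_ge_1[of m, where 'a = real]
      by (intro divide_left_mono) auto
    ultimately have B1: "?B \<le> exp (s\<^sup>2)"
      using sums_le[OF le summable_sums[OF summ]] by blast
    have e: "exp (5 / 4 :: real) \<le> 7 / 2"
    proof (rule power_le_imp_le_base)
      have "exp (5 / 4 :: real) ^ Suc 3 = exp 1 ^ 5" by (simp flip: exp_of_nat_mult)
      also have "\<dots> \<le> (272 / 100 :: real) ^ 5"
        using e_less_272 by (intro power_mono) auto
      finally show "exp (5 / 4 :: real) ^ Suc 3 \<le> (7 / 2) ^ Suc 3" by (simp add: power_divide)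
    qed simp
    \<comment> \<open>By convexity \<open>exp s \<le> 1 + 2 * s\<close> follows from the case \<open>s = 5 / 4\<close>.\<close>
    define u where "u = s / (5 / 4)"
    have u: "0 \<le> u" "u \<le> 1" "s = u * (5 / 4)" using s True by (auto simp: u_def)
    have "exp s \<le> (1 - u) * exp 0 + u * exp (5 / 4)"
      using convex_onD[OF exp_convex, of u 0 "5 / 4"] u(1,2) unfolding u(3) by simp
    also have "\<dots> \<le> (1 - u) * exp 0 + u * (7 / 2)"
      using e u by (intro add_left_mono mult_left_mono) auto
    also have "\<dots> = 1 + 2 * s" using u(3) by simp
    finally have "2 * exp s - 1 \<le> 1 + 4 * s" by simp
    moreover have "1 \<le> exp s" using s by simp
    then have "0 \<le> 2 * exp s - 1" by linarith
    ultimately have "?B * (2 * exp s - 1) \<le> exp (s\<^sup>2) * (1 + 4 * s)"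
      using B0 B1 by (intro mult_mono) auto
    then show ?thesis by (simp add: mult.commute)
  next
    case False
    \<comment> \<open>Completing the square in \<open>3 * s - s\<^sup>2 = 9 / 4 - (s - 3 / 2)\<^sup>2\<close>; the quadratic gain is needed near \<open>s = 5 / 4\<close>.\<close>
    define q where "q = 1 + (s - 3 / 2)\<^sup>2"
    have q: "1 \<le> q" by (simp add: q_def)
    have e: "exp (9 / 4 :: real) \<le> 10"
    proof (rule power_le_imp_le_base)
      have "exp (9 / 4 :: real) ^ Suc 3 = exp 1 ^ 9" by (simp flip: exp_of_nat_mult)
      also have "\<dots> \<le> (272 / 100 :: real) ^ 9"
        using e_less_272 by (intro power_mono) auto
      finally show "exp (9 / 4 :: real) ^ Suc 3 \<le> 10 ^ Suc 3" by (simp add: power_divide)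
    qed simp
    have "sqrt ((158 / 100)\<^sup>2) \<le> sqrt (2 * s)"
      using False by (intro real_sqrt_le_mono) (simp add: power_divide)
    then have r: "158 / 100 \<le> sqrt (2 * s)" by simp
    have "exp (3 * s) = exp (s\<^sup>2) * exp (9 / 4) / exp ((s - 3 / 2)\<^sup>2)"
      by (simp flip: exp_add exp_diff) (simp add: power2_eq_square algebra_simps)
    also have "\<dots> \<le> exp (s\<^sup>2) * 10 / q"
      using e exp_ge_add_one_self[of "(s - 3 / 2)\<^sup>2"] q by (intro frac_le mult_left_mono) (auto simp: q_def intro: add_pos_nonneg)
    finally have E: "exp (3 * s) \<le> exp (s\<^sup>2) * 10 / q" .
    have "10 \<le> (1 + 4 * s) * (158 / 100) * q"
    proof -
      \<comment> \<open>In powers of \<open>s - 5 / 4\<close> all coefficients are nonnegative.\<close>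
      define v where "v = s - 5 / 4"
      have v: "0 \<le> v" "s = v + 5 / 4" using False by (auto simp: v_def)
      have "(1 + 4 * s) * q = 6375 / 1000 + (5 / 4) * v + 4 * v\<^sup>2 + 4 * v ^ 3"
        unfolding q_def v(2) by (simp add: power2_eq_square power3_eq_cube algebra_simps)
      moreover have "0 \<le> v\<^sup>2" "0 \<le> v ^ 3" using v by auto
      ultimately have "6375 / 1000 \<le> (1 + 4 * s) * q" using v by linarith
      from mult_right_mono[OF this, of "158 / 100"]
      have "6375 / 1000 * (158 / 100) \<le> (1 + 4 * s) * q * (158 / 100)" by simp
      moreover have "10 \<le> 6375 / 1000 * (158 / 100 :: real)" by simp
      ultimately have "10 \<le> (1 + 4 * s) * q * (158 / 100)" by (rule order.trans[rotated])
      then show ?thesis by (simp only: mult_ac)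
    qed
    also have "\<dots> \<le> (1 + 4 * s) * sqrt (2 * s) * q"
      using r s q by (intro mult_right_mono mult_left_mono) auto
    finally have F: "10 / (q * sqrt (2 * s)) \<le> 1 + 4 * s"
      using s q by (simp add: divide_le_eq mult_ac)
    have "?B * (2 * exp s - 1) \<le> exp (2 * s) / (2 * sqrt (2 * s)) * (2 * exp s)"
    proof (intro mult_mono B2)
      have "1 \<le> exp s" using s by simp
      then show "0 \<le> 2 * exp s - 1" by linarith
    qed (use s in auto)
    also have "\<dots> = exp (3 * s) / sqrt (2 * s)"
      by (simp flip: exp_add)
    also have "\<dots> \<le> exp (s\<^sup>2) * 10 / q / sqrt (2 * s)"
      using E s by (intro divide_right_mono) auto
    also have "\<dots> = exp (s\<^sup>2) * (10 / (q * sqrt (2 * s)))" by simp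
    also have "\<dots> \<le> exp (s\<^sup>2) * (1 + 4 * s)" using F by (intro mult_left_mono) auto
    finally show ?thesis by (simp add: mult.commute)
  qed
qed

text \<open>
  Cauchy's inequality is applied to each coefficient separately, with weight \<open>2\<close> on the top degree.
  The doubling is what the discrete orthogonality relation in \<open>sum_sin_sin_midpoints\<close> provides, and
  it gains the factor \<open>1 / 2\<close> in the dominant contribution. The lower degrees are smaller by
  \<open>(l / 4) ^ (n - j) / (n - j)!\<close>, so that they add up to an exponential series.
\<close>
lemma weighted_norm_le_expansion:
  fixes l :: real
  assumes l: "0 < l" and P: "P = (\<Sum>j\<le>n. smult (d j) (chebyshev 2 j))"
  shows "(\<Sum>i\<le>n. (coeff P i)\<^sup>2 * (fact i / l ^ i))
    \<le> (2 * (d n)\<^sup>2 + (\<Sum>j<n. (d j)\<^sup>2)) * ((4 / l) ^ n * fact n / 2 * (1 + l) * exp (l\<^sup>2 / 16))"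
proof -
  \<comment> \<open>The weights in Cauchy's inequality, matching the coefficients of \<open>(d j)\<^sup>2\<close> in the claim.\<close>
  define w where "w j = (if j = n then 2 else 1 :: real)" for j
  define W where "W = (\<Sum>j\<le>n. w j * (d j)\<^sup>2)"
  define B where "B = (\<Sum>m. ((l / 4)\<^sup>2) ^ m / (fact m :: real)\<^sup>2)"
  have w: "0 < w j" for j by (simp add: w_def)
  have W0: "0 \<le> W" unfolding W_def using w by (intro sum_nonneg mult_nonneg_nonneg) (auto intro: less_imp_le)
  have W: "W = 2 * (d n)\<^sup>2 + (\<Sum>j<n. (d j)\<^sup>2)"
    unfolding W_def by (simp add: w_def flip: lessThan_Suc_atMost)
  have B0: "0 \<le> B"
    unfolding B_def using bessel_series(1)[of "l / 2"] l by (intro suminf_nonneg) (auto simp: power_divide)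
  have "(coeff P i)\<^sup>2 \<le> W * (\<Sum>j\<le>n. (coeff (chebyshev 2 j) i)\<^sup>2 / w j)" for i
  proof -
    have "coeff P i = (\<Sum>j\<le>n. (sqrt (w j) * d j) * (coeff (chebyshev 2 j) i / sqrt (w j)))"
      unfolding P coeff_sum using w by (intro sum.cong) (auto simp: less_imp_neq[symmetric])
    then have "(coeff P i)\<^sup>2 \<le> (\<Sum>j\<le>n. (sqrt (w j) * d j)\<^sup>2) * (\<Sum>j\<le>n. (coeff (chebyshev 2 j) i / sqrt (w j))\<^sup>2)"
      by (simp only: Cauchy_Schwarz_ineq_sum)
    then show ?thesis
      using w by (simp add: W_def power_mult_distrib power_divide less_imp_le)
  qed
  then have "(\<Sum>i\<le>n. (coeff P i)\<^sup>2 * (fact i / l ^ i))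
      \<le> (\<Sum>i\<le>n. W * (\<Sum>j\<le>n. (coeff (chebyshev 2 j) i)\<^sup>2 / w j) * (fact i / l ^ i))"
    using l by (intro sum_mono mult_right_mono) auto
  also have "\<dots> = W * (\<Sum>i\<le>n. \<Sum>j\<le>n. (coeff (chebyshev 2 j) i)\<^sup>2 / w j * (fact i / l ^ i))"
    by (simp only: sum_distrib_left sum_distrib_right mult.assoc)
  also have "\<dots> = W * (\<Sum>j\<le>n. (\<Sum>i\<le>n. (coeff (chebyshev 2 j) i)\<^sup>2 * (fact i / l ^ i)) / w j)"
    by (subst sum.swap) (simp add: sum_divide_distrib mult_ac)
  also have "\<dots> \<le> W * (\<Sum>j\<le>n. (4 / l) ^ j * fact j * B / w j)"
    unfolding B_def using chebyshev_2_weighted_norm[OF l] w W0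
    by (intro mult_left_mono sum_mono divide_right_mono) (auto intro: less_imp_le)
  also have "(\<Sum>j\<le>n. (4 / l) ^ j * fact j * B / w j)
      \<le> (\<Sum>j\<le>n. (4 / l) ^ n * fact n * B * ((l / 4) ^ (n - j) / fact (n - j)) / w j)"
  proof (intro sum_mono divide_right_mono)
    fix j assume "j \<in> {..n}"
    then have j: "j \<le> n" by simp
    have "fact j * fact (n - j) * 1 \<le> fact j * fact (n - j) * (n choose j)"
      using j by (intro mult_le_mono2) (simp add: Suc_le_eq)
    then have "fact j * fact (n - j) \<le> (fact n :: nat)" using binomial_fact_lemma[OF j] by simp
    then have "(fact j :: real) * fact (n - j) \<le> fact n"
      by (metis of_nat_fact of_nat_le_iff of_nat_mult)
    then have "(fact j :: real) \<le> fact n / fact (n - j)" by (simp add: field_simps)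
    moreover have "(4 / l) ^ j = (4 / l) ^ n * (l / 4) ^ (n - j)"
    proof -
      have "(4 / l) ^ n = (4 / l) ^ j * (4 / l) ^ (n - j)" using j by (simp flip: power_add)
      then show ?thesis using l by (simp add: power_divide)
    qed
    ultimately have "(4 / l) ^ j * fact j * B \<le> (4 / l) ^ n * (l / 4) ^ (n - j) * (fact n / fact (n - j)) * B"
      using l B0 by (simp only:) (intro mult_right_mono mult_left_mono; simp)
    then show "(4 / l) ^ j * fact j * B \<le> (4 / l) ^ n * fact n * B * ((l / 4) ^ (n - j) / fact (n - j))"
      by (simp add: mult_ac)
  qed (use w in \<open>auto intro: less_imp_le\<close>)
  also have "\<dots> = (4 / l) ^ n * fact n * B * (\<Sum>j\<le>n. (l / 4) ^ (n - j) / fact (n - j) / w j)"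
    by (simp add: sum_distrib_left)
  also have "(\<Sum>j\<le>n. (l / 4) ^ (n - j) / fact (n - j) / w j) \<le> (2 * exp (l / 4) - 1) / 2"
  proof -
    have "(\<Sum>j\<le>n. (l / 4) ^ (n - j) / fact (n - j) / w j) = 1 / 2 + (\<Sum>j<n. (l / 4) ^ (n - j) / fact (n - j))"
      by (simp add: w_def flip: lessThan_Suc_atMost)
    also have "(\<Sum>j<n. (l / 4) ^ (n - j) / fact (n - j)) = (\<Sum>j<n. (\<lambda>i. (l / 4) ^ Suc i / fact (Suc i)) (n - Suc j))"
      by (intro sum.cong) (auto simp: Suc_diff_Suc simp del: fact_Suc power_Suc)
    also have "\<dots> = (\<Sum>i<n. (l / 4) ^ Suc i / fact (Suc i))"
      by (rule sum.nat_diff_reindex)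
    also have "\<dots> = (\<Sum>i<Suc n. (l / 4) ^ i / fact i) - 1"
      by (simp only: sum.lessThan_Suc_shift) simp
    also have "(\<Sum>i<Suc n. (l / 4) ^ i / fact i) \<le> exp (l / 4)"
    proof -
      have S: "(\<lambda>i. (l / 4) ^ i / fact i) sums exp (l / 4)"
        by (rule exp_sums_real)
      show ?thesis
        unfolding sums_unique[OF S]
        using l by (intro sum_le_suminf[OF sums_summable[OF S]]) (simp_all del: sum.lessThan_Suc)
    qed
    finally show ?thesis by simp
  qed
  finally have "(\<Sum>i\<le>n. (coeff P i)\<^sup>2 * (fact i / l ^ i))
      \<le> W * ((4 / l) ^ n * fact n * B * ((2 * exp (l / 4) - 1) / 2))"
    using W0 B0 l by (simp add: mult_left_mono)
  also have "\<dots> = W * ((4 / l) ^ n * fact n / 2 * (B * (2 * exp (l / 4) - 1)))" by simp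
  also have "\<dots> \<le> W * ((4 / l) ^ n * fact n / 2 * ((1 + l) * exp (l\<^sup>2 / 16)))"
    using bessel_exp_ineq[of "l / 4"] l W0 unfolding B_def
    by (intro mult_left_mono) (auto simp: power_divide)
  finally show ?thesis unfolding W by (simp only: mult.assoc)
qed

section \<open>Chebyshev coefficients and the size of a polynomial\<close>

text \<open>
  After multiplication by \<open>2 * sin (m * pi / (2 * Suc n))\<close> the sum telescopes to \<open>sin (m * pi)\<close>.
\<close>
lemma sum_cos_midpoints:
  assumes m: "0 < m" "m < 2 * Suc n"
  shows "(\<Sum>k\<le>n. cos (real m * ((real k + 1 / 2) * pi / Suc n))) = 0"
proof -
  define h where "h = real m * pi / (2 * real (Suc n))"
  have h: "0 < h" "h < pi"
  proof -
    show "0 < h" using m pi_gt_zero by (simp add: h_def del: of_nat_Suc)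
    have "real m < 2 * real (Suc n)" using m by linarith
    then have "real m * pi < 2 * real (Suc n) * pi" using pi_gt_zero by (intro mult_strict_right_mono)
    then show "h < pi" by (simp add: h_def divide_less_eq mult.commute del: of_nat_Suc)
  qed
  have "sin (2 * h * real (Suc k)) - sin (2 * h * real k) = 2 * sin h * cos (real m * ((real k + 1 / 2) * pi / Suc n))" for k
  proof -
    define a where "a = real m * ((real k + 1 / 2) * pi / Suc n)"
    have "a = 2 * h * real k + h"
      by (simp add: a_def h_def field_simps del: of_nat_Suc)
    then have "2 * h * real (Suc k) = a + h" "2 * h * real k = a - h"
      by (simp_all add: algebra_simps)
    then show ?thesis
      unfolding a_def[symmetric] by (simp only: sin_add sin_diff) simp
  qed
  then have "2 * sin h * (\<Sum>k<Suc n. cos (real m * ((real k + 1 / 2) * pi / Suc n)))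
      = (\<Sum>k<Suc n. sin (2 * h * real (Suc k)) - sin (2 * h * real k))"
    unfolding sum_distrib_left by (intro sum.cong) auto
  also have "\<dots> = sin (2 * h * real (Suc n)) - sin (2 * h * real 0)" by (rule sum_lessThan_telescope)
  also have "2 * h * real (Suc n) = real m * pi" by (simp add: h_def field_simps)
  finally have "2 * sin h * (\<Sum>k<Suc n. cos (real m * ((real k + 1 / 2) * pi / Suc n))) = 0"
    by simp
  then show ?thesis
    using sin_gt_zero[OF h] unfolding lessThan_Suc_atMost by simp
qed

text \<open>
  At these points \<open>sin (Suc n * \<theta>)\<close> is \<open>1\<close> or \<open>-1\<close>, so that the square sum of the top frequency is
  twice that of the others.
\<close>
lemma sum_sin_sin_midpoints:
  assumes "i \<le> n" "j \<le> n"
  shows "(\<Sum>k\<le>n. sin (real (Suc i) * ((real k + 1 / 2) * pi / Suc n)) * sin (real (Suc j) * ((real k + 1 / 2) * pi / Suc n)))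
    = (if i = j then (if j = n then real (Suc n) else real (Suc n) / 2) else 0)"
proof -
  define \<theta> where "\<theta> k = (real k + 1 / 2) * pi / Suc n" for k
  have c0: "(\<Sum>k\<le>n. cos (real m * \<theta> k)) = 0" if "0 < m" "m < 2 * Suc n" for m
    using sum_cos_midpoints[OF that] unfolding \<theta>_def .
  have minus: "(\<Sum>k\<le>n. cos (real (Suc i) * \<theta> k - real (Suc j) * \<theta> k)) = (if i = j then real (Suc n) else 0)"
  proof (cases i j rule: linorder_cases)
    case less
    have "cos (real (Suc i) * \<theta> k - real (Suc j) * \<theta> k) = cos (real (j - i) * \<theta> k)" for k
      using less by (subst cos_minus[symmetric]) (simp add: of_nat_diff algebra_simps)
    then show ?thesis using c0[of "j - i"] less assms by simp
  next
    case greater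
    have "cos (real (Suc i) * \<theta> k - real (Suc j) * \<theta> k) = cos (real (i - j) * \<theta> k)" for k
      using greater by (simp add: of_nat_diff algebra_simps)
    then show ?thesis using c0[of "i - j"] greater assms by simp
  qed simp
  have plus: "(\<Sum>k\<le>n. cos (real (Suc i) * \<theta> k + real (Suc j) * \<theta> k)) = (if i = n \<and> j = n then - real (Suc n) else 0)"
  proof (cases "i = n \<and> j = n")
    case True
    have "cos (real (Suc i) * \<theta> k + real (Suc j) * \<theta> k) = -1" for k
    proof -
      have "real (Suc n) * \<theta> k = (real k + 1 / 2) * pi"
        by (simp add: \<theta>_def del: of_nat_Suc)
      then have "real (Suc i) * \<theta> k + real (Suc j) * \<theta> k = (2 * real k + 1) * pi"
        using True by (simp add: algebra_simps)
      also have "\<dots> = real (Suc (2 * k)) * pi" by simp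
      finally show ?thesis by (simp only: cos_npi) simp
    qed
    then show ?thesis using True by simp
  next
    case False
    then have "Suc i + Suc j < 2 * Suc n" using assms by (cases "i = n") auto
    from c0[OF _ this] show ?thesis using False by (simp add: algebra_simps)
  qed
  show ?thesis
    unfolding \<theta>_def[symmetric] sin_times_sin sum_divide_distrib[symmetric] sum_subtractf minus plus
    using assms by auto
qed

text \<open>
  With \<open>t = cos \<theta>\<close>, the polynomial times \<open>sin \<theta>\<close> is a sine polynomial with coefficients \<open>d\<close>. Both
  sides are obtained by summing its square over the midpoints: the left one from orthogonality, the
  right one because the squares of \<open>sin \<theta>\<close> add up to \<open>Suc n / 2\<close>, for which \<open>n\<close> has to be positive.
  All evaluation points lie in the open interval, where a bound that holds almost everywhere can be
  used.
\<close>
lemma expansion_le_sup: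
  assumes n: "1 \<le> n" and P: "P = (\<Sum>j\<le>n. smult (d j) (chebyshev 2 j))"
    and M: "\<And>t. t \<in> {-1<..<1} \<Longrightarrow> \<bar>poly P t\<bar> \<le> M"
  shows "2 * (d n)\<^sup>2 + (\<Sum>j<n. (d j)\<^sup>2) \<le> M\<^sup>2"
proof -
  define \<theta> where "\<theta> k = (real k + 1 / 2) * pi / Suc n" for k
  define s where "s i k = sin (real (Suc i) * \<theta> k)" for i k
  have orth: "(\<Sum>k\<le>n. s i k * s j k) = (if i = j then (if j = n then real (Suc n) else real (Suc n) / 2) else 0)"
    if "i \<le> n" "j \<le> n" for i j
    using sum_sin_sin_midpoints[OF that] unfolding s_def \<theta>_def .
  have Ps: "poly P (cos (\<theta> k)) * sin (\<theta> k) = (\<Sum>j\<le>n. d j * s j k)" for k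
    unfolding P poly_sum sum_distrib_right s_def
    by (intro sum.cong refl) (simp only: poly_smult mult.assoc poly_chebyshev_2)
  have "real (Suc n) / 2 * (2 * (d n)\<^sup>2 + (\<Sum>j<n. (d j)\<^sup>2))
      = (\<Sum>j\<le>n. (d j)\<^sup>2 * (if j = n then real (Suc n) else real (Suc n) / 2))"
  proof -
    have "(\<Sum>j\<le>n. (d j)\<^sup>2 * (if j = n then real (Suc n) else real (Suc n) / 2))
        = (\<Sum>j<n. (d j)\<^sup>2 * (real (Suc n) / 2)) + (d n)\<^sup>2 * real (Suc n)"
      by (simp flip: lessThan_Suc_atMost)
    then show ?thesis unfolding sum_distrib_right[symmetric] by (simp add: algebra_simps)
  qed
  also have "\<dots> = (\<Sum>i\<le>n. \<Sum>j\<le>n. d i * d j * (\<Sum>k\<le>n. s i k * s j k))"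
  proof (intro sum.cong refl)
    fix i assume i: "i \<in> {..n}"
    have "(\<Sum>j\<le>n. d i * d j * (\<Sum>k\<le>n. s i k * s j k))
        = (\<Sum>j\<le>n. if j = i then (d i)\<^sup>2 * (if i = n then real (Suc n) else real (Suc n) / 2) else 0)"
      using i by (intro sum.cong refl) (auto simp: orth power2_eq_square)
    then show "(d i)\<^sup>2 * (if i = n then real (Suc n) else real (Suc n) / 2)
        = (\<Sum>j\<le>n. d i * d j * (\<Sum>k\<le>n. s i k * s j k))"
      using i by simp
  qed
  also have "\<dots> = (\<Sum>i\<le>n. \<Sum>k\<le>n. \<Sum>j\<le>n. d i * d j * (s i k * s j k))"
    unfolding sum_distrib_left by (intro sum.cong refl sum.swap)
  also have "\<dots> = (\<Sum>k\<le>n. \<Sum>i\<le>n. \<Sum>j\<le>n. d i * d j * (s i k * s j k))"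
    by (rule sum.swap)
  also have "\<dots> = (\<Sum>k\<le>n. (poly P (cos (\<theta> k)) * sin (\<theta> k))\<^sup>2)"
    unfolding Ps power2_eq_square sum_product by (simp only: mult_ac)
  also have "\<dots> \<le> (\<Sum>k\<le>n. M\<^sup>2 * (sin (\<theta> k))\<^sup>2)"
  proof (rule sum_mono)
    fix k assume "k \<in> {..n}"
    then have "(real k + 1 / 2) * pi < real (Suc n) * pi"
      using pi_gt_zero by (intro mult_strict_right_mono) auto
    then have t: "0 < \<theta> k" "\<theta> k < pi"
      using pi_gt_zero by (auto simp: \<theta>_def divide_less_eq mult.commute simp del: of_nat_Suc)
    have "\<bar>poly P (cos (\<theta> k))\<bar> \<le> M"
      using cos_monotone_0_pi[of 0 "\<theta> k"] cos_monotone_0_pi[of "\<theta> k" pi] t by (intro M) auto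
    then have "(poly P (cos (\<theta> k)))\<^sup>2 \<le> M\<^sup>2"
      by (metis abs_ge_zero power2_abs power_mono)
    then show "(poly P (cos (\<theta> k)) * sin (\<theta> k))\<^sup>2 \<le> M\<^sup>2 * (sin (\<theta> k))\<^sup>2"
      unfolding power_mult_distrib by (intro mult_right_mono) auto
  qed
  also have "\<dots> = M\<^sup>2 * (real (Suc n) / 2)"
    using orth[of 0 0] n by (simp add: s_def power2_eq_square flip: sum_distrib_left)
  finally have "real (Suc n) / 2 * (2 * (d n)\<^sup>2 + (\<Sum>j<n. (d j)\<^sup>2)) \<le> real (Suc n) / 2 * M\<^sup>2"
    by (simp only: mult.commute)
  then show ?thesis by (rule mult_left_le_imp_le) simp
qed

lemma has_integral_cos_nat:
  assumes "0 < m"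
  shows "((\<lambda>x. cos (real m * x)) has_integral 0) {0..pi}"
proof -
  have "((\<lambda>x. cos (real m * x)) has_integral (sin (real m * pi) / m - sin (real m * 0) / m)) {0..pi}"
    using assms by (intro fundamental_theorem_of_calculus)
      (auto intro!: derivative_eq_intros simp flip: has_real_derivative_iff_has_vector_derivative)
  then show ?thesis by simp
qed

lemma has_integral_sin_sin:
  "((\<lambda>x. sin (real (Suc i) * x) * sin (real (Suc j) * x)) has_integral (if i = j then pi / 2 else 0)) {0..pi}"
proof -
  have "((\<lambda>x. cos (real (Suc i) * x - real (Suc j) * x)) has_integral (if i = j then pi else 0)) {0..pi}"
  proof (cases i j rule: linorder_cases)
    case less
    have "cos (real (Suc i) * x - real (Suc j) * x) = cos (real (j - i) * x)" for x
      using less by (subst cos_minus[symmetric]) (simp add: of_nat_diff algebra_simps)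
    then show ?thesis using has_integral_cos_nat[of "j - i"] less by simp
  next
    case greater
    have "cos (real (Suc i) * x - real (Suc j) * x) = cos (real (i - j) * x)" for x
      using greater by (simp add: of_nat_diff algebra_simps)
    then show ?thesis using has_integral_cos_nat[of "i - j"] greater by simp
  next
    case equal
    then show ?thesis using has_integral_const_real[of "1 :: real" 0 pi] by simp
  qed
  moreover have "((\<lambda>x. cos (real (Suc i) * x + real (Suc j) * x)) has_integral 0) {0..pi}"
    using has_integral_cos_nat[of "Suc i + Suc j"] by (simp add: algebra_simps)
  ultimately have "((\<lambda>x. (cos (real (Suc i) * x - real (Suc j) * x) - cos (real (Suc i) * x + real (Suc j) * x)) / 2)
      has_integral ((if i = j then pi else 0) - 0) / 2) {0..pi}"
    by (intro has_integral_divide has_integral_diff)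
  then show ?thesis unfolding sin_times_sin by (rule has_integral_eq_rhs) simp
qed

text \<open>
  The substitution \<open>t = cos x\<close> turns the integral into one with weight \<open>sin x\<close>, which dominates
  \<open>(sin x)\<^sup>2\<close>, the weight for which the expansion is orthogonal.
\<close>
lemma expansion_le_integral:
  assumes P: "P = (\<Sum>j\<le>n. smult (d j) (chebyshev 2 j))"
  shows "pi / 2 * (\<Sum>j\<le>n. (d j)\<^sup>2) \<le> integral {-1..1} (\<lambda>t. (poly P t)\<^sup>2)"
proof -
  let ?s = "\<lambda>i x. sin (real (Suc i) * x)"
  have Ps: "poly P (cos x) * sin x = (\<Sum>j\<le>n. d j * ?s j x)" for x
    unfolding P poly_sum sum_distrib_right
    by (intro sum.cong refl) (simp only: poly_smult mult.assoc poly_chebyshev_2)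
  have "((\<lambda>x. \<Sum>i\<le>n. \<Sum>j\<le>n. d i * d j * (?s i x * ?s j x)) has_integral
      (\<Sum>i\<le>n. \<Sum>j\<le>n. d i * d j * (if i = j then pi / 2 else 0))) {0..pi}"
    by (intro has_integral_sum has_integral_mult_right has_integral_sin_sin) auto
  also have "(\<lambda>x. \<Sum>i\<le>n. \<Sum>j\<le>n. d i * d j * (?s i x * ?s j x)) = (\<lambda>x. (poly P (cos x) * sin x)\<^sup>2)"
    unfolding Ps power2_eq_square sum_product by (simp only: mult_ac)
  also have "(\<Sum>i\<le>n. \<Sum>j\<le>n. d i * d j * (if i = j then pi / 2 else 0)) = pi / 2 * (\<Sum>j\<le>n. (d j)\<^sup>2)"
    by (simp add: if_distrib sum.delta sum_distrib_left power2_eq_square mult_ac cong: if_cong)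
  finally have L: "((\<lambda>x. (poly P (cos x) * sin x)\<^sup>2) has_integral pi / 2 * (\<Sum>j\<le>n. (d j)\<^sup>2)) {0..pi}" .
  have "((\<lambda>x. (- sin x) *\<^sub>R (poly P (cos x))\<^sup>2) has_integral
      (integral {cos 0..cos pi} (\<lambda>t. (poly P t)\<^sup>2) - integral {cos pi..cos 0} (\<lambda>t. (poly P t)\<^sup>2))) {0..pi}"
    by (rule has_integral_substitution_general[of "{}" 0 pi cos "-1" 1])
      (auto intro!: continuous_intros derivative_eq_intros)
  from has_integral_neg[OF this]
  have R: "((\<lambda>x. sin x * (poly P (cos x))\<^sup>2) has_integral integral {-1..1} (\<lambda>t. (poly P t)\<^sup>2)) {0..pi}"
    by simp
  show ?thesis
  proof (rule has_integral_le[OF L R])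
    fix x :: real assume "x \<in> {0..pi}"
    then have "0 \<le> sin x" by (auto intro: sin_ge_zero)
    then have "sin x * sin x \<le> sin x * 1" by (intro mult_left_mono) auto
    then have "(poly P (cos x))\<^sup>2 * (sin x * sin x) \<le> (poly P (cos x))\<^sup>2 * sin x"
      by (intro mult_left_mono) auto
    then show "(poly P (cos x) * sin x)\<^sup>2 \<le> sin x * (poly P (cos x))\<^sup>2"
      by (simp add: power2_eq_square mult_ac)
  qed
qed

section \<open>Node polynomials\<close>

definition node_poly :: "(nat \<Rightarrow> real) \<Rightarrow> nat \<Rightarrow> real poly" where
  "node_poly x n = (\<Prod>k=1..n. [:- x k, 1:])"

lemma poly_node_poly: "poly (node_poly x n) t = (\<Prod>k=1..n. t - x k)"
  by (simp add: node_poly_def poly_prod)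

lemma degree_node_poly: "degree (node_poly x n) = n"
  unfolding node_poly_def by (subst degree_prod_sum_eq) auto

lemma lead_coeff_node_poly: "coeff (node_poly x n) n = 1"
  using lead_coeff_prod[of "\<lambda>k. [:- x k, 1:]" "{1..n}"] degree_node_poly[of x n]
  by (simp add: node_poly_def)

lemma abs_node_poly_le:
  assumes "x ` {1..n} \<subseteq> {-1..1}" "t \<in> {-1..1}"
  shows "\<bar>poly (node_poly x n) t\<bar> \<le> 2 ^ n"
proof -
  have "\<bar>poly (node_poly x n) t\<bar> \<le> (\<Prod>k=1..n. 2)"
    unfolding poly_node_poly abs_prod using assms
    by (intro prod_mono) (force simp: image_subset_iff abs_le_iff)
  then show ?thesis by simp
qed

text \<open>
  Each factor is at most \<open>1 + \<bar>t\<bar>\<close>, which equals \<open>1 + t\<close> or \<open>1 - t\<close>.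
\<close>
lemma integral_node_poly_le:
  assumes n: "1 \<le> n" and x: "x ` {1..n} \<subseteq> {-1..1}"
  shows "integral {-1..1} (\<lambda>t. (poly (node_poly x n) t)\<^sup>2) \<le> 2 * 4 ^ n / n"
proof -
  have I: "((\<lambda>t. (1 + c * t) ^ (2 * n)) has_integral 2 * 4 ^ n / (2 * n + 1)) {-1..1}" if "c = 1 \<or> c = -1" for c :: real
  proof -
    have d: "((\<lambda>t. c * (1 + c * t) ^ Suc (2 * n) / real (Suc (2 * n))) has_real_derivative (1 + c * t) ^ (2 * n))
        (at t within {-1..1})" for t
    proof -
      have "((\<lambda>t. c * (1 + c * t) ^ Suc (2 * n) / real (Suc (2 * n))) has_real_derivative
          c * (real (Suc (2 * n)) * (c * (1 + c * t) ^ (2 * n))) / real (Suc (2 * n))) (at t within {-1..1})"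
        by (auto intro!: derivative_eq_intros simp del: of_nat_Suc power_Suc)
      moreover have "c * (real (Suc (2 * n)) * (c * (1 + c * t) ^ (2 * n))) / real (Suc (2 * n)) = (1 + c * t) ^ (2 * n)"
        using that by (auto simp del: of_nat_Suc)
      ultimately show ?thesis by (simp only:)
    qed
    have "((\<lambda>t. (1 + c * t) ^ (2 * n)) has_integral
        c * (1 + c * 1) ^ Suc (2 * n) / real (Suc (2 * n)) - c * (1 + c * (-1)) ^ Suc (2 * n) / real (Suc (2 * n))) {-1..1}"
      using d by (intro fundamental_theorem_of_calculus) (auto simp flip: has_real_derivative_iff_has_vector_derivative)
    moreover have "c * (1 + c * 1) ^ Suc (2 * n) / real (Suc (2 * n)) - c * (1 + c * (-1)) ^ Suc (2 * n) / real (Suc (2 * n))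
        = 2 * 4 ^ n / (2 * n + 1)"
      using that by (auto simp: power_mult)
    ultimately show ?thesis by simp
  qed
  have "((\<lambda>t. (poly (node_poly x n) t)\<^sup>2) has_integral integral {-1..1} (\<lambda>t. (poly (node_poly x n) t)\<^sup>2)) {-1..1}"
    by (intro integrable_integral integrable_continuous_interval continuous_intros)
  moreover have "((\<lambda>t. (1 + 1 * t) ^ (2 * n) + (1 + (-1) * t) ^ (2 * n)) has_integral
      2 * 4 ^ n / (2 * n + 1) + 2 * 4 ^ n / (2 * n + 1)) {-1..1}"
    by (intro has_integral_add I) auto
  ultimately have "integral {-1..1} (\<lambda>t. (poly (node_poly x n) t)\<^sup>2) \<le> 2 * 4 ^ n / (2 * n + 1) + 2 * 4 ^ n / (2 * n + 1)"
  proof (rule has_integral_le)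
    fix t :: real assume t: "t \<in> {-1..1}"
    have "\<bar>poly (node_poly x n) t\<bar> \<le> (\<Prod>k=1..n. 1 + \<bar>t\<bar>)"
      unfolding poly_node_poly abs_prod using x t
      by (intro prod_mono) (force simp: image_subset_iff abs_le_iff)
    then have "\<bar>poly (node_poly x n) t\<bar>\<^sup>2 \<le> ((1 + \<bar>t\<bar>) ^ n)\<^sup>2"
      by (intro power_mono) auto
    also have "\<dots> = (1 + \<bar>t\<bar>) ^ (2 * n)" by (simp add: power_mult[symmetric] mult.commute)
    also have "\<dots> \<le> (1 + 1 * t) ^ (2 * n) + (1 + (-1) * t) ^ (2 * n)"
      using t by (cases "0 \<le> t") auto
    finally show "(poly (node_poly x n) t)\<^sup>2 \<le> (1 + 1 * t) ^ (2 * n) + (1 + (-1) * t) ^ (2 * n)"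
      by simp
  qed
  also have "\<dots> \<le> 2 * 4 ^ n / (2 * n) + 2 * 4 ^ n / (2 * n)"
    using n by (intro add_mono divide_left_mono) auto
  also have "\<dots> = 2 * 4 ^ n / n" by simp
  finally show ?thesis .
qed

text \<open>
  The nodes are the zeros of the Chebyshev polynomial \<open>T\<^sub>n\<close>, whose leading coefficient is \<open>2 ^ (n - 1)\<close>
  and which is bounded by \<open>1\<close>. Both polynomials have degree \<open>n\<close> and agree at \<open>n\<close> points and in the
  top coefficient, so they agree.
\<close>
lemma chebyshev_nodes:
  assumes n: "1 \<le> n"
  obtains x where "x ` {1..n} \<subseteq> {-1..1}" "inj_on x {1..n}"
    and "\<And>t. t \<in> {-1..1} \<Longrightarrow> \<bar>poly (node_poly x n) t\<bar> \<le> 2 * (1 / 2) ^ n"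
proof -
  define \<theta> where "\<theta> k = (2 * real k - 1) * pi / (2 * n)" for k
  define x where "x k = cos (\<theta> k)" for k
  have \<theta>: "0 \<le> \<theta> k" "\<theta> k \<le> pi" if "k \<in> {1..n}" for k
  proof -
    have "(2 * real k - 1) * pi \<le> (2 * n) * pi" using that by (intro mult_right_mono) auto
    then show "\<theta> k \<le> pi" using n by (simp add: \<theta>_def divide_le_eq mult.commute)
    show "0 \<le> \<theta> k" using that by (auto simp: \<theta>_def)
  qed
  have inj: "inj_on x {1..n}"
  proof (rule inj_onI)
    fix i j assume "i \<in> {1..n}" "j \<in> {1..n}" "x i = x j"
    then have "\<theta> i = \<theta> j" using cos_inj_pi[of "\<theta> i" "\<theta> j"] \<theta> unfolding x_def by blast
    then show "i = j" using n by (simp add: \<theta>_def)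
  qed
  obtain m where m: "n = Suc m" using n by (cases n) auto
  have eq: "chebyshev 1 n = smult (2 ^ m) (node_poly x n)"
  proof (rule poly_eqI_degree_lead_coeff)
    show "coeff (chebyshev 1 n) n = coeff (smult (2 ^ m) (node_poly x n)) n"
      by (simp only: coeff_smult lead_coeff_node_poly) (simp add: m lead_coeff_chebyshev)
    show "n \<le> card (x ` {1..n})" using inj by (simp add: card_image)
    show "degree (chebyshev 1 n) \<le> n" by (rule degree_chebyshev_le)
    show "degree (smult (2 ^ m) (node_poly x n)) \<le> n" by (simp add: degree_node_poly)
    fix z assume "z \<in> x ` {1..n}"
    then obtain k where k: "k \<in> {1..n}" "z = x k" by blast
    have "n * \<theta> k = real k * pi - pi / 2" using n by (simp add: \<theta>_def field_simps)
    then have "poly (chebyshev 1 n) z = 0"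
      unfolding k(2) x_def poly_chebyshev_1 by (simp add: cos_diff sin_npi)
    moreover have "poly (node_poly x n) z = 0"
      unfolding poly_node_poly k(2) using k(1) by (intro prod_zero) auto
    ultimately show "poly (chebyshev 1 n) z = poly (smult (2 ^ m) (node_poly x n)) z" by simp
  qed
  show thesis
  proof (rule that[OF _ inj])
    show "x ` {1..n} \<subseteq> {-1..1}" by (auto simp: x_def)
    fix t :: real assume t: "t \<in> {-1..1}"
    then have "poly (chebyshev 1 n) t = cos (n * arccos t)"
      using poly_chebyshev_1[of n "arccos t"] by simp
    then have "\<bar>poly (chebyshev 1 n) t\<bar> \<le> 1" by simp
    then have "2 ^ m * \<bar>poly (node_poly x n) t\<bar> \<le> 1" unfolding eq by (simp add: abs_mult)
    then show "\<bar>poly (node_poly x n) t\<bar> \<le> 2 * (1 / 2) ^ n" unfolding m by (simp add: field_simps)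
  qed
qed

section \<open>The two Lebesgue norms\<close>

lemma continuous_on_imp_measurable_leb: "continuous_on {-1..1} f \<Longrightarrow> f \<in> borel_measurable leb"
  for f :: "real \<Rightarrow> real"
  by (intro continuous_imp_measurable_on_sets_lebesgue) auto

lemma nn_integral_leb:
  assumes "\<And>t. t \<in> {-1..1} \<Longrightarrow> 0 \<le> g t" "(g has_integral J) {-1..1}"
  shows "(\<integral>\<^sup>+ t. ennreal (g t) \<partial>leb) = ennreal J"
  using nn_integral_has_integral_lebesgue'[OF assms]
  by (subst nn_integral_restrict_space) (auto simp: nn_integral_completion)

lemma Lp_norm_2_eq:
  assumes "((\<lambda>t. (f t)\<^sup>2) has_integral J) {-1..1}"
  shows "Lp_norm leb 2 f = ennreal (sqrt J)"
proof -
  have J: "0 \<le> J" using has_integral_nonneg[OF assms] by simp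
  have "(\<integral>\<^sup>+ t. ennreal (\<bar>f t\<bar> powr enn2real 2) \<partial>leb) = ennreal J"
    using nn_integral_leb[OF _ assms] by (simp add: powr_numeral)
  then show ?thesis using J by (simp add: Lp_norm_def powr_half_sqrt)
qed

lemma Lp_norm_2_le:
  assumes "\<And>t. t \<in> {-1..1} \<Longrightarrow> (f t)\<^sup>2 \<le> g t" "(g has_integral J) {-1..1}"
  shows "Lp_norm leb 2 f \<le> ennreal (sqrt J)"
proof -
  have g: "0 \<le> g t" if "t \<in> {-1..1}" for t using assms(1)[OF that] order.trans zero_le_power2 by blast
  have J: "0 \<le> J" using has_integral_nonneg[OF assms(2)] g by blast
  have "(\<integral>\<^sup>+ t. ennreal (\<bar>f t\<bar> powr enn2real 2) \<partial>leb) \<le> (\<integral>\<^sup>+ t. ennreal (g t) \<partial>leb)"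
    using assms(1) by (intro nn_integral_mono) (auto simp: powr_numeral intro!: ennreal_leI)
  also have "\<dots> = ennreal J" by (rule nn_integral_leb[OF g assms(2)])
  finally obtain I where I: "(\<integral>\<^sup>+ t. ennreal (\<bar>f t\<bar> powr enn2real 2) \<partial>leb) = ennreal I" "0 \<le> I" "I \<le> J"
    using J by (cases "\<integral>\<^sup>+ t. ennreal (\<bar>f t\<bar> powr enn2real 2) \<partial>leb") (auto simp: top_unique)
  then show ?thesis by (simp add: Lp_norm_def powr_half_sqrt)
qed

lemma Lp_norm_infinity_le:
  assumes "continuous_on {-1..1} f" "\<And>t. t \<in> {-1..1} \<Longrightarrow> \<bar>f t\<bar> \<le> C"
  shows "Lp_norm leb \<infinity> f \<le> ennreal C"
  unfolding Lp_norm_def using assms continuous_on_imp_measurable_leb[OF assms(1)]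
  by (auto intro!: esssup_I AE_I2 simp: ennreal_leI)

text \<open>
  A continuous function obeys its essential bound everywhere, because a closed set that contains almost
  every point of an open set contains the open set.
\<close>
lemma abs_le_Lp_norm_infinity:
  assumes f: "continuous_on {-1..1} f" and r: "Lp_norm leb \<infinity> f \<le> ennreal r" "0 \<le> r"
    and t: "t \<in> {-1<..<1}"
  shows "\<bar>f t\<bar> \<le> r"
proof -
  have "AE s in leb. ennreal \<bar>f s\<bar> \<le> esssup leb (\<lambda>t. ennreal \<bar>f t\<bar>)" by (rule esssup_AE)
  then have "AE s in leb. \<bar>f s\<bar> \<le> r"
  proof eventually_elim
    case (elim s)
    then have "ennreal \<bar>f s\<bar> \<le> ennreal r" using r(1) by (auto simp: Lp_norm_def)
    then show ?case using r(2) by simp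
  qed
  then have "AE s \<in> {-1..1} in lebesgue. \<bar>f s\<bar> \<le> r"
    by (subst (asm) AE_restrict_space_iff) auto
  then have ae: "AE s \<in> {-1<..<1} in lebesgue. s \<in> {s \<in> {-1..1}. \<bar>f s\<bar> \<le> r}"
    by eventually_elim auto
  have "closed {s \<in> {-1..1}. \<bar>f s\<bar> \<le> r}"
    using continuous_closed_preimage[OF continuous_on_rabs[OF f] closed_atLeastAtMost closed_atMost[of r]]
    by (simp add: vimage_def Int_def)
  from mem_closed_if_AE_lebesgue_open[OF open_greaterThanLessThan this ae t]
  have "t \<in> {s \<in> {-1..1}. \<bar>f s\<bar> \<le> r}" .
  then show ?thesis by simp
qed

lemma Lp_space_continuous:
  assumes p: "p \<in> {2, \<infinity>}" and f: "continuous_on {-1..1} f"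
  shows "f \<in> Lp_space leb p"
proof -
  have "bounded (f ` {-1..1})" using f by (intro compact_imp_bounded compact_continuous_image) auto
  then obtain C where "\<forall>t\<in>{-1..1}. \<bar>f t\<bar> \<le> C"
    unfolding bounded_iff by auto
  then have C: "\<bar>f t\<bar> \<le> C" if "t \<in> {-1..1}" for t using that by blast
  have "((\<lambda>t. (f t)\<^sup>2) has_integral integral {-1..1} (\<lambda>t. (f t)\<^sup>2)) {-1..1}"
    by (intro integrable_integral integrable_continuous_interval continuous_intros f)
  then have "Lp_norm leb p f < \<infinity>"
    using p Lp_norm_2_eq Lp_norm_infinity_le[OF f C] by (auto simp: top.not_eq_extremum[symmetric] top_unique)
  then show ?thesis using continuous_on_imp_measurable_leb[OF f] by (simp add: Lp_space_def)
qed

lemma ennreal_le_divide: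
  assumes "0 < s" "ennreal (c * s) \<le> X"
  shows "ennreal c \<le> X / ennreal s"
proof (cases X)
  case (real r)
  then have "c * s \<le> r" using assms by (auto simp: ennreal_le_iff2)
  then have "c \<le> r / s" using assms by (simp add: pos_le_divide_eq)
  then show ?thesis using real assms by (simp add: divide_ennreal ennreal_leI)
next
  case top
  then show ?thesis by (simp add: ennreal_top_divide)
qed

lemma ennreal_divide_le:
  assumes "0 < s" "X \<le> ennreal (c * s)" "0 \<le> c"
  shows "X / ennreal s \<le> ennreal c"
proof (cases X)
  case (real r)
  then have "r \<le> c * s" using assms by simp
  then have "r / s \<le> c" using assms by (simp add: pos_divide_le_eq)
  then show ?thesis using real assms by (simp add: divide_ennreal ennreal_leI)
next
  case top
  then show ?thesis using assms by (simp add: top_unique)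
qed

section \<open>Lower bounds\<close>

context gaussian_rkhs
begin

text \<open>
  The constant that compares the squared Gaussian norm of a polynomial of degree \<open>n\<close> with its squared
  supremum norm.
\<close>
definition norm_factor :: "nat \<Rightarrow> real" where
  "norm_factor n = (4 / \<epsilon>\<^sup>2) ^ n * fact n / 2 * (1 + \<epsilon>\<^sup>2) * exp (\<epsilon> ^ 4 / 16)"

lemma norm_factor_pos: "0 < norm_factor n"
  using eps by (auto simp: norm_factor_def intro!: mult_pos_pos divide_pos_pos add_pos_nonneg)

lemma ip_feature_le_expansion:
  assumes "degree P \<le> n" "P = (\<Sum>j\<le>n. smult (d j) (chebyshev 2 j))"
  shows "ip (feature P) (feature P) \<le> (2 * (d n)\<^sup>2 + (\<Sum>j<n. (d j)\<^sup>2)) * norm_factor n"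
proof -
  have "ip (feature P) (feature P) \<le> (\<Sum>i\<le>n. (coeff P i)\<^sup>2 * (fact i / (\<epsilon>\<^sup>2) ^ i))"
    unfolding ip_feature using assms(1) by (intro sum_mono2) auto
  also have "\<dots> \<le> (2 * (d n)\<^sup>2 + (\<Sum>j<n. (d j)\<^sup>2)) * ((4 / \<epsilon>\<^sup>2) ^ n * fact n / 2 * (1 + \<epsilon>\<^sup>2) * exp ((\<epsilon>\<^sup>2)\<^sup>2 / 16))"
    using eps by (intro weighted_norm_le_expansion assms(2)) auto
  also have "(\<epsilon>\<^sup>2)\<^sup>2 = \<epsilon> ^ 4" by simp
  finally show ?thesis unfolding norm_factor_def .
qed

lemma ip_feature_le_sup:
  assumes "1 \<le> n" "degree P \<le> n" "\<And>t. t \<in> {-1<..<1} \<Longrightarrow> \<bar>poly P t\<bar> \<le> M"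
  shows "ip (feature P) (feature P) \<le> M\<^sup>2 * norm_factor n"
proof -
  obtain d where d: "P = (\<Sum>j\<le>n. smult (d j) (chebyshev 2 j))"
    using chebyshev_2_expansion[OF assms(2)] by blast
  have "2 * (d n)\<^sup>2 + (\<Sum>j<n. (d j)\<^sup>2) \<le> M\<^sup>2"
    by (rule expansion_le_sup[OF assms(1) d assms(3)])
  from mult_right_mono[OF this, of "norm_factor n"] ip_feature_le_expansion[OF assms(2) d]
  show ?thesis using norm_factor_pos[of n] by linarith
qed

lemma ip_feature_le_integral:
  assumes "degree P \<le> n"
  shows "ip (feature P) (feature P) \<le> 4 / pi * integral {-1..1} (\<lambda>t. (poly P t)\<^sup>2) * norm_factor n"
proof -
  obtain d where d: "P = (\<Sum>j\<le>n. smult (d j) (chebyshev 2 j))"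
    using chebyshev_2_expansion[OF assms] by blast
  have "2 * (d n)\<^sup>2 + (\<Sum>j<n. (d j)\<^sup>2) \<le> 2 * (\<Sum>j\<le>n. (d j)\<^sup>2)"
    using sum_nonneg[of "{..<n}" "\<lambda>j. (d j)\<^sup>2"] by (simp flip: lessThan_Suc_atMost)
  also have "\<dots> = 4 / pi * (pi / 2 * (\<Sum>j\<le>n. (d j)\<^sup>2))" by simp
  also have "\<dots> \<le> 4 / pi * integral {-1..1} (\<lambda>t. (poly P t)\<^sup>2)"
    using expansion_le_integral[OF d] by (intro mult_left_mono) auto
  finally have "2 * (d n)\<^sup>2 + (\<Sum>j<n. (d j)\<^sup>2) \<le> 4 / pi * integral {-1..1} (\<lambda>t. (poly P t)\<^sup>2)" .
  from mult_right_mono[OF this, of "norm_factor n"] ip_feature_le_expansion[OF assms d]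
  show ?thesis using norm_factor_pos[of n] by linarith
qed

lemma feature_node_poly: "k \<in> {1..n} \<Longrightarrow> feature (node_poly x n) (x k) = 0"
  by (auto simp: feature_def poly_node_poly intro!: prod_zero)

lemma ip_feature_node_poly_pos: "0 < ip (feature (node_poly x n)) (feature (node_poly x n))"
proof -
  have "0 < (coeff (node_poly x n) n)\<^sup>2 * (fact n / (\<epsilon>\<^sup>2) ^ n)"
    using eps by (simp add: lead_coeff_node_poly)
  also have "\<dots> \<le> ip (feature (node_poly x n)) (feature (node_poly x n))"
    unfolding ip_feature degree_node_poly
    by (rule member_le_sum[of n "{..n}" "\<lambda>i. (coeff (node_poly x n) i)\<^sup>2 * (fact i / (\<epsilon>\<^sup>2) ^ i)"]) auto
  finally show ?thesis .
qed

lemma feature_node_poly_mem: "feature (node_poly x n) \<in> H - {\<lambda>t. 0}"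
proof -
  have "ip (\<lambda>t. 0) (\<lambda>t. 0) = 0" using ip_scale[OF zero_mem zero_mem, of 0] by simp
  then show ?thesis using feature_mem ip_feature_node_poly_pos[of x n] by auto
qed

lemma continuous_on_feature: "continuous_on {-1..1} (feature P)"
proof -
  have "continuous_on {-1..1} (\<lambda>t. exp (- \<epsilon>\<^sup>2 * t\<^sup>2 / 2) * poly P t)"
    by (intro continuous_intros) auto
  then show ?thesis by (rule continuous_on_eq) (auto simp: feature_def)
qed

lemma abs_poly_le_feature: "t \<in> {-1..1} \<Longrightarrow> exp (- \<epsilon>\<^sup>2 / 2) * \<bar>poly P t\<bar> \<le> \<bar>feature P t\<bar>"
proof -
  assume t: "t \<in> {-1..1}"
  then have "t\<^sup>2 \<le> 1" by (auto simp: power2_le_iff_abs_le abs_le_iff abs_square_le_1)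
  then have "\<epsilon>\<^sup>2 * t\<^sup>2 \<le> \<epsilon>\<^sup>2 * 1" by (intro mult_left_mono) auto
  then have "exp (- \<epsilon>\<^sup>2 / 2) * \<bar>poly P t\<bar> \<le> exp (- \<epsilon>\<^sup>2 * t\<^sup>2 / 2) * \<bar>poly P t\<bar>"
    by (intro mult_right_mono) auto
  then show ?thesis using t by (simp add: feature_def abs_mult)
qed

text \<open>
  The constant \<open>c1 \<infinity> \<epsilon>\<close> is exactly the one that the comparison of norms produces, the weight being
  estimated by \<open>exp (- \<epsilon>\<^sup>2 / 2)\<close>.
\<close>
lemma c1_infinity_norm_factor:
  "c1 \<infinity> \<epsilon> * (\<epsilon> / 2) ^ n * fact n powr (-1/2) * sqrt (norm_factor n) = exp (- \<epsilon>\<^sup>2 / 2)"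
proof -
  have "norm_factor n = ((2 / \<epsilon>) ^ n * sqrt (fact n) * sqrt ((1 + \<epsilon>\<^sup>2) / 2) * exp (\<epsilon> ^ 4 / 32))\<^sup>2"
  proof -
    have "(exp (\<epsilon> ^ 4 / 32))\<^sup>2 = exp (\<epsilon> ^ 4 / 16)"
      by (simp flip: exp_double)
    moreover have "((2 / \<epsilon>) ^ n)\<^sup>2 = (4 / \<epsilon>\<^sup>2) ^ n"
      by (simp add: power_divide flip: power_mult) (simp add: power_mult mult.commute[of n])
    moreover have "(sqrt ((1 + \<epsilon>\<^sup>2) / 2))\<^sup>2 = (1 + \<epsilon>\<^sup>2) / 2" by (simp add: add_nonneg_nonneg)
    ultimately show ?thesis by (simp add: norm_factor_def power_mult_distrib)
  qed
  then have r: "sqrt (norm_factor n) = (2 / \<epsilon>) ^ n * sqrt (fact n) * sqrt ((1 + \<epsilon>\<^sup>2) / 2) * exp (\<epsilon> ^ 4 / 32)"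
    using eps by (simp add: add_nonneg_nonneg)
  have f: "fact n powr (-1/2) * sqrt (fact n) = 1"
    by (simp add: powr_minus powr_half_sqrt)
  have e: "(\<epsilon> / 2) ^ n * (2 / \<epsilon>) ^ n = 1"
    using eps by (simp flip: power_mult_distrib)
  have q: "sqrt (2 / (1 + \<epsilon>\<^sup>2)) * sqrt ((1 + \<epsilon>\<^sup>2) / 2) = 1"
  proof -
    have "1 + \<epsilon>\<^sup>2 \<noteq> 0" by (metis add_nonneg_pos zero_less_one add.commute zero_le_power2 less_irrefl)
    then show ?thesis by (simp flip: real_sqrt_mult)
  qed
  have x: "exp (- (1/32) * \<epsilon> ^ 4) * exp (\<epsilon> ^ 4 / 32) = 1"
    by (simp flip: exp_add)
  have gen: "c1 \<infinity> \<epsilon> * a * b * (a' * b' * s' * e') = (sqrt (2 / (1 + \<epsilon>\<^sup>2)) * s') * (exp (- (1/32) * \<epsilon> ^ 4) * e') * (a * a') * (b * b') * exp (- \<epsilon>\<^sup>2 / 2)"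
    for a b a' b' s' e'
    by (simp add: c1_def)
  show ?thesis unfolding r gen f e q x by simp
qed

lemma c1_infinity_pos: "0 < c1 \<infinity> \<epsilon>"
  by (auto simp: c1_def intro!: mult_pos_pos divide_pos_pos add_pos_nonneg)

text \<open>
  The factor \<open>sqrt pi / 2\<close> is the one lost in \<open>ip_feature_le_integral\<close> compared with
  \<open>ip_feature_le_sup\<close>; the constant for \<open>L\<^sup>2\<close> is smaller by much more than that.
\<close>
lemma c1_2_le: "c1 2 \<epsilon> \<le> c1 \<infinity> \<epsilon> * (sqrt pi / 2)"
proof -
  have p: "0 < 1 + \<epsilon>\<^sup>2" "0 < 4 + \<epsilon>\<^sup>2" by (auto intro!: add_pos_nonneg)
  have "2 * sqrt (2 * pi) / (3 * exp 3 * sqrt (3 * (4 + \<epsilon>\<^sup>2))) \<le> sqrt (2 / (1 + \<epsilon>\<^sup>2)) * (sqrt pi / 2)"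
  proof -
    have e: "1 \<le> exp (3 :: real)" by simp
    have "2 * sqrt (2 * pi) / (3 * exp 3 * sqrt (3 * (4 + \<epsilon>\<^sup>2))) \<le> sqrt (2 * pi) / (2 * sqrt (1 + \<epsilon>\<^sup>2))"
    proof -
      have "4 * sqrt (1 + \<epsilon>\<^sup>2) = sqrt (16 * (1 + \<epsilon>\<^sup>2))" unfolding real_sqrt_mult[of 16] by simp
      also have "\<dots> \<le> sqrt (9 * (3 * (4 + \<epsilon>\<^sup>2)))" by (intro real_sqrt_le_mono) (simp add: algebra_simps)
      also have "\<dots> = 3 * 1 * sqrt (3 * (4 + \<epsilon>\<^sup>2))" unfolding real_sqrt_mult[of 9] by simp
      also have "\<dots> \<le> 3 * exp 3 * sqrt (3 * (4 + \<epsilon>\<^sup>2))"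
        using e p by (intro mult_right_mono mult_left_mono) auto
      finally have "2 * (2 * sqrt (1 + \<epsilon>\<^sup>2)) \<le> 3 * exp 3 * sqrt (3 * (4 + \<epsilon>\<^sup>2))" by simp
      then have "sqrt (2 * pi) * (2 * (2 * sqrt (1 + \<epsilon>\<^sup>2))) \<le> sqrt (2 * pi) * (3 * exp 3 * sqrt (3 * (4 + \<epsilon>\<^sup>2)))"
        by (intro mult_left_mono) auto
      then have *: "(2 * sqrt (2 * pi)) * (2 * sqrt (1 + \<epsilon>\<^sup>2)) \<le> sqrt (2 * pi) * (3 * exp 3 * sqrt (3 * (4 + \<epsilon>\<^sup>2)))"
        by (simp only: mult_ac)
      show ?thesis
        by (rule frac_le_eq[THEN iffD2]) (use p * in \<open>simp_all add: divide_nonpos_pos\<close>)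
    qed
    also have "\<dots> = sqrt (2 / (1 + \<epsilon>\<^sup>2)) * (sqrt pi / 2)" by (simp add: real_sqrt_mult real_sqrt_divide)
    finally show ?thesis .
  qed
  then have "2 * sqrt (2 * pi) / (3 * exp 3 * sqrt (3 * (4 + \<epsilon>\<^sup>2))) * (exp (- (1/32) * \<epsilon>^4) * exp (- (1/2) * \<epsilon>\<^sup>2))
      \<le> sqrt (2 / (1 + \<epsilon>\<^sup>2)) * (sqrt pi / 2) * (exp (- (1/32) * \<epsilon>^4) * exp (- (1/2) * \<epsilon>\<^sup>2))"
    by (intro mult_right_mono) auto
  then show ?thesis by (simp add: c1_def mult_ac)
qed

lemma Lp_norm_feature_ge:
  assumes n: "1 \<le> n" and p: "p \<in> {2, \<infinity>}" and P: "degree P \<le> n"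
  shows "ennreal (c1 p \<epsilon> * (\<epsilon> / 2) ^ n * fact n powr (-1/2) * sqrt (ip (feature P) (feature P))) \<le> Lp_norm leb p (feature P)"
proof -
  define c where "c = c1 \<infinity> \<epsilon> * (\<epsilon> / 2) ^ n * fact n powr (-1/2)"
  have c0: "0 \<le> c" using c1_infinity_pos eps by (simp add: c_def)
  have cN: "c * sqrt (norm_factor n) = exp (- \<epsilon>\<^sup>2 / 2)"
    using c1_infinity_norm_factor by (simp add: c_def)
  consider "p = \<infinity>" | "p = 2" using p by auto
  then show ?thesis
  proof cases
    case 1
    have "ennreal (c * sqrt (ip (feature P) (feature P))) \<le> Lp_norm leb \<infinity> (feature P)"
    proof (cases "Lp_norm leb \<infinity> (feature P)")
      case (real r)
      have "\<bar>poly P t\<bar> \<le> r * exp (\<epsilon>\<^sup>2 / 2)" if t: "t \<in> {-1<..<1}" for t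
      proof -
        have "exp (- \<epsilon>\<^sup>2 / 2) * \<bar>poly P t\<bar> \<le> r"
          using abs_poly_le_feature[of t P] abs_le_Lp_norm_infinity[OF continuous_on_feature _ _ t, of P r] real t
          by auto
        then show ?thesis by (simp add: exp_minus field_simps)
      qed
      then have "ip (feature P) (feature P) \<le> (r * exp (\<epsilon>\<^sup>2 / 2))\<^sup>2 * norm_factor n"
        by (intro ip_feature_le_sup n P)
      then have "sqrt (ip (feature P) (feature P)) \<le> sqrt ((r * exp (\<epsilon>\<^sup>2 / 2))\<^sup>2 * norm_factor n)"
        by (rule real_sqrt_le_mono)
      also have "\<dots> = r * exp (\<epsilon>\<^sup>2 / 2) * sqrt (norm_factor n)"
        using real by (simp add: real_sqrt_mult)
      finally have "c * sqrt (ip (feature P) (feature P)) \<le> c * (r * exp (\<epsilon>\<^sup>2 / 2) * sqrt (norm_factor n))"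
        using c0 by (rule mult_left_mono)
      also have "\<dots> = (c * sqrt (norm_factor n)) * exp (\<epsilon>\<^sup>2 / 2) * r" by simp
      also have "\<dots> = r" unfolding cN by (simp add: exp_minus)
      finally show ?thesis using real by (simp add: ennreal_leI)
    qed simp
    then show ?thesis by (simp add: c_def 1)
  next
    case 2
    define I where "I = integral {-1..1} (\<lambda>t. (poly P t)\<^sup>2)"
    define J where "J = integral {-1..1} (\<lambda>t. (feature P t)\<^sup>2)"
    have I: "((\<lambda>t. (poly P t)\<^sup>2) has_integral I) {-1..1}"
      unfolding I_def by (intro integrable_integral integrable_continuous_interval continuous_intros)
    have J: "((\<lambda>t. (feature P t)\<^sup>2) has_integral J) {-1..1}"
      unfolding J_def
      by (intro integrable_integral integrable_continuous_interval continuous_intros continuous_on_feature)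
    have "(exp (- \<epsilon>\<^sup>2 / 2))\<^sup>2 * I \<le> J"
    proof (rule has_integral_le[OF has_integral_mult_right[OF I] J])
      fix t :: real assume "t \<in> {-1..1}"
      from power_mono[OF abs_poly_le_feature[OF this], of P 2]
      show "(exp (- \<epsilon>\<^sup>2 / 2))\<^sup>2 * (poly P t)\<^sup>2 \<le> (feature P t)\<^sup>2"
        by (simp add: power_mult_distrib)
    qed
    from real_sqrt_le_mono[OF this]
    have IJ: "exp (- \<epsilon>\<^sup>2 / 2) * sqrt I \<le> sqrt J" by (simp add: real_sqrt_mult)
    have "c1 2 \<epsilon> * (\<epsilon> / 2) ^ n * fact n powr (-1/2) \<le> c1 \<infinity> \<epsilon> * (sqrt pi / 2) * (\<epsilon> / 2) ^ n * fact n powr (-1/2)"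
      using c1_2_le eps by (intro mult_right_mono) auto
    then have "c1 2 \<epsilon> * (\<epsilon> / 2) ^ n * fact n powr (-1/2) \<le> c * (sqrt pi / 2)" by (simp add: c_def mult_ac)
    moreover have "sqrt (ip (feature P) (feature P)) \<le> sqrt (4 / pi * I * norm_factor n)"
      unfolding I_def by (intro real_sqrt_le_mono ip_feature_le_integral P)
    ultimately have "c1 2 \<epsilon> * (\<epsilon> / 2) ^ n * fact n powr (-1/2) * sqrt (ip (feature P) (feature P))
        \<le> c * (sqrt pi / 2) * sqrt (4 / pi * I * norm_factor n)"
      by (rule mult_mono) (use c0 ip_nonneg[OF feature_mem[of P]] in auto)
    also have "\<dots> = (c * sqrt (norm_factor n)) * sqrt I"
      by (simp add: real_sqrt_mult real_sqrt_divide)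
    also have "\<dots> \<le> sqrt J" unfolding cN by (rule IJ)
    finally show ?thesis unfolding 2 Lp_norm_2_eq[OF J] by (rule ennreal_leI)
  qed
qed

text \<open>
  The weighted node polynomial has only zero samples, so every sampling method approximates it by
  zero.
\<close>
lemma emin_points_ge:
  assumes n: "1 \<le> n" and p: "p \<in> {2, \<infinity>}"
  shows "ennreal (c1 p \<epsilon> * (\<epsilon> / 2) ^ n * fact n powr (-1/2)) \<le> emin_points H ip p n x"
  unfolding emin_points_def
proof (rule INF_greatest, rule SUP_upper2[OF feature_node_poly_mem[of x n]])
  fix \<psi> :: "nat \<Rightarrow> real \<Rightarrow> real"
  have z: "(\<Sum>k=1..n. feature (node_poly x n) (x k) * \<psi> k t) = 0" for t
    by (intro sum.neutral) (auto simp: feature_node_poly)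
  show "ennreal (c1 p \<epsilon> * (\<epsilon> / 2) ^ n * fact n powr (-1/2))
    \<le> Lp_norm leb p (\<lambda>t. feature (node_poly x n) t - (\<Sum>k=1..n. feature (node_poly x n) (x k) * \<psi> k t))
      / ennreal (sqrt (ip (feature (node_poly x n)) (feature (node_poly x n))))"
    unfolding z diff_0_right
    using ip_feature_node_poly_pos[of x n] Lp_norm_feature_ge[OF n p, of "node_poly x n"]
    by (intro ennreal_le_divide) (auto simp: degree_node_poly)
qed

text \<open>
  The same function is used at the point \<open>t\<close>. Its norm is now compared with the bound \<open>2 ^ n\<close> of the
  node polynomial, which turns \<open>\<epsilon> / 2\<close> into \<open>\<epsilon> / 4\<close>.
\<close>
lemma emin_at_ge:
  assumes n: "1 \<le> n" and x: "x ` {1..n} \<subseteq> {-1..1}" and t: "t \<in> {-1..1} - x ` {1..n}"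
  shows "ennreal (c1 \<infinity> \<epsilon> * (\<epsilon> / 4) ^ n * fact n powr (-1/2)) \<le> emin_at H ip n x t / ennreal \<bar>\<Prod>k=1..n. (t - x k)\<bar>"
proof (rule ennreal_le_divide)
  let ?W = "node_poly x n"
  have W: "(\<Prod>k=1..n. (t - x k)) = poly ?W t" by (simp add: poly_node_poly)
  show "0 < \<bar>\<Prod>k=1..n. (t - x k)\<bar>" using t by auto
  let ?c = "c1 \<infinity> \<epsilon> * (\<epsilon> / 4) ^ n * fact n powr (-1/2)"
  have c0: "0 \<le> ?c" using c1_infinity_pos eps by simp
  have "sqrt (ip (feature ?W) (feature ?W)) \<le> sqrt ((2 ^ n)\<^sup>2 * norm_factor n)"
    using abs_node_poly_le[OF x]
    by (intro real_sqrt_le_mono ip_feature_le_sup[OF n]) (auto simp: degree_node_poly)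
  also have "\<dots> = 2 ^ n * sqrt (norm_factor n)" by (simp add: real_sqrt_mult)
  finally have "?c * sqrt (ip (feature ?W) (feature ?W)) \<le> ?c * (2 ^ n * sqrt (norm_factor n))"
    using c0 by (rule mult_left_mono)
  also have "\<dots> = c1 \<infinity> \<epsilon> * (\<epsilon> / 2) ^ n * fact n powr (-1/2) * sqrt (norm_factor n)"
  proof -
    have "(\<epsilon> / 4) ^ n * 2 ^ n = (\<epsilon> / 2) ^ n" by (simp flip: power_mult_distrib)
    moreover have "a * b * f * (d * s) = a * (b * d) * f * s" for a b f d s :: real by simp
    ultimately show ?thesis by (simp only:)
  qed
  finally have "?c * sqrt (ip (feature ?W) (feature ?W)) \<le> exp (- \<epsilon>\<^sup>2 / 2)"
    unfolding c1_infinity_norm_factor .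
  then have "?c * sqrt (ip (feature ?W) (feature ?W)) * \<bar>poly ?W t\<bar> \<le> exp (- \<epsilon>\<^sup>2 / 2) * \<bar>poly ?W t\<bar>"
    by (intro mult_right_mono) auto
  also have "\<dots> \<le> \<bar>feature ?W t\<bar>" using t by (intro abs_poly_le_feature) auto
  finally have main: "?c * \<bar>poly ?W t\<bar> * sqrt (ip (feature ?W) (feature ?W)) \<le> \<bar>feature ?W t\<bar>"
    by (simp only: mult_ac)
  show "ennreal (?c * \<bar>\<Prod>k=1..n. (t - x k)\<bar>) \<le> emin_at H ip n x t"
    unfolding emin_at_def W
  proof (rule INF_greatest, rule SUP_upper2[OF feature_node_poly_mem[of x n]])
    fix u :: "nat \<Rightarrow> real"
    have z: "(\<Sum>k=1..n. feature ?W (x k) * u k) = 0"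
      by (intro sum.neutral) (auto simp: feature_node_poly)
    show "ennreal (?c * \<bar>poly ?W t\<bar>) \<le> ennreal \<bar>feature ?W t - (\<Sum>k=1..n. feature ?W (x k) * u k)\<bar>
        / ennreal (sqrt (ip (feature ?W) (feature ?W)))"
      unfolding z diff_0_right using ip_feature_node_poly_pos[of x n] main
      by (intro ennreal_le_divide ennreal_leI) auto
  qed
qed

end

section \<open>Upper bounds\<close>

context gaussian_rkhs
begin

text \<open>
  Point evaluation at \<open>t\<close> and at \<open>s\<close> are represented by kernel sections at distance
  \<open>sqrt (2 - 2 * K t s)\<close>.
\<close>
lemma continuous_on_mem:
  assumes f: "f \<in> H"
  shows "continuous_on {-1..1} f"
  unfolding continuous_on_def
proof
  fix s :: real assume s: "s \<in> {-1..1}"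
  let ?k = "\<lambda>y t. if t \<in> {-1..1} then gaussian_kernel \<epsilon> t y else 0"
  define g where "g t = sqrt (ip f f) * sqrt (2 - 2 * exp (- (1/2) * \<epsilon>\<^sup>2 * (t - s)\<^sup>2))" for t
  have "\<bar>f t - f s\<bar> \<le> g t" if t: "t \<in> {-1..1}" for t
  proof -
    have m: "?k t \<in> H" "?k s \<in> H" by (rule section_mem[OF t], rule section_mem[OF s])
    have "ip f (\<lambda>x. ?k t x - ?k s x) = f t - f s"
      using ip_minus_right[OF m f] reproducing[OF f t] reproducing[OF f s] by simp
    moreover have "ip (\<lambda>x. ?k t x - ?k s x) (\<lambda>x. ?k t x - ?k s x) = ?k t t - 2 * ?k t s + ?k s s"
      unfolding ip_minus_self[OF m] reproducing[OF m(1) t] reproducing[OF m(1) s] reproducing[OF m(2) s] ..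
    moreover have "\<dots> = 2 - 2 * exp (- (1/2) * \<epsilon>\<^sup>2 * (t - s)\<^sup>2)"
      using s t by (simp add: gaussian_kernel_def power2_commute)
    ultimately show ?thesis
      using Cauchy_Schwarz[OF f minus_mem[OF m]] by (simp add: g_def)
  qed
  then have "eventually (\<lambda>t. norm (f t - f s) \<le> g t) (at s within {-1..1})"
    by (auto simp: eventually_at_filter)
  moreover have "(g \<longlongrightarrow> g s) (at s within {-1..1})"
    unfolding g_def by (intro tendsto_intros)
  then have "(g \<longlongrightarrow> 0) (at s within {-1..1})" by (simp add: g_def)
  ultimately have "((\<lambda>t. f t - f s) \<longlongrightarrow> 0) (at s within {-1..1})"
    by (rule Lim_null_comparison)
  then show "(f \<longlongrightarrow> f s) (at s within {-1..1})" by (simp add: LIM_zero_iff)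
qed

text \<open>
  The common factor of all upper bounds: a bound for the worst-case pointwise error per unit of \<open>\<bar>\<Prod>k. (t - x k)\<bar>\<close>.
\<close>
definition error_factor :: "nat \<Rightarrow> real" where
  "error_factor n = sqrt (c_L (\<epsilon>\<^sup>2)) * real n powr (-1/8) * exp (\<epsilon> * sqrt n) * \<epsilon> ^ n * fact n powr (-1/2)"

lemma error_factor_nonneg: "0 \<le> error_factor n"
  using eps c_L_nonneg[of "\<epsilon>\<^sup>2"] by (simp add: error_factor_def)

text \<open>
  A single system of continuous weights serves all points \<open>t\<close> and all functions \<open>f\<close> at once. Hence it
  yields the pointwise bounds and, after taking norms in \<open>t\<close>, the bounds for \<open>L\<^sup>2\<close> and \<open>L\<^sup>\<infinity>\<close>.
\<close>
lemma sampling_error: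
  assumes n: "m_L (\<epsilon>\<^sup>2) \<le> n" and x: "x ` {1..n} \<subseteq> {-1..1}" "inj_on x {1..n}"
  shows "\<exists>\<psi>. (\<forall>k. continuous_on {-1..1} (\<psi> k)) \<and> (\<forall>f\<in>H. \<forall>t\<in>{-1..1}.
      \<bar>f t - (\<Sum>k=1..n. f (x k) * \<psi> k t)\<bar> \<le> sqrt (ip f f) * (\<bar>poly (node_poly x n) t\<bar> * error_factor n))"
proof -
  define A where "A = x ` {1..n}"
  have A: "finite A" "A \<subseteq> {-1..1}" "card A = n" using x by (auto simp: A_def card_image)
  have A1: "\<And>a. a \<in> A \<Longrightarrow> \<bar>a\<bar> \<le> 1" using A(2) by (auto simp: abs_le_iff)
  obtain u where u: "\<And>a. continuous_on UNIV (u a)"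
    "\<And>t j. \<bar>t\<bar> \<le> 1 \<Longrightarrow> \<bar>t ^ j - (\<Sum>a\<in>A. u a t * a ^ j)\<bar> \<le> \<bar>\<Prod>a\<in>A. t - a\<bar> * real (j choose card A)"
    using monomial_interpolation_error[OF A(1) A1] by blast
  have l: "0 < \<epsilon>\<^sup>2" using eps by simp
  obtain S where S: "(\<lambda>j. (\<epsilon>\<^sup>2) ^ j / fact j * (real (j choose n))\<^sup>2) sums S"
    and S_le: "S \<le> c_L (\<epsilon>\<^sup>2) * real n powr (-1/4) * exp (2 * sqrt (\<epsilon>\<^sup>2 * n)) * (\<epsilon>\<^sup>2) ^ n / fact n"
    using binomial_squares_sum_le[OF l n] by blast
  have "sqrt S \<le> error_factor n"
  proof (rule real_le_lsqrt)
    have "(real n powr (-1/8))\<^sup>2 = real n powr (-1/4)"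
      by (simp add: power2_eq_square flip: powr_add)
    moreover have "(fact n powr (-1/2))\<^sup>2 = (1 / fact n :: real)"
      by (simp add: power2_eq_square powr_minus_divide flip: powr_add)
    moreover have "(exp (\<epsilon> * sqrt n))\<^sup>2 = exp (2 * sqrt (\<epsilon>\<^sup>2 * n))"
      using eps by (simp add: real_sqrt_mult flip: exp_double)
    moreover have "(\<epsilon> ^ n)\<^sup>2 = (\<epsilon>\<^sup>2) ^ n" by (simp flip: power_mult add: mult.commute)
    ultimately show "S \<le> (error_factor n)\<^sup>2"
      using S_le c_L_nonneg[OF l] by (simp add: error_factor_def power_mult_distrib)
  qed (rule error_factor_nonneg)
  define \<psi> where "\<psi> k t = exp (- \<epsilon>\<^sup>2 * t\<^sup>2 / 2) * (exp (\<epsilon>\<^sup>2 * (x k)\<^sup>2 / 2) * u (x k) t)" for k t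
  show ?thesis
  proof (intro exI[of _ \<psi>] conjI allI ballI)
    fix k :: nat
    show "continuous_on {-1..1} (\<psi> k)"
      unfolding \<psi>_def using continuous_on_subset[OF u(1)] by (intro continuous_intros) auto
  next
    fix f and t :: real assume f: "f \<in> H" and t: "t \<in> {-1..1}"
    have w: "(\<Prod>a\<in>A. t - a) = poly (node_poly x n) t"
      unfolding A_def poly_node_poly by (subst prod.reindex[OF x(2)]) simp
    have "(\<Sum>k=1..n. f (x k) * \<psi> k t) = (\<Sum>a\<in>A. f a * (exp (- \<epsilon>\<^sup>2 * t\<^sup>2 / 2) * (exp (\<epsilon>\<^sup>2 * a\<^sup>2 / 2) * u a t)))"
      unfolding A_def \<psi>_def by (subst sum.reindex[OF x(2)]) simp
    then have "\<bar>f t - (\<Sum>k=1..n. f (x k) * \<psi> k t)\<bar> \<le> sqrt (ip f f) * (\<bar>poly (node_poly x n) t\<bar> * sqrt S)"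
      using interpolation_error[OF A(1,2) t f _ _ S, of "\<lambda>a. u a t" "\<bar>poly (node_poly x n) t\<bar>"] u(2)[of t] t w A(3)
      by (auto simp: abs_le_iff)
    also have "\<dots> \<le> sqrt (ip f f) * (\<bar>poly (node_poly x n) t\<bar> * error_factor n)"
      using \<open>sqrt S \<le> error_factor n\<close> ip_nonneg[OF f] by (intro mult_left_mono) auto
    finally show "\<bar>f t - (\<Sum>k=1..n. f (x k) * \<psi> k t)\<bar> \<le> sqrt (ip f f) * (\<bar>poly (node_poly x n) t\<bar> * error_factor n)" .
  qed
qed

lemma ip_pos: "f \<in> H - {\<lambda>t. 0} \<Longrightarrow> 0 < ip f f"
  using ip_nonneg[of f] ip_definite[of f] by (auto simp: less_le)

lemma emin_points_infinity_le:
  assumes n: "m_L (\<epsilon>\<^sup>2) \<le> n" and x: "x ` {1..n} \<subseteq> {-1..1}" "inj_on x {1..n}"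
    and B: "\<And>t. t \<in> {-1..1} \<Longrightarrow> \<bar>poly (node_poly x n) t\<bar> \<le> B"
  shows "emin_points H ip \<infinity> n x \<le> ennreal (B * error_factor n)"
proof -
  obtain \<psi> where "(\<forall>k. continuous_on {-1..1} (\<psi> k)) \<and> (\<forall>f\<in>H. \<forall>t\<in>{-1..1}.
      \<bar>f t - (\<Sum>k=1..n. f (x k) * \<psi> k t)\<bar> \<le> sqrt (ip f f) * (\<bar>poly (node_poly x n) t\<bar> * error_factor n))"
    using sampling_error[OF n x] by (rule exE)
  note \<psi> = this[THEN conjunct1, rule_format] this[THEN conjunct2, rule_format]
  have "0 \<le> B" using B[of 0] by auto
  show ?thesis
    unfolding emin_points_def
  proof (rule INF_lower2[of \<psi>], use Lp_space_continuous \<psi>(1) in simp, rule SUP_least)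
    fix f assume f': "f \<in> H - {\<lambda>t. 0}"
    then have f: "f \<in> H" by simp
    show "Lp_norm leb \<infinity> (\<lambda>t. f t - (\<Sum>k=1..n. f (x k) * \<psi> k t)) / ennreal (sqrt (ip f f)) \<le> ennreal (B * error_factor n)"
    proof (rule ennreal_divide_le)
      show "Lp_norm leb \<infinity> (\<lambda>t. f t - (\<Sum>k=1..n. f (x k) * \<psi> k t)) \<le> ennreal (B * error_factor n * sqrt (ip f f))"
      proof (rule Lp_norm_infinity_le)
        show "continuous_on {-1..1} (\<lambda>t. f t - (\<Sum>k=1..n. f (x k) * \<psi> k t))"
          by (intro continuous_intros continuous_on_mem f \<psi>)
        fix t :: real assume t: "t \<in> {-1..1}"
        have "sqrt (ip f f) * (\<bar>poly (node_poly x n) t\<bar> * error_factor n) \<le> sqrt (ip f f) * (B * error_factor n)"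
          using B[OF t] error_factor_nonneg ip_nonneg[OF f] by (intro mult_left_mono mult_right_mono) auto
        then show "\<bar>f t - (\<Sum>k=1..n. f (x k) * \<psi> k t)\<bar> \<le> B * error_factor n * sqrt (ip f f)"
          using \<psi>(2)[OF f t] by (simp add: mult_ac)
      qed
    qed (use ip_pos[OF f'] \<open>0 \<le> B\<close> error_factor_nonneg in auto)
  qed
qed

lemma emin_points_2_le:
  assumes n: "m_L (\<epsilon>\<^sup>2) \<le> n" and x: "x ` {1..n} \<subseteq> {-1..1}" "inj_on x {1..n}"
    and D: "integral {-1..1} (\<lambda>t. (poly (node_poly x n) t)\<^sup>2) \<le> D"
  shows "emin_points H ip 2 n x \<le> ennreal (sqrt D * error_factor n)"
proof -
  obtain \<psi> where "(\<forall>k. continuous_on {-1..1} (\<psi> k)) \<and> (\<forall>f\<in>H. \<forall>t\<in>{-1..1}.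
      \<bar>f t - (\<Sum>k=1..n. f (x k) * \<psi> k t)\<bar> \<le> sqrt (ip f f) * (\<bar>poly (node_poly x n) t\<bar> * error_factor n))"
    using sampling_error[OF n x] by (rule exE)
  note \<psi> = this[THEN conjunct1, rule_format] this[THEN conjunct2, rule_format]
  let ?I = "integral {-1..1} (\<lambda>t. (poly (node_poly x n) t)\<^sup>2)"
  have I: "((\<lambda>t. (poly (node_poly x n) t)\<^sup>2) has_integral ?I) {-1..1}"
    by (intro integrable_integral integrable_continuous_interval continuous_intros)
  have D0: "0 \<le> D" using has_integral_nonneg[OF I] D by simp
  show ?thesis
    unfolding emin_points_def
  proof (rule INF_lower2[of \<psi>], use Lp_space_continuous \<psi>(1) in simp, rule SUP_least)
    fix f assume f': "f \<in> H - {\<lambda>t. 0}"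
    then have f: "f \<in> H" by simp
    show "Lp_norm leb 2 (\<lambda>t. f t - (\<Sum>k=1..n. f (x k) * \<psi> k t)) / ennreal (sqrt (ip f f)) \<le> ennreal (sqrt D * error_factor n)"
    proof (rule ennreal_divide_le)
      let ?c = "(sqrt (ip f f) * error_factor n)\<^sup>2"
      have "Lp_norm leb 2 (\<lambda>t. f t - (\<Sum>k=1..n. f (x k) * \<psi> k t)) \<le> ennreal (sqrt (?c * ?I))"
      proof (rule Lp_norm_2_le[OF _ has_integral_mult_right[OF I]])
        fix t :: real assume t: "t \<in> {-1..1}"
        from power_mono[OF \<psi>(2)[OF f t], of 2]
        show "(f t - (\<Sum>k=1..n. f (x k) * \<psi> k t))\<^sup>2 \<le> ?c * (poly (node_poly x n) t)\<^sup>2"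
          by (simp add: power_mult_distrib mult_ac)
      qed
      also have "sqrt (?c * ?I) = sqrt (ip f f) * error_factor n * sqrt ?I"
        using error_factor_nonneg ip_nonneg[OF f] by (simp add: real_sqrt_mult)
      also have "\<dots> \<le> sqrt (ip f f) * error_factor n * sqrt D"
        using D error_factor_nonneg ip_nonneg[OF f] by (intro mult_left_mono) auto
      then have "ennreal (sqrt (ip f f) * error_factor n * sqrt ?I) \<le> ennreal (sqrt (ip f f) * error_factor n * sqrt D)"
        by (rule ennreal_leI)
      finally show "Lp_norm leb 2 (\<lambda>t. f t - (\<Sum>k=1..n. f (x k) * \<psi> k t)) \<le> ennreal (sqrt D * error_factor n * sqrt (ip f f))"
        by (simp add: mult_ac)
    qed (use ip_pos[OF f'] D0 error_factor_nonneg in auto)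
  qed
qed

lemma emin_at_le:
  assumes n: "m_L (\<epsilon>\<^sup>2) \<le> n" and x: "x ` {1..n} \<subseteq> {-1..1}" "inj_on x {1..n}"
    and t: "t \<in> {-1..1} - x ` {1..n}"
  shows "emin_at H ip n x t / ennreal \<bar>\<Prod>k=1..n. (t - x k)\<bar> \<le> ennreal (error_factor n)"
proof (rule ennreal_divide_le)
  obtain \<psi> where "(\<forall>k. continuous_on {-1..1} (\<psi> k)) \<and> (\<forall>f\<in>H. \<forall>t\<in>{-1..1}.
      \<bar>f t - (\<Sum>k=1..n. f (x k) * \<psi> k t)\<bar> \<le> sqrt (ip f f) * (\<bar>poly (node_poly x n) t\<bar> * error_factor n))"
    using sampling_error[OF n x] by (rule exE)
  note \<psi> = this[THEN conjunct2, rule_format]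
  show "0 < \<bar>\<Prod>k=1..n. (t - x k)\<bar>" using t by auto
  show "emin_at H ip n x t \<le> ennreal (error_factor n * \<bar>\<Prod>k=1..n. (t - x k)\<bar>)"
    unfolding emin_at_def
  proof (rule INF_lower2[of "\<lambda>k. \<psi> k t"], simp, rule SUP_least)
    fix f assume f': "f \<in> H - {\<lambda>t. 0}"
    then have f: "f \<in> H" by simp
    show "ennreal \<bar>f t - (\<Sum>k=1..n. f (x k) * \<psi> k t)\<bar> / ennreal (sqrt (ip f f))
        \<le> ennreal (error_factor n * \<bar>\<Prod>k=1..n. (t - x k)\<bar>)"
    proof (rule ennreal_divide_le)
      show "ennreal \<bar>f t - (\<Sum>k=1..n. f (x k) * \<psi> k t)\<bar>
          \<le> ennreal (error_factor n * \<bar>\<Prod>k=1..n. (t - x k)\<bar> * sqrt (ip f f))"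
        using \<psi>[OF f, of t] t by (intro ennreal_leI) (simp add: poly_node_poly mult_ac)
    qed (use ip_pos[OF f'] error_factor_nonneg in auto)
  qed
qed (rule error_factor_nonneg)

end

section \<open>The error bounds\<close>

theorem theorem1p1:
  fixes \<epsilon> :: real and p :: ennreal and n :: nat
    and H :: "(real \<Rightarrow> real) set"
    and ip :: "(real \<Rightarrow> real) \<Rightarrow> (real \<Rightarrow> real) \<Rightarrow> real"
  assumes "\<epsilon> > 0"
    and "p \<in> {2, \<infinity>}"
    and "rkhs {-1..1} (gaussian_kernel \<epsilon>) H ip"
    and "n \<ge> 1"
  shows
    "(\<forall>x :: nat \<Rightarrow> real. x ` {1..n} \<subseteq> {-1..1} \<and> inj_on x {1..n} \<longrightarrow>
        ennreal (c1 p \<epsilon> * (\<epsilon>/2)^n * fact n powr (-1/2)) \<le> emin_points H ip p n x \<and>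
        (real n \<ge> m_L (\<epsilon>^2) \<longrightarrow>
          emin_points H ip p n x \<le>
            ennreal (c2 p \<epsilon> * real n powr (-1/8 - recip p) * exp (\<epsilon> * sqrt (real n))
              * (2*\<epsilon>)^n * fact n powr (-1/2))))
     \<and> ennreal (c1 p \<epsilon> * (\<epsilon>/2)^n * fact n powr (-1/2)) \<le> emin H ip p n
     \<and> (real n \<ge> m_L (\<epsilon>^2) \<longrightarrow>
          emin H ip p n \<le>
            ennreal (2 * c2 p \<epsilon> * real n powr (-1/8) * exp (\<epsilon> * sqrt (real n))
              * (\<epsilon>/2)^n * fact n powr (-1/2)))
     \<and> (\<forall>x :: nat \<Rightarrow> real. x ` {1..n} \<subseteq> {-1..1} \<and> inj_on x {1..n} \<longrightarrow>
        (\<forall>t \<in> {-1..1} - x ` {1..n}.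
          ennreal (c1 \<infinity> \<epsilon> * (\<epsilon>/4)^n * fact n powr (-1/2))
            \<le> emin_at H ip n x t / ennreal \<bar>\<Prod>k=1..n. (t - x k)\<bar> \<and>
          (real n \<ge> m_L (\<epsilon>^2) \<longrightarrow>
            emin_at H ip n x t / ennreal \<bar>\<Prod>k=1..n. (t - x k)\<bar> \<le>
              ennreal (c2 p \<epsilon> * real n powr (-1/8) * exp (\<epsilon> * sqrt (real n))
                * \<epsilon>^n * fact n powr (-1/2)))))"
proof -
  interpret rkhs "{-1..1}" "gaussian_kernel \<epsilon>" H ip by (rule assms(3))
  interpret gaussian_rkhs \<epsilon> H ip by unfold_locales (rule assms(1))
  note p = assms(2) and n = assms(4)
  have c2: "sqrt (c_L (\<epsilon>\<^sup>2)) \<le> c2 p \<epsilon>"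
  proof -
    have "sqrt (c_L (\<epsilon>\<^sup>2)) \<le> sqrt (2 * c_L (\<epsilon>\<^sup>2))"
      using c_L_nonneg[of "\<epsilon>\<^sup>2"] eps by (intro real_sqrt_le_mono) auto
    then show ?thesis by (simp add: c2_def)
  qed
  have points_upper: "emin_points H ip p n x \<le> ennreal (c2 p \<epsilon> * real n powr (-1/8 - recip p) * exp (\<epsilon> * sqrt (real n))
      * (2*\<epsilon>)^n * fact n powr (-1/2))"
    if x: "x ` {1..n} \<subseteq> {-1..1}" "inj_on x {1..n}" and m: "m_L (\<epsilon>\<^sup>2) \<le> n" for x
  proof (cases "p = \<infinity>")
    case True
    have "emin_points H ip \<infinity> n x \<le> ennreal (2 ^ n * error_factor n)"
      by (intro emin_points_infinity_le m x abs_node_poly_le)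
    also have "2 ^ n * error_factor n = c2 \<infinity> \<epsilon> * real n powr (-1/8 - recip \<infinity>) * exp (\<epsilon> * sqrt (real n))
      * (2*\<epsilon>)^n * fact n powr (-1/2)"
      by (simp add: error_factor_def c2_def recip_def power_mult_distrib mult_ac)
    finally show ?thesis using True by simp
  next
    case False
    then have p2: "p = 2" using p by simp
    have "emin_points H ip 2 n x \<le> ennreal (sqrt (2 * 4 ^ n / n) * error_factor n)"
      by (intro emin_points_2_le m x integral_node_poly_le n)
    also have "sqrt (2 * 4 ^ n / n) = sqrt 2 * 2 ^ n * real n powr (-1/2)"
    proof -
      have "sqrt (4 ^ n) = (2 :: real) ^ n" by (simp add: real_sqrt_power)
      then show ?thesis using n by (simp add: real_sqrt_mult real_sqrt_divide powr_minus_divide powr_half_sqrt)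
    qed
    also have "sqrt 2 * 2 ^ n * real n powr (-1/2) * error_factor n
        = c2 2 \<epsilon> * real n powr (-1/8 - recip 2) * exp (\<epsilon> * sqrt (real n)) * (2*\<epsilon>)^n * fact n powr (-1/2)"
    proof -
      have "real n powr (-1/8 - recip 2) = real n powr (-1/8) * real n powr (-1/2)"
        by (simp add: recip_def flip: powr_add)
      then show ?thesis
        by (simp add: error_factor_def c2_def power_mult_distrib real_sqrt_mult mult_ac)
    qed
    finally show ?thesis unfolding p2 .
  qed
  have emin_upper: "emin H ip p n \<le> ennreal (2 * c2 p \<epsilon> * real n powr (-1/8) * exp (\<epsilon> * sqrt (real n))
      * (\<epsilon>/2)^n * fact n powr (-1/2))"
    if m: "m_L (\<epsilon>\<^sup>2) \<le> n"
  proof -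
    obtain x where x: "x ` {1..n} \<subseteq> {-1..1}" "inj_on x {1..n}"
      and w: "\<And>t. t \<in> {-1..1} \<Longrightarrow> \<bar>poly (node_poly x n) t\<bar> \<le> 2 * (1 / 2) ^ n"
      using chebyshev_nodes[OF n] by blast
    have "emin H ip p n \<le> emin_points H ip p n x"
      unfolding emin_def using x(1) by (intro INF_lower) (auto simp: image_subset_iff)
    also have "\<dots> \<le> ennreal ((if p = \<infinity> then 1 else sqrt 2) * (2 * (1 / 2) ^ n) * error_factor n)"
    proof (cases "p = \<infinity>")
      case True
      then show ?thesis using emin_points_infinity_le[OF m x w] by simp
    next
      case False
      then have p2: "p = 2" using p by simp
      have "integral {-1..1} (\<lambda>t. (poly (node_poly x n) t)\<^sup>2) \<le> 2 * (2 * (1 / 2) ^ n)\<^sup>2"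
      proof (rule has_integral_le)
        show "((\<lambda>t. (poly (node_poly x n) t)\<^sup>2) has_integral integral {-1..1} (\<lambda>t. (poly (node_poly x n) t)\<^sup>2)) {-1..1}"
          by (intro integrable_integral integrable_continuous_interval continuous_intros)
        show "((\<lambda>t::real. (2 * (1 / 2) ^ n)\<^sup>2 :: real) has_integral 2 * (2 * (1 / 2) ^ n)\<^sup>2) {-1..1}"
          using has_integral_const_real[of "(2 * (1 / 2) ^ n)\<^sup>2 :: real" "-1" 1] by simp
        fix t :: real assume "t \<in> {-1..1}"
        from power_mono[OF w[OF this], of 2]
        show "(poly (node_poly x n) t)\<^sup>2 \<le> (2 * (1 / 2) ^ n)\<^sup>2" by simp
      qed
      moreover have "sqrt (2 * (2 * (1 / 2) ^ n)\<^sup>2) = sqrt 2 * (2 * (1 / 2) ^ n)"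
        using real_sqrt_mult[of 2 "(2 * (1 / 2) ^ n)\<^sup>2"] real_sqrt_abs[of "2 * (1 / 2) ^ n"]
        by (simp only:) simp
      ultimately show ?thesis
        using emin_points_2_le[OF m x] unfolding p2 by fastforce
    qed
    also have "(if p = \<infinity> then 1 else sqrt 2) * (2 * (1 / 2) ^ n) * error_factor n
        = 2 * c2 p \<epsilon> * real n powr (-1/8) * exp (\<epsilon> * sqrt (real n)) * (\<epsilon>/2)^n * fact n powr (-1/2)"
    proof -
      have "(\<epsilon> / 2) ^ n = (1 / 2) ^ n * \<epsilon> ^ n" by (simp flip: power_mult_distrib)
      then show ?thesis by (simp add: error_factor_def c2_def real_sqrt_mult)
    qed
    finally show ?thesis .
  qed
  have at_upper: "emin_at H ip n x t / ennreal \<bar>\<Prod>k=1..n. (t - x k)\<bar> \<le>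
      ennreal (c2 p \<epsilon> * real n powr (-1/8) * exp (\<epsilon> * sqrt (real n)) * \<epsilon>^n * fact n powr (-1/2))"
    if "x ` {1..n} \<subseteq> {-1..1}" "inj_on x {1..n}" "m_L (\<epsilon>\<^sup>2) \<le> n" "t \<in> {-1..1} - x ` {1..n}" for x t
  proof -
    have "error_factor n \<le> c2 p \<epsilon> * real n powr (-1/8) * exp (\<epsilon> * sqrt (real n)) * \<epsilon>^n * fact n powr (-1/2)"
      unfolding error_factor_def using c2 eps by (intro mult_right_mono) auto
    then show ?thesis
      using emin_at_le[OF that(3,1,2,4)] by (meson ennreal_leI order.trans)
  qed
  have emin_lower: "ennreal (c1 p \<epsilon> * (\<epsilon>/2)^n * fact n powr (-1/2)) \<le> emin H ip p n"
    unfolding emin_def by (intro INF_greatest emin_points_ge n p)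
  show ?thesis
    using emin_points_ge[OF n p] points_upper emin_lower emin_upper emin_at_ge[OF n] at_upper
    by (intro conjI allI impI ballI) auto
qed

end
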